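(* Let $n\ge 2$ and let $f:\mathbb{R}^{2n}\to(0,\infty)$ be an even, positive, continuous function. For closed bounded $R_\theta$-invariant sets $D\subset\mathbb{R}^{2n}$ and $(2n-2)$-dimensional linear subspaces $H$, put $\mu(D)=\int_D f(x)\,dx$ and $\mu(D\cap H)=\int_{D\cap H} f(x)\,dx$. (a) If $n\le 3$, then for all origin symmetric convex bodies $K,L\subset\mathbb{R}^{2n}$ that are invariant with respect to all $R_\theta$ and satisfy $\mu(K\cap H_\xi)\le\mu(L\cap H_\xi)$ for every $\xi\in S^{2n-1}$, one has $\mu(K)\le\mu(L)$. (b) If $n\ge 4$, this implication fails: there exist origin symmetric convex bodies $K,L\subset\mathbb{R}^{2n}$, invariant with respect to all $R_\theta$, such that $\mu(K\cap H_\xi)\le\mu(L\cap H_\xi)$ for every $\xi\in S^{2n-1}$, but $\mu(K)>\mu(L)$.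
   Context: Identify $\mathbb{C}^n$ with $\mathbb{R}^{2n}$ via $(\xi_{11}+i\xi_{12},\ldots,\xi_{n1}+i\xi_{n2})\mapsto(\xi_{11},\xi_{12},\ldots,\xi_{n1},\xi_{n2})$. For $\xi\in\mathbb{C}^n$ with $|\xi|=1$ (equivalently $\xi\in S^{2n-1}$), $H_\xi=\{z\in\mathbb{C}^n:\sum_{k=1}^n z_k\overline{\xi_k}=0\}$; under the identification it is the $(2n-2)$-dimensional subspace of $\mathbb{R}^{2n}$ orthogonal to $\xi$ and to $\xi^\perp=(-\xi_{12},\xi_{11},\ldots,-\xi_{n2},\xi_{n1})$. Integrals over $D\cap H$ are with respect to $(2n-2)$-dimensional Lebesgue measure on $H$. For $\theta\in[0,2\pi]$, $R_\theta$ is the counterclockwise rotation of $\mathbb{R}^2$ by angle $\theta$ about the origin; it acts on $\mathbb{R}^{2n}$ by $R_\theta x=(R_\theta(x_{11},x_{12}),\ldots,R_\theta(x_{n1},x_{n2}))$. A set $D\subset\mathbb{R}^{2n}$ is invariant with respect to all $R_\theta$ ($R_\theta$-invariant) if $R_\theta D=D$ for all $\theta\in[0,2\pi]$. For an origin symmetric convex body $K$ (compact convex set with nonempty interior, $K=-K$) this means $\|R_\theta x\|_K=\|x\|_K$ for all $x$ and $\theta$, where $\|x\|_K=\min\{\alpha\ge0:x\in\alpha K\}$. *)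

theory Defs
  imports "HOL-Analysis.Analysis"
begin

text \<open>
  The space \<open>\<complex>\<^sup>n\<close>, identified with \<open>\<real>\<^sup>2\<^sup>n\<close>, is the type \<open>complex ^ 'n\<close> with \<open>n = CARD('n)\<close>. Its norm, inner
  product (\<open>\<bullet>\<close>, real valued) and Lebesgue measure \<open>lborel\<close> in the library are those of
  \<open>\<real>\<^sup>2\<^sup>n\<close>, the coordinates being the real and imaginary parts of the components.
\<close>

definition rotate_all :: "real \<Rightarrow> complex ^ 'n \<Rightarrow> complex ^ 'n" where
  "rotate_all \<theta> x = (\<chi> k. cis \<theta> * x $ k)"

definition rotation_invariant :: "(complex ^ 'n) set \<Rightarrow> bool" where
  "rotation_invariant D \<longleftrightarrow> (\<forall>\<theta>\<in>{0..2 * pi}. rotate_all \<theta> ` D = D)"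

definition complex_hyperplane :: "complex ^ 'n \<Rightarrow> (complex ^ 'n) set" where
  "complex_hyperplane \<xi> = {z. (\<Sum>k\<in>UNIV. z $ k * cnj (\<xi> $ k)) = 0}"

definition origin_symmetric_convex_body :: "'a::euclidean_space set \<Rightarrow> bool" where
  "origin_symmetric_convex_body K \<longleftrightarrow>
     compact K \<and> convex K \<and> interior K \<noteq> {} \<and> uminus ` K = K"

definition orthonormal_basis_of :: "'a::euclidean_space set \<Rightarrow> 'a set \<Rightarrow> bool" where
  "orthonormal_basis_of H B \<longleftrightarrow>
     finite B \<and> pairwise orthogonal B \<and> (\<forall>b\<in>B. norm b = 1) \<and> span B = H"

lemma orthonormal_basis_of_exists:
  assumes "subspace H"
  shows "\<exists>B. orthonormal_basis_of H B"
  using orthonormal_basis_subspace[OF assms] independent_imp_finite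
  unfolding orthonormal_basis_of_def by metis

lemma subspace_complex_hyperplane: "subspace (complex_hyperplane \<xi>)"
  unfolding subspace_def complex_hyperplane_def
  by (auto simp: distrib_right sum.distrib simp flip: scaleR_right.sum)

text \<open>
  Lebesgue measure of dimension \<open>dim H\<close> on a linear subspace \<open>H\<close>, as a Borel measure on the ambient
  space: the image of the product Lebesgue measure on coordinates with respect to an orthonormal basis
  of \<open>H\<close> (compare the construction of \<open>lborel\<close> in the library). By orthogonal invariance of Lebesgue
  measure the choice of the basis is immaterial.
\<close>

definition subspace_lborel :: "'a::euclidean_space set \<Rightarrow> 'a measure" where
  "subspace_lborel H =
     (let B = (SOME B. orthonormal_basis_of H B)
      in distr (\<Pi>\<^sub>M b\<in>B. (lborel :: real measure)) borel (\<lambda>c. \<Sum>b\<in>B. c b *\<^sub>R b))"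

definition mu :: "('a::euclidean_space \<Rightarrow> real) \<Rightarrow> 'a set \<Rightarrow> real" where
  "mu f D = (LINT x:D|lborel. f x)"

definition mu_section :: "('a::euclidean_space \<Rightarrow> real) \<Rightarrow> 'a set \<Rightarrow> 'a set \<Rightarrow> real" where
  "mu_section f D H = (LINT x:D \<inter> H|subspace_lborel H. f x)"

end

theory Submission
  imports Defs
begin

text \<open>
  Write \<open>n = CARD('n)\<close>, let \<open>\<langle>x, z\<rangle>\<close> be the Hermitian product and \<open>H\<^sub>z\<close> the complex hyperplane orthogonal to \<open>z\<close>.

  \<^bold>\<open>The case of \<open>n = 2, 3\<close>.\<close> Let \<open>\<Phi> = f (1\<^sub>L - 1\<^sub>K)\<close>. The assumption on sections says that the integral of \<open>\<Phi>\<close>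
  over every complex hyperplane is nonnegative. The heart of the matter is that then the integral of
  \<open>\<Phi>(z) / \<parallel>z\<parallel>\<^sub>K\<^sup>2\<close> is nonnegative as well (\<open>weighted_volume_nonneg\<close>), in other words that the function
  \<open>\<parallel>\<cdot>\<parallel>\<^sub>K\<^sup>-\<^sup>2\<close> acts like a positive superposition of hyperplane integrals. This suffices: \<open>\<Phi> \<le> 0\<close> on \<open>K\<close>, where
  \<open>\<parallel>z\<parallel>\<^sub>K\<^sup>-\<^sup>2 \<ge> 1\<close>, and \<open>\<Phi> \<ge> 0\<close> outside of \<open>K\<close>, where \<open>\<parallel>z\<parallel>\<^sub>K\<^sup>-\<^sup>2 \<le> 1\<close>; hence \<open>\<Phi> \<ge> \<Phi> / \<parallel>\<cdot>\<parallel>\<^sub>K\<^sup>2\<close> pointwise and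
  \<open>\<mu>(L) - \<mu>(K) = \<integral>\<Phi> \<ge> 0\<close> (\<open>mu_le_if_sections_le\<close>).

  The superposition is produced without Fourier analysis. Let \<open>\<psi>\<close> be an even log-concave function of \<open>\<parallel>\<cdot>\<parallel>\<^sub>K\<close>. By
  the Prekopa--Leindler inequality the integrals of \<open>\<psi>\<close> over the translates of \<open>H\<^sub>y\<close> decrease when the translate
  moves away from the origin. Averaging them with a Gaussian weight of variance proportional to \<open>s\<close> therefore gives
  more than averaging with four times that variance (\<open>integral_kern_antimono\<close>). Multiply this nonnegative difference by the integral of
  \<open>\<Phi>\<close> over \<open>H\<^sub>y\<close>, itself a limit of Gaussian averages, and integrate over all directions \<open>y\<close> with a Gaussian weight:
  the result is nonnegative (\<open>kernel_difference_nonneg\<close>). On the other hand, exchanging the integrations leaves a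
  Gaussian integral over \<open>y\<close> with an explicit value (\<open>nn_integral_two_kernels\<close>), and the result becomes, up to a constant, the integral of
  \<open>\<Phi>(z) \<psi>(x) / \<bar>z\<bar>\<^sup>2\<close> against \<open>1 / ((s + \<bar>h\<bar>\<^sup>2) (4 s + \<bar>h\<bar>\<^sup>2))\<close>, where \<open>h\<close> is the projection of \<open>x\<close> to \<open>H\<^sub>z\<close>. As
  \<open>s\<close> tends to \<open>0\<close> this weight tends to \<open>\<bar>h\<bar>\<^sup>-\<^sup>4\<close>, which is not integrable at the origin of \<open>H\<^sub>z\<close>, a space of real
  dimension \<open>2 (n - 1) \<le> 4\<close>. So the weight, once normalised, concentrates on the complex line through
  \<open>z\<close> (\<open>section_kernel_mean\<close>); there \<open>\<psi>\<close> is radial by rotation invariance, and its integral over that line is a constant multiple of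
  \<open>\<bar>z\<bar>\<^sup>2 / \<parallel>z\<parallel>\<^sub>K\<^sup>2\<close>.

  \<^bold>\<open>The case of \<open>n \<ge> 4\<close>.\<close> The counterexample is a pair of bodies of revolution about a complex line, described by
  \<open>a = \<bar>\<langle>x, e\<rangle>\<bar>\<^sup>2\<close> and \<open>b = \<bar>x\<bar>\<^sup>2 - a\<close>. With \<open>m = n - 2\<close>, the volume of \<open>{a \<le> A, b + C a \<le> B}\<close> is proportional to the integral of
  \<open>(B - C a)\<^sub>+\<^sup>m\<^sup>+\<^sup>1\<close> over \<open>[0, A]\<close>, and its sections are proportional to the integrals of \<open>(B - (C + \<kappa>) a)\<^sub>+\<^sup>m\<close> with \<open>\<kappa> \<ge> 0\<close>
  depending on the direction only (or to \<open>B\<^sup>m\<^sup>+\<^sup>1\<close>, for the hyperplane orthogonal to the line). Start from the cylinder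
  \<open>A = B = 1, C = 0\<close>; tapering and lengthening it slightly, one can
  decrease the volume to first order while no section decreases to first order
  (\<open>profile_integral_perturbed_ge\<close>, \<open>profile_integral_perturbed_volume\<close>), because the exponents \<open>m\<close> and \<open>m + 1\<close> differ. Strict
  inequalities with a margin follow after shrinking the cylinder slightly (\<open>exists_counterexample_profile\<close>). Finally, shrinking both
  bodies towards the origin makes \<open>f\<close> almost constant on them, so that the comparison of Lebesgue
  measures carries over to \<open>\<mu>\<close> (\<open>exists_counterexample\<close>).
\<close>

section \<open>Lebesgue measure in orthonormal coordinates\<close>

interpretation lebesgue_product: product_sigma_finite "\<lambda>_. lborel :: real measure"
  by standard

definition basis_measure :: "'a::euclidean_space set \<Rightarrow> 'a measure" where
  "basis_measure B = distr (\<Pi>\<^sub>M b\<in>B. (lborel :: real measure)) borel (\<lambda>c. \<Sum>b\<in>B. c b *\<^sub>R b)"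

lemma sets_basis_measure [simp, measurable_cong]: "sets (basis_measure B) = sets borel"
  and space_basis_measure [simp]: "space (basis_measure B) = UNIV"
  by (simp_all add: basis_measure_def)

lemma combination_measurable [measurable]:
  "(\<lambda>c. \<Sum>b\<in>B. c b *\<^sub>R b) \<in> measurable (Pi\<^sub>M B (\<lambda>_. lborel :: real measure)) (borel :: 'a::euclidean_space measure)"
  by measurable

text \<open>
  The maps \<open>x \<mapsto> v \<plusminus> x\<close>, written in coordinates: translations and the point
  reflection are the only isometries that the uniqueness argument below and the symmetry of parallel sections use.
\<close>

lemma PiM_lborel_isometry:
  assumes B: "finite B" and s: "\<bar>s\<bar> = (1::real)"
  shows "distr (Pi\<^sub>M B (\<lambda>_. lborel)) (Pi\<^sub>M B (\<lambda>_. lborel)) (\<lambda>c. \<lambda>b\<in>B. t b + s * c b) =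
           Pi\<^sub>M B (\<lambda>_. lborel :: real measure)"
    (is "distr ?M ?M ?T = ?M")
proof (rule lebesgue_product.PiM_eqI[OF B])
  fix A :: "'a \<Rightarrow> real set" assume A: "\<And>b. b \<in> B \<Longrightarrow> A b \<in> sets lborel"
  have [measurable]: "?T \<in> measurable ?M ?M" by measurable
  have "emeasure (distr ?M ?M ?T) (Pi\<^sub>E B A) = emeasure ?M (?T -` (Pi\<^sub>E B A) \<inter> space ?M)"
    using A B by (intro emeasure_distr) (auto intro!: sets_PiM_I_finite)
  also have "?T -` (Pi\<^sub>E B A) \<inter> space ?M = Pi\<^sub>E B (\<lambda>b. (\<lambda>x. t b + s * x) -` A b)"
    by (auto simp: space_PiM PiE_iff)
  also have "emeasure ?M \<dots> = (\<Prod>b\<in>B. emeasure lborel ((\<lambda>x. t b + s * x) -` A b))"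
    using A B measurable_sets[of "\<lambda>x. t _ + s * x" borel borel "A _"]
    by (intro lebesgue_product.emeasure_PiM) auto
  also have "\<dots> = (\<Prod>b\<in>B. emeasure lborel (A b))"
  proof (rule prod.cong)
    fix b assume "b \<in> B"
    have "lborel = distr lborel borel (\<lambda>x. t b + s * x)"
      using lborel_real_affine[of s "t b"] s by (auto simp: density_1)
    moreover have "emeasure (distr lborel borel (\<lambda>x. t b + s * x)) (A b) = emeasure lborel ((\<lambda>x. t b + s * x) -` A b)"
      using A[OF \<open>b \<in> B\<close>] by (subst emeasure_distr) auto
    ultimately show "emeasure lborel ((\<lambda>x. t b + s * x) -` A b) = emeasure lborel (A b)" by metis
  qed simp
  finally show "emeasure (distr ?M ?M ?T) (Pi\<^sub>E B A) = (\<Prod>b\<in>B. emeasure lborel (A b))" .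
qed simp

lemma nn_integral_basis_measure:
  assumes "F \<in> borel_measurable borel"
  shows "(\<integral>\<^sup>+ x. F x \<partial>basis_measure B) = (\<integral>\<^sup>+ c. F (\<Sum>b\<in>B. c b *\<^sub>R b) \<partial>(Pi\<^sub>M B (\<lambda>_. lborel :: real measure)))"
  unfolding basis_measure_def using assms by (subst nn_integral_distr) auto

lemma nn_integral_basis_measure_isometry:
  fixes v :: "'a::euclidean_space"
  assumes B: "finite B" and s: "\<bar>s\<bar> = (1::real)" and v: "v \<in> span B"
    and F [measurable]: "F \<in> borel_measurable borel"
  shows "(\<integral>\<^sup>+ x. F (v + s *\<^sub>R x) \<partial>basis_measure B) = (\<integral>\<^sup>+ x. F x \<partial>basis_measure B)"
proof -
  obtain t where t: "v = (\<Sum>b\<in>B. t b *\<^sub>R b)" using v span_finite[OF B] by auto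
  let ?M = "Pi\<^sub>M B (\<lambda>_. lborel :: real measure)"
  have "(\<integral>\<^sup>+ x. F x \<partial>basis_measure B) = (\<integral>\<^sup>+ c. F (\<Sum>b\<in>B. c b *\<^sub>R b) \<partial>?M)"
    by (rule nn_integral_basis_measure) fact
  also have "\<dots> = (\<integral>\<^sup>+ c. F (\<Sum>b\<in>B. c b *\<^sub>R b) \<partial>distr ?M ?M (\<lambda>c. \<lambda>b\<in>B. t b + s * c b))"
    using PiM_lborel_isometry[OF B s, of t] by simp
  also have "\<dots> = (\<integral>\<^sup>+ c. F (\<Sum>b\<in>B. (\<lambda>b\<in>B. t b + s * c b) b *\<^sub>R b) \<partial>?M)"
    by (subst nn_integral_distr) auto
  also have "\<dots> = (\<integral>\<^sup>+ c. F (v + s *\<^sub>R (\<Sum>b\<in>B. c b *\<^sub>R b)) \<partial>?M)"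
    by (intro nn_integral_cong)
       (simp add: t scaleR_sum_right flip: sum.distrib scaleR_add_left cong: sum.cong)
  also have "\<dots> = (\<integral>\<^sup>+ x. F (v + s *\<^sub>R x) \<partial>basis_measure B)"
    by (subst nn_integral_basis_measure) auto
  finally show ?thesis by simp
qed

lemma norm_combination:
  assumes "orthonormal_basis_of H B"
  shows "(norm (\<Sum>b\<in>B. c b *\<^sub>R b))\<^sup>2 = (\<Sum>b\<in>B. (c b)\<^sup>2)"
proof -
  have "(norm (\<Sum>b\<in>B. c b *\<^sub>R b))\<^sup>2 = (\<Sum>b\<in>B. (norm (c b *\<^sub>R b))\<^sup>2)"
    using assms by (intro norm_sum_Pythagorean)
      (auto simp: orthonormal_basis_of_def pairwise_def orthogonal_def)
  then show ?thesis using assms by (simp add: orthonormal_basis_of_def power_mult_distrib)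
qed

text \<open>
  This is where orthonormality enters: the volume of a ball depends only on the number of basis vectors, which
  fixes the constant in the uniqueness argument below.
\<close>

lemma emeasure_basis_measure_cball:
  assumes "orthonormal_basis_of H B" "r > 0"
  shows "emeasure (basis_measure B) (cball 0 r) = ennreal (unit_ball_vol (card B) * r ^ card B)"
proof -
  have "emeasure (basis_measure B) (cball 0 r) =
      emeasure (Pi\<^sub>M B (\<lambda>_. lborel)) ((\<lambda>c. \<Sum>b\<in>B. c b *\<^sub>R b) -` cball 0 r \<inter> space (Pi\<^sub>M B (\<lambda>_. lborel :: real measure)))"
    unfolding basis_measure_def by (subst emeasure_distr) auto
  also have "(\<lambda>c. \<Sum>b\<in>B. c b *\<^sub>R b) -` cball 0 r = {c. sqrt (\<Sum>b\<in>B. (c b)\<^sup>2) \<le> r}"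
    by (auto simp: norm_combination[OF assms(1), symmetric])
  finally show ?thesis
    using emeasure_cball_aux[of B r] assms by (simp add: orthonormal_basis_of_def)
qed

lemma sigma_finite_basis_measure:
  assumes "orthonormal_basis_of H B"
  shows "sigma_finite_measure (basis_measure B)"
proof
  let ?A = "range (\<lambda>i::nat. cball 0 (real i + 1))"
  have "\<exists>i::nat. norm x \<le> real i + 1" for x :: 'a
    using real_arch_simple[of "norm x"] by (meson add_increasing2 order.trans zero_le_one)
  then show "\<exists>A. countable A \<and> A \<subseteq> sets (basis_measure B) \<and> \<Union>A = space (basis_measure B) \<and>
      (\<forall>a\<in>A. emeasure (basis_measure B) a \<noteq> \<infinity>)"
    by (intro exI[of _ ?A]) (auto simp: emeasure_basis_measure_cball[OF assms])
qed

text \<open>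
  Uniqueness of Haar measure, by Fubini. With \<open>U\<close> the unit ball, evaluate the double integral of
  \<open>1\<^sub>U(y) 1\<^sub>A(y + x)\<close> in the two variables: integrating first over \<open>x\<close> uses
  the invariance of \<open>lborel\<close> and gives \<open>lborel(A) \<nu>(U)\<close>; replacing \<open>y\<close>
  by \<open>y - x\<close> first uses the invariance of \<open>\<nu>\<close> and gives \<open>lborel(U)
  \<nu>(A)\<close>. The two measures agree on \<open>U\<close>, so they agree on \<open>A\<close>.
\<close>

lemma lborel_eq_basis_measure:
  fixes B :: "'a::euclidean_space set"
  assumes B: "orthonormal_basis_of UNIV B"
  shows "lborel = basis_measure B"
proof (rule measure_eqI)
  fix A :: "'a set" assume "A \<in> sets lborel"
  then have [measurable]: "A \<in> sets borel" by simp
  let ?\<nu> = "basis_measure B" and ?C = "cball 0 1 :: 'a set"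
  interpret \<nu>: sigma_finite_measure ?\<nu> using B by (rule sigma_finite_basis_measure)
  interpret P: pair_sigma_finite lborel ?\<nu> ..
  have [measurable]: "?C \<in> sets borel" by simp
  have sets_eq: "sets (lborel \<Otimes>\<^sub>M ?\<nu>) = sets (borel \<Otimes>\<^sub>M borel)"
    by (intro sets_pair_measure_cong) auto
  have fin: "finite B" and spn: "x \<in> span B" for x using B by (auto simp: orthonormal_basis_of_def)
  have card: "card B = DIM('a)"
  proof -
    have "independent B"
      using B by (intro pairwise_orthogonal_independent) (auto simp: orthonormal_basis_of_def)
    then show ?thesis using B dim_eq_card_independent[of B] dim_span[of B]
      by (simp add: orthonormal_basis_of_def)
  qed
  have lb: "(\<integral>\<^sup>+ x. F (v + s *\<^sub>R x) \<partial>lborel) = (\<integral>\<^sup>+ x. F x \<partial>lborel)"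
    if "\<bar>s\<bar> = 1" "F \<in> borel_measurable borel" for F :: "'a \<Rightarrow> ennreal" and v s
  proof -
    have "lborel = distr lborel borel (\<lambda>x. v + s *\<^sub>R x)"
      using lborel_affine[of s v] that by (auto simp: density_1)
    then have "(\<integral>\<^sup>+ x. F x \<partial>lborel) = (\<integral>\<^sup>+ x. F x \<partial>distr lborel borel (\<lambda>x. v + s *\<^sub>R x))" by metis
    then show ?thesis using that by (simp add: nn_integral_distr)
  qed
  have "emeasure lborel A * emeasure ?\<nu> ?C = (\<integral>\<^sup>+ y. indicator ?C y * (\<integral>\<^sup>+ x. indicator A (y + 1 *\<^sub>R x) \<partial>lborel) \<partial>?\<nu>)"
    by (subst lb) (auto simp: mult.commute[of "indicator _ _"] nn_integral_cmult_indicator)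
  also have "\<dots> = (\<integral>\<^sup>+ y. \<integral>\<^sup>+ x. indicator ?C y * indicator A (y + x) \<partial>lborel \<partial>?\<nu>)"
    by (subst nn_integral_cmult[symmetric]) auto
  also have "\<dots> = (\<integral>\<^sup>+ x. \<integral>\<^sup>+ y. indicator ?C y * indicator A (y + x) \<partial>?\<nu> \<partial>lborel)"
    by (rule P.Fubini', subst measurable_cong_sets[OF sets_eq refl]) measurable
  also have "\<dots> = (\<integral>\<^sup>+ x. \<integral>\<^sup>+ y. indicator ?C ((- x) + 1 *\<^sub>R y) * indicator A ((- x) + 1 *\<^sub>R y + x) \<partial>?\<nu> \<partial>lborel)"
    by (intro nn_integral_cong nn_integral_basis_measure_isometry[OF fin _ spn, symmetric]) auto
  also have "\<dots> = (\<integral>\<^sup>+ x. \<integral>\<^sup>+ y. indicator ?C (y - x) * indicator A y \<partial>?\<nu> \<partial>lborel)"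
    by simp
  also have "\<dots> = (\<integral>\<^sup>+ y. \<integral>\<^sup>+ x. indicator ?C (y - x) * indicator A y \<partial>lborel \<partial>?\<nu>)"
    by (rule P.Fubini'[symmetric], subst measurable_cong_sets[OF sets_eq refl]) measurable
  also have "\<dots> = (\<integral>\<^sup>+ y. (\<integral>\<^sup>+ x. indicator ?C (y + (-1) *\<^sub>R x) \<partial>lborel) * indicator A y \<partial>?\<nu>)"
    by (subst nn_integral_multc[symmetric]) auto
  also have "\<dots> = emeasure lborel ?C * emeasure ?\<nu> A"
    by (subst lb) (auto simp: nn_integral_cmult)
  also have "emeasure lborel ?C = emeasure ?\<nu> ?C"
    using emeasure_basis_measure_cball[OF B, of 1] emeasure_cball[of 1 "0::'a"] card by simp
  finally have "emeasure ?\<nu> ?C * emeasure lborel A = emeasure ?\<nu> ?C * emeasure ?\<nu> A"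
    by (simp add: mult.commute)
  moreover have "emeasure ?\<nu> ?C \<noteq> 0" "emeasure ?\<nu> ?C \<noteq> \<infinity>"
    using emeasure_basis_measure_cball[OF B, of 1] by (auto simp: ennreal_eq_0_iff not_le)
  ultimately show "emeasure lborel A = emeasure ?\<nu> A"
    by (auto simp: ennreal_mult_cancel_left)
qed simp

section \<open>Hermitian geometry and integration along complex hyperplanes\<close>

definition hprod :: "complex ^ 'n \<Rightarrow> complex ^ 'n \<Rightarrow> complex" where
  "hprod x y = (\<Sum>k\<in>UNIV. x $ k * cnj (y $ k))"

lemma hprod_add_left: "hprod (x + y) z = hprod x z + hprod y z"
  and hprod_add_right: "hprod z (x + y) = hprod z x + hprod z y"
  and hprod_diff_left: "hprod (x - y) z = hprod x z - hprod y z"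
  and hprod_diff_right: "hprod z (x - y) = hprod z x - hprod z y"
  and hprod_minus_left: "hprod (- x) z = - hprod x z"
  and hprod_scale_left: "hprod (c *s x) z = c * hprod x z"
  and hprod_scale_right: "hprod z (c *s x) = cnj c * hprod z x"
  and hprod_scaleR_left: "hprod (r *\<^sub>R x) z = of_real r * hprod x z"
  and hprod_scaleR_right: "hprod z (r *\<^sub>R x) = of_real r * hprod z x"
  and hprod_zero_left [simp]: "hprod 0 z = 0"
  and hprod_zero_right [simp]: "hprod z 0 = 0"
  by (simp_all add: hprod_def algebra_simps sum.distrib sum_subtractf sum_negf sum_distrib_left
        scaleR_conv_of_real[where 'a = complex])

lemma hprod_commute: "hprod x y = cnj (hprod y x)"
  by (simp add: hprod_def mult.commute)

lemma Re_hprod: "Re (hprod x y) = x \<bullet> y"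
  by (simp add: hprod_def inner_vec_def inner_complex_def)

lemma Im_hprod: "Im (hprod x y) = x \<bullet> (\<i> *s y)"
  by (simp flip: Re_hprod add: hprod_scale_right)

lemma hprod_self: "hprod x x = of_real ((norm x)\<^sup>2)"
proof (rule complex_eqI)
  show "Re (hprod x x) = Re (of_real ((norm x)\<^sup>2))" by (simp only: Re_hprod dot_square_norm Re_complex_of_real)
  show "Im (hprod x x) = Im (of_real ((norm x)\<^sup>2))" by (simp add: hprod_def mult.commute)
qed

lemma mem_complex_hyperplane: "z \<in> complex_hyperplane \<xi> \<longleftrightarrow> hprod z \<xi> = 0"
  by (simp add: complex_hyperplane_def hprod_def)

lemma norm_hprod_commute: "cmod (hprod x y) = cmod (hprod y x)"
  by (metis hprod_commute complex_mod_cnj)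

lemma norm_smult: "norm (c *s (x :: complex ^ 'n)) = cmod c * norm x"
proof -
  have "hprod (c *s x) (c *s x) = c * cnj c * hprod x x"
    by (simp add: hprod_scale_left hprod_scale_right)
  then have "of_real ((norm (c *s x))\<^sup>2) = c * cnj c * of_real ((norm x)\<^sup>2)"
    by (simp only: hprod_self)
  also have "\<dots> = complex_of_real ((cmod c * norm x)\<^sup>2)"
    by (simp only: complex_norm_square[symmetric] of_real_mult power_mult_distrib)
  finally have "(norm (c *s x))\<^sup>2 = (cmod c * norm x)\<^sup>2" by (simp only: of_real_eq_iff)
  then show ?thesis by (simp add: power2_eq_iff_nonneg)
qed

lemma Re_Im_smult: "u *s z = Re u *\<^sub>R z + Im u *\<^sub>R (\<i> *s (z :: complex ^ 'n))"
  by (simp add: vec_eq_iff complex_eq_iff)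

lemma continuous_hprod [continuous_intros]:
  "continuous_on S f \<Longrightarrow> continuous_on S g \<Longrightarrow> continuous_on S (\<lambda>x. hprod (f x) (g x))"
  unfolding hprod_def by (intro continuous_intros)

lemma continuous_smult [continuous_intros]:
  "continuous_on S f \<Longrightarrow> continuous_on S g \<Longrightarrow> continuous_on S (\<lambda>x. f x *s (g x :: complex ^ 'n))"
  unfolding Re_Im_smult[of "f _"] vector_scalar_mult_def
  by (intro continuous_intros)

lemma measurable_hprod [measurable (raw)]:
  assumes "f \<in> borel_measurable M" "g \<in> borel_measurable M"
  shows "(\<lambda>x. hprod (f x) (g x)) \<in> borel_measurable M"
  using assms by (rule borel_measurable_continuous_Pair) (intro continuous_intros)

lemma measurable_smult [measurable (raw)]:
  assumes "f \<in> borel_measurable M" "g \<in> borel_measurable M"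
  shows "(\<lambda>x. f x *s (g x :: complex ^ 'n)) \<in> borel_measurable M"
  using assms by (rule borel_measurable_continuous_Pair) (intro continuous_intros)

definition hproj :: "complex ^ 'n \<Rightarrow> complex ^ 'n \<Rightarrow> complex ^ 'n" where
  "hproj z x = x - hprod x z *s z"

lemma hprod_hproj: "norm z = 1 \<Longrightarrow> hprod (hproj z x) z = 0"
  by (simp add: hproj_def hprod_diff_left hprod_scale_left hprod_self)

lemma hproj_mem: "norm z = 1 \<Longrightarrow> hproj z x \<in> complex_hyperplane z"
  by (simp add: mem_complex_hyperplane hprod_hproj)

lemma norm_add_smult:
  assumes "norm z = 1" "hprod h z = 0"
  shows "(norm (h + u *s z))\<^sup>2 = (norm h)\<^sup>2 + (cmod u)\<^sup>2"
proof -
  have "of_real ((norm (h + u *s z))\<^sup>2) = hprod h h + u * cnj u * hprod z z"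
    using assms hprod_commute[of z h]
    by (simp only: hprod_self[symmetric] hprod_add_left hprod_add_right hprod_scale_left hprod_scale_right) simp
  also have "\<dots> = (of_real ((norm h)\<^sup>2 + (cmod u)\<^sup>2) :: complex)"
    using assms by (simp only: complex_norm_square[symmetric] hprod_self) simp
  finally have "of_real ((norm (h + u *s z))\<^sup>2) = (of_real ((norm h)\<^sup>2 + (cmod u)\<^sup>2) :: complex)" .
  then show ?thesis by (simp only: of_real_eq_iff)
qed

lemma norm_hproj:
  assumes "norm z = 1"
  shows "(norm (hproj z x))\<^sup>2 = (norm x)\<^sup>2 - (cmod (hprod x z))\<^sup>2"
  using norm_add_smult[OF assms hprod_hproj[OF assms], of x "hprod x z"] by (simp add: hproj_def)

lemma cmod_hprod_le: "cmod (hprod x z) \<le> norm x * norm (z :: complex ^ 'n)"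
proof (cases "z = 0")
  case False
  define y where "y = (1 / norm z) *\<^sub>R z"
  have y: "norm y = 1" using False by (simp add: y_def)
  have "(cmod (hprod x y))\<^sup>2 \<le> (norm x)\<^sup>2" using norm_hproj[OF y, of x] by (metis diff_ge_0_iff_ge zero_le_power2)
  then have "cmod (hprod x y) \<le> norm x" by (simp add: power2_le_iff_abs_le)
  then show ?thesis using False by (simp add: y_def hprod_scaleR_right norm_mult norm_divide field_simps)
qed simp

lemma nn_integral_basis_measure_insert:
  assumes "finite B" "b \<notin> B" and [measurable]: "F \<in> borel_measurable borel"
  shows "(\<integral>\<^sup>+ x. F x \<partial>basis_measure (insert b B)) =
    (\<integral>\<^sup>+ t. (\<integral>\<^sup>+ x. F (t *\<^sub>R b + x) \<partial>basis_measure B) \<partial>lborel)"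
proof -
  have "(\<integral>\<^sup>+ x. F x \<partial>basis_measure (insert b B)) =
      (\<integral>\<^sup>+ t. \<integral>\<^sup>+ c. F (\<Sum>a\<in>insert b B. (c(b := t)) a *\<^sub>R a) \<partial>Pi\<^sub>M B (\<lambda>_. lborel) \<partial>lborel)"
    by (subst nn_integral_basis_measure, fact, rule lebesgue_product.product_nn_integral_insert_rev)
       (use assms in auto)
  also have "\<dots> = (\<integral>\<^sup>+ t. \<integral>\<^sup>+ c. F (t *\<^sub>R b + (\<Sum>a\<in>B. c a *\<^sub>R a)) \<partial>Pi\<^sub>M B (\<lambda>_. lborel) \<partial>lborel)"
  proof (intro nn_integral_cong)
    fix t and c :: "'a \<Rightarrow> real"
    have "(\<Sum>a\<in>B. (c(b := t)) a *\<^sub>R a) = (\<Sum>a\<in>B. c a *\<^sub>R a)" using assms by (intro sum.cong) auto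
    then show "F (\<Sum>a\<in>insert b B. (c(b := t)) a *\<^sub>R a) = F (t *\<^sub>R b + (\<Sum>a\<in>B. c a *\<^sub>R a))"
      using assms by simp
  qed
  also have "\<dots> = (\<integral>\<^sup>+ t. (\<integral>\<^sup>+ x. F (t *\<^sub>R b + x) \<partial>basis_measure B) \<partial>lborel)"
    by (intro nn_integral_cong, subst nn_integral_basis_measure) auto
  finally show ?thesis .
qed

lemma nn_integral_basis_measure_empty:
  fixes F :: "'a::euclidean_space \<Rightarrow> ennreal"
  assumes [measurable]: "F \<in> borel_measurable borel"
  shows "(\<integral>\<^sup>+ x. F x \<partial>basis_measure {}) = F 0"
proof -
  have "(\<integral>\<^sup>+ x. F x \<partial>basis_measure {}) = (\<integral>\<^sup>+ c. F 0 \<partial>(Pi\<^sub>M ({} :: 'a set) (\<lambda>_. lborel :: real measure)))"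
    by (subst nn_integral_basis_measure) (simp_all del: nn_integral_const)
  then show ?thesis by (simp only: lebesgue_product.nn_integral_empty[OF zero_le])
qed

lemma nn_integral_complex:
  assumes [measurable]: "F \<in> borel_measurable borel"
  shows "(\<integral>\<^sup>+ u. F u \<partial>lborel) = (\<integral>\<^sup>+ s. \<integral>\<^sup>+ t. F (Complex s t) \<partial>lborel \<partial>lborel)"
proof -
  have "u = Re u *\<^sub>R 1 + Im u *\<^sub>R \<i>" for u by (simp add: complex_eq_iff)
  then have "u \<in> span {1, \<i>}" for u
    by (metis span_add span_scale span_base insertI1 insertI2)
  then have "orthonormal_basis_of UNIV {1, \<i>}"
    by (auto simp: orthonormal_basis_of_def pairwise_def orthogonal_def inner_complex_def)
  then have "(\<integral>\<^sup>+ u. F u \<partial>lborel) = (\<integral>\<^sup>+ u. F u \<partial>basis_measure {1, \<i>})"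
    using lborel_eq_basis_measure by metis
  also have "\<dots> = (\<integral>\<^sup>+ s. \<integral>\<^sup>+ t. F (s *\<^sub>R 1 + (t *\<^sub>R \<i> + 0)) \<partial>lborel \<partial>lborel)"
    by (simp add: nn_integral_basis_measure_insert nn_integral_basis_measure_empty)
  also have "\<dots> = (\<integral>\<^sup>+ s. \<integral>\<^sup>+ t. F (Complex s t) \<partial>lborel \<partial>lborel)"
    by (simp add: complex_eq_iff Complex_eq scaleR_conv_of_real mult.commute)
  finally show ?thesis .
qed

text \<open>
  Over the reals, passing from \<open>H \<inter> H\<^sub>z\<close> to \<open>H\<close> adds the two directions
  \<open>z\<close> and \<open>\<i> z\<close>. A general \<open>H\<close> is needed since later a hyperplane is
  itself split in this way.
\<close>

lemma orthonormal_basis_extend_subspace: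
  assumes H: "subspace H" and z: "norm z = 1" and zH: "z \<in> H" "\<i> *s z \<in> H"
    and B: "orthonormal_basis_of (H \<inter> complex_hyperplane z) B"
  shows "orthonormal_basis_of H (insert z (insert (\<i> *s z) B))"
    and "z \<notin> insert (\<i> *s z) B" "\<i> *s z \<notin> B"
proof -
  have spanB: "span B = H \<inter> complex_hyperplane z" using B by (simp add: orthonormal_basis_of_def)
  have perp: "b \<bullet> z = 0" "b \<bullet> (\<i> *s z) = 0" if "b \<in> B" for b
  proof -
    have "b \<in> complex_hyperplane z" using spanB that span_base by blast
    then have "hprod b z = 0" by (simp add: mem_complex_hyperplane)
    then show "b \<bullet> z = 0" "b \<bullet> (\<i> *s z) = 0" using Re_hprod[of b z] Im_hprod[of b z] by simp_all
  qed
  have zz: "z \<bullet> (\<i> *s z) = 0" by (simp flip: Im_hprod add: hprod_self)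
  have ni: "norm (\<i> *s z) = 1" using z by (simp add: norm_smult)
  have "norm b = 0" if "b \<in> B" "b = z \<or> b = \<i> *s z" for b
    using perp[OF that(1)] that(2) by (auto simp: inner_eq_zero_iff)
  then show "\<i> *s z \<notin> B" "z \<notin> insert (\<i> *s z) B"
    using ni z zz by (force, metis insertE inner_eq_zero_iff norm_zero zero_neq_one)
  have comb: "Re c *\<^sub>R z + Im c *\<^sub>R (\<i> *s z) \<in> span (insert z (insert (\<i> *s z) B))" for c
    by (intro span_add span_scale span_base) auto
  have "x \<in> span (insert z (insert (\<i> *s z) B))" if x: "x \<in> H" for x
  proof -
    have "Re (hprod x z) *\<^sub>R z + Im (hprod x z) *\<^sub>R (\<i> *s z) \<in> H"
      using H zH by (intro subspace_add subspace_scale)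
    then have "hproj z x \<in> H" unfolding hproj_def Re_Im_smult[of "hprod x z"] using H x by (intro subspace_diff)
    then have "hproj z x \<in> span B" using spanB hproj_mem[OF z] by simp
    moreover have "span B \<subseteq> span (insert z (insert (\<i> *s z) B))" by (intro span_mono) blast
    moreover have "x = hproj z x + (Re (hprod x z) *\<^sub>R z + Im (hprod x z) *\<^sub>R (\<i> *s z))"
      by (simp add: hproj_def flip: Re_Im_smult)
    ultimately show ?thesis using comb span_add by (metis subsetD)
  qed
  moreover have "span (insert z (insert (\<i> *s z) B)) \<subseteq> H"
    using H zH spanB span_superset[of B] by (intro span_minimal) auto
  ultimately have "span (insert z (insert (\<i> *s z) B)) = H" by blast
  moreover have "pairwise orthogonal (insert z (insert (\<i> *s z) B))"
    using B perp zz by (auto simp: orthonormal_basis_of_def pairwise_insert orthogonal_def inner_commute)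
  ultimately show "orthonormal_basis_of H (insert z (insert (\<i> *s z) B))"
    using B z ni unfolding orthonormal_basis_of_def by blast
qed

lemmas orthonormal_basis_extend =
  orthonormal_basis_extend_subspace[OF subspace_UNIV _ UNIV_I UNIV_I, unfolded Int_UNIV_left]

lemma nn_integral_basis_measure_extend:
  assumes B: "orthonormal_basis_of H B" and new: "z \<notin> insert (\<i> *s z) B" "\<i> *s z \<notin> B"
    and [measurable]: "F \<in> borel_measurable borel"
  shows "(\<integral>\<^sup>+ x. F x \<partial>basis_measure (insert z (insert (\<i> *s z) B))) =
    (\<integral>\<^sup>+ u. \<integral>\<^sup>+ h. F (h + u *s z) \<partial>basis_measure B \<partial>lborel)"
proof -
  have fin: "finite B" using B by (simp add: orthonormal_basis_of_def)
  interpret sigma_finite_measure "basis_measure B" using B by (rule sigma_finite_basis_measure)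
  have "(\<integral>\<^sup>+ x. F x \<partial>basis_measure (insert z (insert (\<i> *s z) B))) =
      (\<integral>\<^sup>+ s. \<integral>\<^sup>+ t. \<integral>\<^sup>+ h. F (s *\<^sub>R z + (t *\<^sub>R (\<i> *s z) + h)) \<partial>basis_measure B \<partial>lborel \<partial>lborel)"
    using new fin by (simp add: nn_integral_basis_measure_insert)
  also have "\<dots> = (\<integral>\<^sup>+ s. \<integral>\<^sup>+ t. \<integral>\<^sup>+ h. F (h + Complex s t *s z) \<partial>basis_measure B \<partial>lborel \<partial>lborel)"
    by (simp add: Re_Im_smult[of "Complex _ _"] add_ac)
  also have "\<dots> = (\<integral>\<^sup>+ u. \<integral>\<^sup>+ h. F (h + u *s z) \<partial>basis_measure B \<partial>lborel)"
  proof (rule nn_integral_complex[symmetric])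
    have "(\<lambda>(u, h). F (h + u *s z)) \<in> borel_measurable (borel \<Otimes>\<^sub>M basis_measure B)"
      by measurable
    then show "(\<lambda>u. \<integral>\<^sup>+ h. F (h + u *s z) \<partial>basis_measure B) \<in> borel_measurable borel"
      by (rule borel_measurable_nn_integral)
  qed
  finally show ?thesis .
qed

lemma nn_integral_split:
  assumes z: "norm z = 1" and B: "orthonormal_basis_of (complex_hyperplane z) B"
    and F: "F \<in> borel_measurable borel"
  shows "(\<integral>\<^sup>+ x. F x \<partial>lborel) = (\<integral>\<^sup>+ u. \<integral>\<^sup>+ h. F (h + u *s z) \<partial>basis_measure B \<partial>lborel)"
  using nn_integral_basis_measure_extend[OF B orthonormal_basis_extend(2,3)[OF z B] F]
    lborel_eq_basis_measure[OF orthonormal_basis_extend(1)[OF z B]] by simp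

lemma nn_integral_complex_scale:
  assumes "c > 0" and [measurable]: "F \<in> borel_measurable borel"
  shows "(\<integral>\<^sup>+ u. F u \<partial>lborel) = ennreal (c\<^sup>2) * (\<integral>\<^sup>+ u. F (of_real c * (u :: complex)) \<partial>lborel)"
proof -
  have "(\<integral>\<^sup>+ u. F u \<partial>lborel) = (\<integral>\<^sup>+ u. F u \<partial>density (distr lborel borel (\<lambda>x. 0 + c *\<^sub>R x)) (\<lambda>_. \<bar>c\<bar>^DIM(complex)))"
    using lborel_affine[of c "0::complex"] assms by simp
  then show ?thesis using assms
    by (simp add: nn_integral_density nn_integral_distr nn_integral_cmult scaleR_conv_of_real)
qed

text \<open>
  The space is the orthogonal sum of \<open>H\<^sub>z\<close> and the complex line through \<open>z\<close>. The
  scale \<open>c\<close> serves the Gaussian averages of width \<open>c\<close> transversal to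
  \<open>H\<^sub>z\<close>, whose limits for \<open>c \<rightarrow> 0\<close> are hyperplane integrals.
\<close>

lemma lborel_split:
  assumes z: "norm z = 1" and B: "orthonormal_basis_of (complex_hyperplane z) B" and c: "c > 0"
  shows "lborel = density (distr (basis_measure B \<Otimes>\<^sub>M lborel) borel (\<lambda>(h, u). h + (of_real c * u) *s z)) (\<lambda>_. ennreal (c\<^sup>2))"
    (is "_ = density (distr ?P borel ?T) _")
proof (rule measure_eqI)
  interpret sigma_finite_measure "basis_measure B" using B by (rule sigma_finite_basis_measure)
  interpret P: pair_sigma_finite "basis_measure B" "lborel :: complex measure" ..
  have [measurable]: "?T \<in> measurable ?P borel" by measurable
  fix A assume "A \<in> sets (lborel :: (complex ^ 'a) measure)"
  then have [measurable]: "A \<in> sets borel" by simp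
  have "emeasure lborel A = (\<integral>\<^sup>+ x. indicator A x \<partial>lborel)" by simp
  also have "\<dots> = (\<integral>\<^sup>+ u. \<integral>\<^sup>+ h. indicator A (h + u *s z) \<partial>basis_measure B \<partial>lborel)"
    by (rule nn_integral_split[OF z B]) measurable
  also have "\<dots> = ennreal (c\<^sup>2) * (\<integral>\<^sup>+ u. \<integral>\<^sup>+ h. indicator A (h + (of_real c * u) *s z) \<partial>basis_measure B \<partial>lborel)"
  proof (rule nn_integral_complex_scale[OF c])
    have "(\<lambda>(u, h). indicator A (h + u *s z)) \<in> borel_measurable (borel \<Otimes>\<^sub>M basis_measure B)"
      by measurable
    then show "(\<lambda>u. \<integral>\<^sup>+ h. indicator A (h + u *s z) \<partial>basis_measure B) \<in> borel_measurable borel"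
      by (rule borel_measurable_nn_integral)
  qed
  also have "(\<integral>\<^sup>+ u. \<integral>\<^sup>+ h. indicator A (h + (of_real c * u) *s z) \<partial>basis_measure B \<partial>lborel) =
      (\<integral>\<^sup>+ p. indicator A (?T p) \<partial>?P)"
    by (subst P.nn_integral_snd[symmetric]) auto
  also have "ennreal (c\<^sup>2) * \<dots> = emeasure (density (distr ?P borel ?T) (\<lambda>_. ennreal (c\<^sup>2))) A"
    by (simp add: emeasure_density nn_integral_cmult nn_integral_distr del: nn_integral_indicator)
  finally show "emeasure lborel A = emeasure (density (distr ?P borel ?T) (\<lambda>_. ennreal (c\<^sup>2))) A" .
qed simp

abbreviation hyperplane_measure :: "complex ^ 'n \<Rightarrow> (complex ^ 'n) measure" where
  "hyperplane_measure z \<equiv> subspace_lborel (complex_hyperplane z)"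

lemma subspace_lborel_basis:
  assumes "subspace H"
  obtains B where "orthonormal_basis_of H B" "subspace_lborel H = basis_measure B"
proof -
  have "orthonormal_basis_of H (SOME B. orthonormal_basis_of H B)"
    using orthonormal_basis_of_exists[OF assms] by (rule someI_ex)
  then show ?thesis using that by (simp add: subspace_lborel_def basis_measure_def Let_def)
qed

lemma sets_subspace_lborel [simp, measurable_cong]: "sets (subspace_lborel H) = sets borel"
  and space_subspace_lborel [simp]: "space (subspace_lborel H) = UNIV"
  by (simp_all add: subspace_lborel_def Let_def)

lemma sigma_finite_hyperplane_measure: "sigma_finite_measure (hyperplane_measure z)"
  by (metis subspace_lborel_basis subspace_complex_hyperplane sigma_finite_basis_measure)

lemma AE_basis_measure_span: "AE x in basis_measure B. x \<in> span B"
  unfolding basis_measure_def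
proof (subst AE_distr_iff)
  show "AE c in Pi\<^sub>M B (\<lambda>_. lborel). (\<Sum>b\<in>B. c b *\<^sub>R b) \<in> span B"
    by (intro AE_I2 span_sum span_scale span_base)
qed (auto simp: closed_subspace borel_closed)

lemma AE_hyperplane_measure: "AE h in hyperplane_measure z. hprod h z = 0"
proof -
  obtain B where B: "orthonormal_basis_of (complex_hyperplane z) B" "hyperplane_measure z = basis_measure B"
    using subspace_lborel_basis[OF subspace_complex_hyperplane] by metis
  show ?thesis unfolding B(2) using AE_basis_measure_span[of B] B(1)
    by (simp add: orthonormal_basis_of_def mem_complex_hyperplane)
qed

text \<open>
  The measure \<open>hyperplane_measure z\<close> lives on the whole space but is concentrated on
  \<open>H\<^sub>z\<close>, so the integrand may be simplified using \<open>hprod h z = 0\<close>.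
\<close>

lemma nn_integral_hyperplane_split:
  assumes z: "norm z = 1" and F [measurable]: "F \<in> borel_measurable borel"
    and eq: "\<And>h u. hprod h z = 0 \<Longrightarrow> F (h + u *s z) = G h u"
  shows "(\<integral>\<^sup>+ x. F x \<partial>lborel) = (\<integral>\<^sup>+ u. \<integral>\<^sup>+ h. G h u \<partial>hyperplane_measure z \<partial>lborel)"
    and "(\<integral>\<^sup>+ x. F x \<partial>lborel) = (\<integral>\<^sup>+ h. \<integral>\<^sup>+ u. G h u \<partial>lborel \<partial>hyperplane_measure z)"
proof -
  obtain B where B: "orthonormal_basis_of (complex_hyperplane z) B" "hyperplane_measure z = basis_measure B"
    using subspace_lborel_basis[OF subspace_complex_hyperplane] by metis
  interpret sigma_finite_measure "hyperplane_measure z" by (rule sigma_finite_hyperplane_measure)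
  interpret P: pair_sigma_finite "hyperplane_measure z" "lborel :: complex measure" ..
  have *: "(\<integral>\<^sup>+ x. F x \<partial>lborel) = (\<integral>\<^sup>+ u. \<integral>\<^sup>+ h. F (h + u *s z) \<partial>hyperplane_measure z \<partial>lborel)"
    using nn_integral_split[OF z B(1) F] B(2) by simp
  also have "\<dots> = (\<integral>\<^sup>+ u. \<integral>\<^sup>+ h. G h u \<partial>hyperplane_measure z \<partial>lborel)"
    using AE_hyperplane_measure[of z] by (intro nn_integral_cong nn_integral_cong_AE) (auto simp: eq)
  finally show "(\<integral>\<^sup>+ x. F x \<partial>lborel) = (\<integral>\<^sup>+ u. \<integral>\<^sup>+ h. G h u \<partial>hyperplane_measure z \<partial>lborel)" .
  have "(\<integral>\<^sup>+ x. F x \<partial>lborel) = (\<integral>\<^sup>+ h. \<integral>\<^sup>+ u. F (h + u *s z) \<partial>lborel \<partial>hyperplane_measure z)"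
    unfolding * by (rule P.Fubini') measurable
  also have "\<dots> = (\<integral>\<^sup>+ h. \<integral>\<^sup>+ u. G h u \<partial>lborel \<partial>hyperplane_measure z)"
    using AE_hyperplane_measure[of z] by (intro nn_integral_cong_AE) (auto elim!: eventually_mono intro!: nn_integral_cong simp: eq)
  finally show "(\<integral>\<^sup>+ x. F x \<partial>lborel) = (\<integral>\<^sup>+ h. \<integral>\<^sup>+ u. G h u \<partial>lborel \<partial>hyperplane_measure z)" .
qed

text \<open>
  The measure on a subspace is defined with a chosen orthonormal basis. The choice does not matter: thickening
  \<open>A\<close> by the unit disc in the direction of \<open>z\<close> gives a cylinder whose Lebesgue measure
  is, for every basis \<open>B\<close>, the \<open>B\<close>-measure of \<open>A\<close> times the area of the
  disc.
\<close>

lemma hyperplane_measure_eq_basis_measure: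
  assumes z: "norm z = 1" and B: "orthonormal_basis_of (complex_hyperplane z) B"
  shows "hyperplane_measure z = basis_measure B"
proof (rule measure_eqI)
  fix A assume "A \<in> sets (hyperplane_measure z)"
  then have [measurable]: "A \<in> sets borel" by simp
  have [measurable]: "cball 0 1 \<in> sets (borel :: complex measure)" by simp
  have cyl: "emeasure lborel {x. hproj z x \<in> A \<and> cmod (hprod x z) \<le> 1} =
      emeasure (basis_measure B') A * emeasure lborel (cball 0 1 :: complex set)"
    if B': "orthonormal_basis_of (complex_hyperplane z) B'" for B'
  proof -
    have [measurable]: "{x. hproj z x \<in> A \<and> cmod (hprod x z) \<le> 1} \<in> sets borel"
      unfolding hproj_def by measurable
    have AE: "AE h in basis_measure B'. hprod h z = 0"
      using AE_basis_measure_span[of B'] B' by (simp add: orthonormal_basis_of_def mem_complex_hyperplane)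
    have eq: "indicator {x. hproj z x \<in> A \<and> cmod (hprod x z) \<le> 1} (h + u *s z) = (indicator A h * indicator (cball 0 1) u :: ennreal)"
      if "hprod h z = 0" for h u
      using that z by (simp add: hproj_def hprod_add_left hprod_scale_left hprod_self indicator_def)
    have "emeasure lborel {x. hproj z x \<in> A \<and> cmod (hprod x z) \<le> 1} =
      (\<integral>\<^sup>+ u. \<integral>\<^sup>+ h. indicator {x. hproj z x \<in> A \<and> cmod (hprod x z) \<le> 1} (h + u *s z) \<partial>basis_measure B' \<partial>lborel)"
      by (subst nn_integral_split[OF z B', symmetric]) auto
    also have "\<dots> = (\<integral>\<^sup>+ u. \<integral>\<^sup>+ h. indicator A h * indicator (cball 0 1 :: complex set) u \<partial>basis_measure B' \<partial>lborel)"
      by (rule nn_integral_cong, rule nn_integral_cong_AE) (use AE in \<open>auto simp: eq\<close>)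
    also have "\<dots> = emeasure (basis_measure B') A * emeasure lborel (cball 0 1 :: complex set)"
      by (simp add: nn_integral_multc nn_integral_cmult_indicator)
    finally show ?thesis .
  qed
  obtain B' where B': "orthonormal_basis_of (complex_hyperplane z) B'" "hyperplane_measure z = basis_measure B'"
    using subspace_lborel_basis[OF subspace_complex_hyperplane] by metis
  have "unit_ball_vol 2 \<noteq> 0" by (metis less_irrefl unit_ball_vol_pos zero_le_numeral)
  then have "emeasure lborel (cball 0 1 :: complex set) \<noteq> 0" "emeasure lborel (cball 0 1 :: complex set) \<noteq> \<infinity>"
    by (auto simp: emeasure_cball)
  then show "emeasure (hyperplane_measure z) A = emeasure (basis_measure B) A"
    using cyl[OF B] cyl[OF B'(1)] B'(2)
    by (simp add: ennreal_mult_cancel_left mult.commute[of _ "emeasure lborel (cball 0 1 :: complex set)"])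
qed simp

lemma card_orthonormal_basis_hyperplane:
  fixes z :: "complex ^ 'n"
  assumes z: "norm z = 1" and B: "orthonormal_basis_of (complex_hyperplane z) B"
  shows "card B = 2 * (CARD('n) - 1)"
proof -
  let ?E = "insert z (insert (\<i> *s z) B)"
  note E = orthonormal_basis_extend[OF z B]
  have "independent ?E"
    using E(1) by (intro pairwise_orthogonal_independent) (auto simp: orthonormal_basis_of_def)
  then have "card ?E = DIM(complex ^ 'n)" using E(1) dim_eq_card_independent[of ?E] dim_span[of ?E]
    by (simp add: orthonormal_basis_of_def)
  moreover have "card ?E = 2 + card B" using E B by (simp add: orthonormal_basis_of_def)
  ultimately show ?thesis by simp
qed

section \<open>Gaussian integrals\<close>

lemma nn_integral_exp:
  assumes "c > 0"
  shows "(\<integral>\<^sup>+ t. ennreal (exp (- (c * t))) * indicator {0..} t \<partial>lborel) = ennreal (1 / c)"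
proof -
  have "((\<lambda>t. exp (- (c * t))) \<longlongrightarrow> 0) at_top"
    using assms by (intro filterlim_compose[OF exp_at_bot] filterlim_uminus_at_bot_at_top filterlim_compose[OF filterlim_uminus_at_bot_at_top]
        filterlim_tendsto_pos_mult_at_top[OF tendsto_const _ filterlim_ident])
  then have "((\<lambda>t. - exp (- (c * t)) / c) \<longlongrightarrow> - 0 / c) at_top"
    using assms by (intro tendsto_intros) auto
  then show ?thesis using assms
    by (subst nn_integral_FTC_atLeast[where F = "\<lambda>t. - exp (- (c * t)) / c" and T = 0])
       (auto intro!: derivative_eq_intros)
qed

text \<open>
  The number \<open>\<surd>\<pi>\<close>. Its value is immaterial; what matters is that it is finite and positive.
\<close>

definition gauss :: real where
  "gauss = enn2real (\<integral>\<^sup>+ t. ennreal (exp (- (t\<^sup>2))) \<partial>lborel)"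

lemma nn_integral_gauss: "(\<integral>\<^sup>+ t. ennreal (exp (- (t\<^sup>2))) \<partial>lborel) = ennreal gauss"
  and gauss_pos: "gauss > 0"
proof -
  have "(\<integral>\<^sup>+ t. ennreal (exp (- (t\<^sup>2))) \<partial>lborel) \<le>
      (\<integral>\<^sup>+ t. ennreal (exp 1) * (ennreal (exp (- (1 * t))) * indicator {0..} t + ennreal (exp (- (1 * (- t)))) * indicator {0..} (- t)) \<partial>lborel)"
  proof (intro nn_integral_mono)
    fix t :: real
    have "- (t\<^sup>2) \<le> 1 - \<bar>t\<bar>" using zero_le_power2[of "\<bar>t\<bar> - 1"] by (simp add: power2_eq_square algebra_simps)
    then have "exp (- (t\<^sup>2)) \<le> exp 1 * exp (- \<bar>t\<bar>)" by (simp flip: exp_add)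
    then have "ennreal (exp (- (t\<^sup>2))) \<le> ennreal (exp 1) * ennreal (exp (- \<bar>t\<bar>))"
      by (simp add: ennreal_leI flip: ennreal_mult)
    also have "ennreal (exp (- \<bar>t\<bar>)) \<le> ennreal (exp (- (1 * t))) * indicator {0..} t + ennreal (exp (- (1 * (- t)))) * indicator {0..} (- t)"
      by (cases "t \<ge> 0") auto
    finally show "ennreal (exp (- (t\<^sup>2))) \<le> ennreal (exp 1) * (ennreal (exp (- (1 * t))) * indicator {0..} t + ennreal (exp (- (1 * (- t)))) * indicator {0..} (- t))"
      by (simp add: mult_left_mono)
  qed
  also have "\<dots> = ennreal (exp 1) * (1 + 1)"
    using nn_integral_real_affine[of "\<lambda>t. ennreal (exp (- (1 * t))) * indicator {0..} t" "-1" 0]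
    by (simp add: nn_integral_cmult nn_integral_add nn_integral_exp[of 1, simplified])
  also have "\<dots> < \<infinity>" by (simp add: ennreal_mult_less_top)
  finally have fin: "(\<integral>\<^sup>+ t. ennreal (exp (- (t\<^sup>2))) \<partial>lborel) < \<infinity>" .
  then show "(\<integral>\<^sup>+ t. ennreal (exp (- (t\<^sup>2))) \<partial>lborel) = ennreal gauss" by (simp add: gauss_def)
  have "ennreal (exp (- 1)) = (\<integral>\<^sup>+ t. ennreal (exp (- 1)) * indicator {0..1::real} t \<partial>lborel)"
    by (subst nn_integral_cmult_indicator) auto
  also have "\<dots> \<le> (\<integral>\<^sup>+ t. ennreal (exp (- (t\<^sup>2))) \<partial>lborel)"
    by (intro nn_integral_mono) (auto simp: indicator_def abs_square_le_1 intro!: ennreal_leI)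
  finally have "0 < (\<integral>\<^sup>+ t. ennreal (exp (- (t\<^sup>2))) \<partial>lborel)"
    using ennreal_less_zero_iff exp_gt_zero less_le_trans by blast
  then show "gauss > 0" using fin by (simp add: gauss_def enn2real_positive_iff)
qed

lemma nn_integral_gauss_scaled:
  assumes "c > 0"
  shows "(\<integral>\<^sup>+ t. ennreal (exp (- (c * t\<^sup>2))) \<partial>lborel) = ennreal (gauss / sqrt c)"
proof -
  have "ennreal gauss = ennreal (sqrt c) * (\<integral>\<^sup>+ t. ennreal (exp (- (c * t\<^sup>2))) \<partial>lborel)"
    using nn_integral_real_affine[of "\<lambda>t. ennreal (exp (- (t\<^sup>2)))" "sqrt c" 0] assms
    by (simp add: nn_integral_gauss power_mult_distrib)
  then have "ennreal (1 / sqrt c) * ennreal gauss = (ennreal (1 / sqrt c) * ennreal (sqrt c)) * (\<integral>\<^sup>+ t. ennreal (exp (- (c * t\<^sup>2))) \<partial>lborel)"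
    by (simp only: mult.assoc)
  then show ?thesis using assms gauss_pos by (simp flip: ennreal_mult)
qed

lemma nn_integral_basis_measure_gauss:
  assumes B: "orthonormal_basis_of H B" and c: "c > 0"
  shows "(\<integral>\<^sup>+ x. ennreal (exp (- (c * (norm x)\<^sup>2))) \<partial>basis_measure B) = ennreal ((gauss / sqrt c) ^ card B)"
proof -
  have fin: "finite B" using B by (simp add: orthonormal_basis_of_def)
  have "(\<integral>\<^sup>+ x. ennreal (exp (- (c * (norm x)\<^sup>2))) \<partial>basis_measure B) =
      (\<integral>\<^sup>+ a. (\<Prod>b\<in>B. ennreal (exp (- (c * (a b)\<^sup>2)))) \<partial>Pi\<^sub>M B (\<lambda>_. lborel))"
    by (subst nn_integral_basis_measure)
       (simp_all add: norm_combination[OF B] sum_distrib_left exp_sum[OF fin] prod_ennreal flip: sum_negf)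
  also have "\<dots> = (\<Prod>b\<in>B. \<integral>\<^sup>+ t. ennreal (exp (- (c * t\<^sup>2))) \<partial>lborel)"
    by (rule lebesgue_product.product_nn_integral_prod[OF fin]) measurable
  finally show ?thesis using c gauss_pos by (simp add: nn_integral_gauss_scaled ennreal_power)
qed

lemma nn_integral_gauss_complex:
  assumes "c > 0"
  shows "(\<integral>\<^sup>+ u. ennreal (exp (- (c * (cmod u)\<^sup>2))) \<partial>lborel) = ennreal (gauss\<^sup>2 / c)"
proof -
  have "(\<integral>\<^sup>+ u. ennreal (exp (- (c * (cmod u)\<^sup>2))) \<partial>lborel) =
      (\<integral>\<^sup>+ s. \<integral>\<^sup>+ t. ennreal (exp (- (c * s\<^sup>2))) * ennreal (exp (- (c * t\<^sup>2))) \<partial>lborel \<partial>lborel)"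
    by (subst nn_integral_complex)
       (simp_all add: cmod_power2 algebra_simps flip: ennreal_mult exp_add)
  also have "\<dots> = ennreal (gauss / sqrt c) * ennreal (gauss / sqrt c)"
    using assms by (simp add: nn_integral_cmult nn_integral_multc nn_integral_gauss_scaled)
  also have "\<dots> = ennreal (gauss\<^sup>2 / c)"
    using assms gauss_pos by (simp add: power2_eq_square flip: ennreal_mult)
  finally show ?thesis .
qed

lemma nn_integral_gauss_hyperplane:
  fixes z :: "complex ^ 'n"
  assumes z: "norm z = 1" and c: "c > 0"
  shows "(\<integral>\<^sup>+ h. ennreal (exp (- (c * (norm h)\<^sup>2))) \<partial>hyperplane_measure z) = ennreal ((gauss\<^sup>2 / c) ^ (CARD('n) - 1))"
proof -
  obtain B where B: "orthonormal_basis_of (complex_hyperplane z) B" "hyperplane_measure z = basis_measure B"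
    using subspace_lborel_basis[OF subspace_complex_hyperplane] by metis
  have "card B = 2 * (CARD('n) - 1)" using card_orthonormal_basis_hyperplane[OF z B(1)] .
  then show ?thesis using nn_integral_basis_measure_gauss[OF B(1) c] c
    by (simp add: B(2) power_mult power_divide)
qed

lemma nn_integral_gauss_space:
  fixes c :: real
  assumes c: "c > 0"
  shows "(\<integral>\<^sup>+ x. ennreal (exp (- (c * (norm (x :: complex ^ 'n))\<^sup>2))) \<partial>lborel) = ennreal ((gauss\<^sup>2 / c) ^ CARD('n))"
proof -
  define z :: "complex ^ 'n" where "z = axis undefined 1"
  have z: "norm z = 1" by (simp add: z_def)
  have "(\<integral>\<^sup>+ x. ennreal (exp (- (c * (norm (x :: complex ^ 'n))\<^sup>2))) \<partial>lborel) =
     (\<integral>\<^sup>+ u. \<integral>\<^sup>+ h. ennreal (exp (- (c * (norm h)\<^sup>2))) * ennreal (exp (- (c * (cmod u)\<^sup>2))) \<partial>hyperplane_measure z \<partial>lborel)"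
    using z by (intro nn_integral_hyperplane_split)
      (auto simp: norm_add_smult algebra_simps simp flip: ennreal_mult exp_add)
  also have "\<dots> = ennreal ((gauss\<^sup>2 / c) ^ (CARD('n) - 1)) * ennreal (gauss\<^sup>2 / c)"
    using c by (simp add: nn_integral_cmult nn_integral_multc nn_integral_gauss_hyperplane[OF z c] nn_integral_gauss_complex)
  also have "\<dots> = ennreal ((gauss\<^sup>2 / c) ^ CARD('n))"
    using c power_minus_mult[of "CARD('n)" "gauss\<^sup>2 / c"] zero_less_card_finite[where 'a = 'n]
    by (simp only: ennreal_mult[symmetric] zero_le_power zero_le_divide_iff zero_le_power2 less_imp_le simp_thms)
  finally show ?thesis .
qed

text \<open>
  On the plane of complex numbers the integral of \<open>kern s\<close> is \<open>gauss\<^sup>2\<close> for every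
  \<open>s\<close>. So \<open>kern s (hprod y x)\<close> is, up to a factor depending on \<open>y\<close>, a
  Gaussian approximation of width \<open>\<surd>s / \<bar>y\<bar>\<close> of the measure on
  \<open>H\<^sub>y\<close>.
\<close>

definition kern :: "real \<Rightarrow> complex \<Rightarrow> real" where
  "kern s u = exp (- ((cmod u)\<^sup>2 / s)) / s"

lemma measurable_kern [measurable]: "kern s \<in> borel_measurable borel"
  unfolding kern_def by measurable

lemma kern_nonneg: "s > 0 \<Longrightarrow> 0 \<le> kern s u" and kern_le: "s > 0 \<Longrightarrow> kern s u \<le> 1 / s"
  by (simp_all add: kern_def divide_simps)

lemma nn_integral_gauss_rank_one:
  fixes v :: "complex ^ 'n"
  assumes c: "c \<ge> 0"
  shows "(\<integral>\<^sup>+ x. ennreal (exp (- ((norm x)\<^sup>2 + c * (cmod (hprod x v))\<^sup>2))) \<partial>lborel) =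
    ennreal ((gauss\<^sup>2) ^ CARD('n) / (1 + c * (norm v)\<^sup>2))"
proof (cases "v = 0")
  case True
  then show ?thesis using nn_integral_gauss_space[where 'n = 'n, of 1] by simp
next
  case False
  define y where "y = (1 / norm v) *\<^sub>R v"
  have y: "norm y = 1" and v: "v = norm v *\<^sub>R y" using False by (simp_all add: y_def)
  let ?a = "1 + c * (norm v)\<^sup>2"
  have a: "?a > 0" using c by (simp add: add_pos_nonneg)
  have "(\<integral>\<^sup>+ x. ennreal (exp (- ((norm x)\<^sup>2 + c * (cmod (hprod x v))\<^sup>2))) \<partial>lborel) =
     (\<integral>\<^sup>+ u. \<integral>\<^sup>+ h. ennreal (exp (- (1 * (norm h)\<^sup>2))) * ennreal (exp (- (?a * (cmod u)\<^sup>2))) \<partial>hyperplane_measure y \<partial>lborel)"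
  proof (rule nn_integral_hyperplane_split(1)[OF y])
    fix h u assume h: "hprod h y = 0"
    have "hprod (h + u *s y) v = of_real (norm v) * u"
      using y h by (subst v) (simp add: hprod_add_left hprod_scaleR_right hprod_scale_left hprod_self)
    then show "ennreal (exp (- ((norm (h + u *s y))\<^sup>2 + c * (cmod (hprod (h + u *s y) v))\<^sup>2))) =
      ennreal (exp (- (1 * (norm h)\<^sup>2))) * ennreal (exp (- (?a * (cmod u)\<^sup>2)))"
      using norm_add_smult[OF y h, of u]
      by (simp add: norm_mult power_mult_distrib algebra_simps flip: ennreal_mult exp_add)
  qed measurable
  also have "\<dots> = ennreal ((gauss\<^sup>2 / 1) ^ (CARD('n) - 1)) * ennreal (gauss\<^sup>2 / ?a)"
    by (subst nn_integral_multc, measurable, subst nn_integral_cmult, measurable)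
       (simp only: nn_integral_gauss_hyperplane[OF y zero_less_one] nn_integral_gauss_complex[OF a])
  also have "\<dots> = ennreal ((gauss\<^sup>2) ^ CARD('n) / ?a)"
    using a power_minus_mult[of "CARD('n)" "gauss\<^sup>2"] zero_less_card_finite[where 'a = 'n]
    by (simp add: ennreal_mult[symmetric] times_divide_eq_right)
  finally show ?thesis .
qed

lemma nn_integral_gauss_rank_one_hyperplane:
  fixes v :: "complex ^ 'n"
  assumes z: "norm z = 1" and v: "hprod v z = 0" and c: "c \<ge> 0"
  shows "(\<integral>\<^sup>+ h. ennreal (exp (- ((norm h)\<^sup>2 + c * (cmod (hprod h v))\<^sup>2))) \<partial>hyperplane_measure z) =
    ennreal ((gauss\<^sup>2) ^ (CARD('n) - 1) / (1 + c * (norm v)\<^sup>2))"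
    (is "?I = _")
proof -
  let ?a = "1 + c * (norm v)\<^sup>2"
  have a: "?a > 0" using c by (simp add: add_pos_nonneg)
  have v': "hprod z v = 0" using v hprod_commute[of z v] by simp
  have "ennreal ((gauss\<^sup>2) ^ CARD('n) / ?a) =
    (\<integral>\<^sup>+ x. ennreal (exp (- ((norm x)\<^sup>2 + c * (cmod (hprod x v))\<^sup>2))) \<partial>lborel)"
    by (rule nn_integral_gauss_rank_one[OF c, symmetric])
  also have "\<dots> = (\<integral>\<^sup>+ u. \<integral>\<^sup>+ h. ennreal (exp (- ((norm h)\<^sup>2 + c * (cmod (hprod h v))\<^sup>2))) * ennreal (exp (- (1 * (cmod u)\<^sup>2)))
      \<partial>hyperplane_measure z \<partial>lborel)"
    using z v' by (intro nn_integral_hyperplane_split)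
      (auto simp: norm_add_smult hprod_add_left hprod_scale_left algebra_simps simp flip: ennreal_mult exp_add)
  also have "\<dots> = ?I * (\<integral>\<^sup>+ u. ennreal (exp (- (1 * (cmod u)\<^sup>2))) \<partial>lborel)"
    by (subst nn_integral_multc, measurable) (subst nn_integral_cmult, auto)
  also have "\<dots> = ennreal (gauss\<^sup>2) * ?I"
    by (subst nn_integral_gauss_complex) (auto simp: mult.commute)
  finally have "ennreal (gauss\<^sup>2) * ?I = ennreal ((gauss\<^sup>2) ^ CARD('n) / ?a)" ..
  also have "\<dots> = ennreal (gauss\<^sup>2) * ennreal ((gauss\<^sup>2) ^ (CARD('n) - 1) / ?a)"
    using a power_minus_mult[of "CARD('n)" "gauss\<^sup>2"] zero_less_card_finite[where 'a = 'n]
    by (simp add: ennreal_mult[symmetric] mult.commute)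
  finally show ?thesis using gauss_pos by (auto simp: ennreal_mult_cancel_left)
qed

text \<open>
  A shift of \<open>u\<close> completes the square; \<open>A\<close> is the coefficient of
  \<open>\<bar>u\<bar>\<^sup>2\<close> in the exponent.
\<close>

lemma nn_integral_complete_square:
  fixes v g :: complex
  assumes B: "B > 0" and s: "s > 0"
  defines "A \<equiv> B + (cmod g)\<^sup>2 / s"
  shows "(\<integral>\<^sup>+ u. ennreal (exp (- (B * (cmod u)\<^sup>2 + (cmod (v + u * g))\<^sup>2 / s))) \<partial>lborel) =
    ennreal (gauss\<^sup>2 / A * exp (- (B / (s * A) * (cmod v)\<^sup>2)))"
proof -
  have A: "A > 0" using B s by (simp add: A_def add_pos_nonneg)
  define w where "w = v * cnj g / of_real (s * A)"
  have sq: "B * (cmod u)\<^sup>2 + (cmod (v + u * g))\<^sup>2 / s = A * (cmod (w + 1 *\<^sub>R u))\<^sup>2 + B / (s * A) * (cmod v)\<^sup>2" for u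
  proof -
    have w: "Re w = Re (v * cnj g) / (s * A)" "Im w = Im (v * cnj g) / (s * A)" by (simp_all add: w_def)
    have 1: "A * (cmod (w + 1 *\<^sub>R u))\<^sup>2 = A * (cmod u)\<^sup>2 + 2 * A * (Re w * Re u + Im w * Im u) + A * ((Re w)\<^sup>2 + (Im w)\<^sup>2)"
      unfolding cmod_power2 by (simp add: power2_eq_square algebra_simps)
    have 2: "A * (Re w * Re u + Im w * Im u) = (Re (v * cnj g) * Re u + Im (v * cnj g) * Im u) / s"
      using A s by (simp add: w field_simps)
    have "(Re w)\<^sup>2 + (Im w)\<^sup>2 = (cmod w)\<^sup>2" by (simp add: cmod_power2)
    also have "\<dots> = (cmod v)\<^sup>2 * (cmod g)\<^sup>2 / (s * A)\<^sup>2"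
      using A s by (simp add: w_def norm_mult norm_divide power_mult_distrib power_divide)
    finally have 3: "A * ((Re w)\<^sup>2 + (Im w)\<^sup>2) = (cmod v)\<^sup>2 * (cmod g)\<^sup>2 / (s * s * A)"
      using A s by (simp add: power2_eq_square field_simps)
    have 4: "(cmod v)\<^sup>2 * (cmod g)\<^sup>2 / (s * s * A) + B / (s * A) * (cmod v)\<^sup>2 = (cmod v)\<^sup>2 / s"
    proof -
      have "(cmod g)\<^sup>2 / (s * s * A) + B / (s * A) = A / (s * A)"
      proof -
        have "A / (s * A) = B / (s * A) + (cmod g)\<^sup>2 / s / (s * A)"
          by (subst (1) A_def) (simp add: add_divide_distrib)
        then show ?thesis by (simp add: mult_ac)
      qed
      then have "(cmod v)\<^sup>2 * ((cmod g)\<^sup>2 / (s * s * A) + B / (s * A)) = (cmod v)\<^sup>2 / s" using A by simp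
      then show ?thesis by (simp add: algebra_simps)
    qed
    have 5: "(cmod (v + u * g))\<^sup>2 = (cmod v)\<^sup>2 + 2 * (Re (v * cnj g) * Re u + Im (v * cnj g) * Im u) + (cmod u)\<^sup>2 * (cmod g)\<^sup>2"
      unfolding cmod_power2 by (simp add: power2_eq_square algebra_simps)
    have 6: "2 * A * (Re w * Re u + Im w * Im u) = 2 * ((Re (v * cnj g) * Re u + Im (v * cnj g) * Im u) / s)"
      using 2 by (simp only: mult.assoc)
    have "B * (cmod u)\<^sup>2 + (cmod (v + u * g))\<^sup>2 / s = A * (cmod u)\<^sup>2 + 2 * ((Re (v * cnj g) * Re u + Im (v * cnj g) * Im u) / s) + (cmod v)\<^sup>2 / s"
      unfolding 5 A_def by (simp only: add_divide_distrib distrib_right times_divide_eq_left times_divide_eq_right) (simp add: mult.commute add_divide_distrib)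
    then show ?thesis by (simp only: 1 3 6 4[symmetric] add.assoc)
  qed
  have "(\<integral>\<^sup>+ u. ennreal (exp (- (B * (cmod u)\<^sup>2 + (cmod (v + u * g))\<^sup>2 / s))) \<partial>lborel) =
      (\<integral>\<^sup>+ u. ennreal (exp (- (B / (s * A) * (cmod v)\<^sup>2))) * ennreal (exp (- (A * (cmod (w + 1 *\<^sub>R u))\<^sup>2))) \<partial>lborel)"
    unfolding sq minus_add_distrib exp_add ennreal_mult[OF exp_ge_zero exp_ge_zero] by (simp only: mult.commute)
  also have "\<dots> = ennreal (exp (- (B / (s * A) * (cmod v)\<^sup>2))) * (\<integral>\<^sup>+ u. ennreal (exp (- (A * (cmod (w + 1 *\<^sub>R u))\<^sup>2))) \<partial>lborel)"
    by (rule nn_integral_cmult) measurable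
  also have "(\<integral>\<^sup>+ u. ennreal (exp (- (A * (cmod (w + 1 *\<^sub>R u))\<^sup>2))) \<partial>lborel) =
     (\<integral>\<^sup>+ u. ennreal (exp (- (A * (cmod u)\<^sup>2))) \<partial>distr lborel borel (\<lambda>u. w + 1 *\<^sub>R u))"
    by (subst nn_integral_distr) auto
  also have "distr lborel borel (\<lambda>u. w + 1 *\<^sub>R u) = lborel"
    using lborel_affine[of 1 w] by (simp add: density_1)
  finally show ?thesis using A by (simp add: nn_integral_gauss_complex mult.commute flip: ennreal_mult)
qed

text \<open>
  Up to the factor \<open>t s\<close>, the determinant of the Hermitian form \<open>\<bar>y\<bar>\<^sup>2 +
  \<bar>\<langle>y, z\<rangle>\<bar>\<^sup>2 / t + \<bar>\<langle>y, x\<rangle>\<bar>\<^sup>2 / s\<close> in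
  \<open>y\<close>.
\<close>

definition kernel_denominator :: "real \<Rightarrow> real \<Rightarrow> complex ^ 'n \<Rightarrow> complex ^ 'n \<Rightarrow> real" where
  "kernel_denominator t s z x = (t + (norm z)\<^sup>2) * (s + (norm x)\<^sup>2) - (cmod (hprod x z))\<^sup>2"

text \<open>
  By the Cauchy--Schwarz inequality. The bound is uniform in \<open>t \<ge> 0\<close>, hence dominates the limit
  \<open>t \<rightarrow> 0\<close>.
\<close>

lemma kernel_denominator_ge:
  assumes "t \<ge> 0" "s \<ge> 0"
  shows "kernel_denominator t s z x \<ge> s * (norm z)\<^sup>2"
proof -
  have "(cmod (hprod x z))\<^sup>2 \<le> (norm x * norm z)\<^sup>2" by (intro power_mono cmod_hprod_le) simp
  also have "\<dots> \<le> (t + (norm z)\<^sup>2) * (norm x)\<^sup>2" using assms by (simp add: power_mult_distrib algebra_simps)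
  finally show ?thesis using assms unfolding kernel_denominator_def
    by (simp add: distrib_left) (simp add: algebra_simps add_increasing)
qed

text \<open>
  The integral of \<open>exp (- Q y)\<close> for a positive Hermitian form \<open>Q\<close> is
  \<open>gauss\<^sup>2\<^sup>n / det Q\<close>. Here \<open>Q\<close> is a perturbation of
  \<open>\<bar>y\<bar>\<^sup>2\<close> of rank two: splitting off the coordinate along \<open>z\<close> and
  completing the square in it leaves a perturbation of rank one on \<open>H\<^sub>z\<close>.
\<close>

lemma nn_integral_two_kernels:
  fixes z x :: "complex ^ 'n"
  assumes z0: "z \<noteq> 0" and t: "t > 0" and s: "s > 0"
  shows "(\<integral>\<^sup>+ y. ennreal (exp (- (norm y)\<^sup>2) * kern t (hprod y z) * kern s (hprod y x)) \<partial>lborel) =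
    ennreal ((gauss\<^sup>2) ^ CARD('n) / kernel_denominator t s z x)"
proof -
  define e where "e = (1 / norm z) *\<^sub>R z"
  have e: "norm e = 1" and z: "z = norm z *\<^sub>R e" using z0 by (simp_all add: e_def)
  define g where "g = hprod e x"
  define p where "p = hproj e x"
  define B where "B = 1 + (norm z)\<^sup>2 / t"
  define A where "A = B + (cmod g)\<^sup>2 / s"
  have B: "B > 0" using t by (simp add: B_def add_pos_nonneg)
  have A: "A > 0" using B s by (simp add: A_def add_pos_nonneg)
  have pe: "hprod p e = 0" by (simp add: p_def hprod_hproj[OF e])
  have "(\<integral>\<^sup>+ y. ennreal (exp (- (norm y)\<^sup>2) * kern t (hprod y z) * kern s (hprod y x)) \<partial>lborel) =
     (\<integral>\<^sup>+ h. \<integral>\<^sup>+ u. ennreal (exp (- (norm h)\<^sup>2) / (t * s)) *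
        ennreal (exp (- (B * (cmod u)\<^sup>2 + (cmod (hprod h p + u * g))\<^sup>2 / s))) \<partial>lborel \<partial>hyperplane_measure e)"
  proof (rule nn_integral_hyperplane_split(2)[OF e])
    fix h u assume h: "hprod h e = 0"
    have 1: "hprod (h + u *s e) z = of_real (norm z) * u"
      using e h by (subst z) (simp add: hprod_add_left hprod_scaleR_right hprod_scale_left hprod_self)
    have 2: "hprod (h + u *s e) x = hprod h p + u * g"
      using h by (simp add: p_def g_def hproj_def hprod_diff_right hprod_scale_right hprod_add_left hprod_scale_left)
    show "ennreal (exp (- (norm (h + u *s e))\<^sup>2) * kern t (hprod (h + u *s e) z) * kern s (hprod (h + u *s e) x)) =
      ennreal (exp (- (norm h)\<^sup>2) / (t * s)) * ennreal (exp (- (B * (cmod u)\<^sup>2 + (cmod (hprod h p + u * g))\<^sup>2 / s)))"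
      unfolding 1 2 norm_add_smult[OF e h] using t s
      by (simp add: kern_def B_def norm_mult power_mult_distrib algebra_simps flip: ennreal_mult exp_add)
  qed measurable
  also have "\<dots> = (\<integral>\<^sup>+ h. ennreal (gauss\<^sup>2 / (A * (t * s))) *
        ennreal (exp (- ((norm h)\<^sup>2 + B / (s * A) * (cmod (hprod h p))\<^sup>2))) \<partial>hyperplane_measure e)"
  proof (rule nn_integral_cong)
    fix h
    show "(\<integral>\<^sup>+ u. ennreal (exp (- (norm h)\<^sup>2) / (t * s)) * ennreal (exp (- (B * (cmod u)\<^sup>2 + (cmod (hprod h p + u * g))\<^sup>2 / s))) \<partial>lborel) =
      ennreal (gauss\<^sup>2 / (A * (t * s))) * ennreal (exp (- ((norm h)\<^sup>2 + B / (s * A) * (cmod (hprod h p))\<^sup>2)))"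
    proof (subst nn_integral_cmult)
      have "exp (- (norm h)\<^sup>2) / (t * s) * (gauss\<^sup>2 / A * exp (- (B / (s * A) * (cmod (hprod h p))\<^sup>2))) =
          gauss\<^sup>2 / (A * (t * s)) * exp (- ((norm h)\<^sup>2 + B / (s * A) * (cmod (hprod h p))\<^sup>2))"
        by (simp only: minus_add_distrib exp_add) (simp add: mult_ac)
      then show "ennreal (exp (- (norm h)\<^sup>2) / (t * s)) * (\<integral>\<^sup>+ u. ennreal (exp (- (B * (cmod u)\<^sup>2 + (cmod (hprod h p + u * g))\<^sup>2 / s))) \<partial>lborel) =
        ennreal (gauss\<^sup>2 / (A * (t * s))) * ennreal (exp (- ((norm h)\<^sup>2 + B / (s * A) * (cmod (hprod h p))\<^sup>2)))"
        unfolding nn_integral_complete_square[OF B s, of "hprod h p" g, folded A_def]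
        using t s A by (simp only: ennreal_mult[symmetric] divide_nonneg_nonneg mult_nonneg_nonneg exp_ge_zero zero_le_power2 less_imp_le)
    qed measurable
  qed
  also have "\<dots> = ennreal (gauss\<^sup>2 / (A * (t * s))) * ennreal ((gauss\<^sup>2) ^ (CARD('n) - 1) / (1 + B / (s * A) * (norm p)\<^sup>2))"
    using A B s by (subst nn_integral_cmult, measurable) (subst nn_integral_gauss_rank_one_hyperplane[OF e pe], auto)
  also have "\<dots> = ennreal ((gauss\<^sup>2) ^ CARD('n) / kernel_denominator t s z x)"
  proof -
    have 1: "(norm p)\<^sup>2 = (norm x)\<^sup>2 - (cmod g)\<^sup>2"
      unfolding p_def g_def norm_hproj[OF e] by (simp add: norm_hprod_commute)
    have 2: "(cmod (hprod x z))\<^sup>2 = (norm z)\<^sup>2 * (cmod g)\<^sup>2"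
      by (subst z) (simp add: g_def hprod_scaleR_right norm_mult power_mult_distrib norm_hprod_commute[of x])
    have 3: "(A * (t * s)) * (1 + B / (s * A) * (norm p)\<^sup>2) = t * s * A + t * B * (norm p)\<^sup>2"
      using A s by (simp add: field_simps)
    have 4: "t * s * A = s * (t + (norm z)\<^sup>2) + t * (cmod g)\<^sup>2" "t * B = t + (norm z)\<^sup>2"
      using t s by (simp_all add: A_def B_def field_simps)
    have "t * s * A + t * B * (norm p)\<^sup>2 = kernel_denominator t s z x"
      unfolding 4 1 kernel_denominator_def 2 by (simp add: algebra_simps)
    with 3 have D: "(A * (t * s)) * (1 + B / (s * A) * (norm p)\<^sup>2) = kernel_denominator t s z x" by simp
    have "0 \<le> gauss\<^sup>2 / (A * (t * s))" using A t s by simp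
    then have "ennreal (gauss\<^sup>2 / (A * (t * s))) * ennreal ((gauss\<^sup>2) ^ (CARD('n) - 1) / (1 + B / (s * A) * (norm p)\<^sup>2)) =
       ennreal (gauss\<^sup>2 / (A * (t * s)) * ((gauss\<^sup>2) ^ (CARD('n) - 1) / (1 + B / (s * A) * (norm p)\<^sup>2)))"
      by (rule ennreal_mult'[symmetric])
    then show ?thesis unfolding times_divide_times_eq D
      using power_minus_mult[of "CARD('n)" "gauss\<^sup>2"] zero_less_card_finite[where 'a = 'n] by (simp add: mult.commute)
  qed
  finally show ?thesis .
qed

section \<open>The Prekopa--Leindler inequality\<close>

lemma ennreal_power2_le_iff: "x\<^sup>2 \<le> y\<^sup>2 \<longleftrightarrow> x \<le> (y :: ennreal)"
proof
  show "x \<le> y" if "x\<^sup>2 \<le> y\<^sup>2"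
    using that by (cases x; cases y) (auto simp: ennreal_power top_power_ennreal abs_le_square_iff[symmetric] top_unique ennreal_le_iff2)
qed (rule power_mono, auto)

lemma ennreal_arith_geo_mean: "4 * (x * y) \<le> (x + y :: ennreal)\<^sup>2"
proof (cases "x = top \<or> y = top")
  case False
  then obtain a b where "x = ennreal a" "y = ennreal b" "a \<ge> 0" "b \<ge> 0" by (cases x; cases y) auto
  moreover have "4 * (a * b) \<le> (a + b)\<^sup>2" using zero_le_power2[of "a - b"] by (simp add: power2_eq_square algebra_simps)
  ultimately show ?thesis
    by (simp add: ennreal_power ennreal_leI flip: ennreal_mult ennreal_plus ennreal_numeral)
qed (auto simp: top_power_ennreal)

text \<open>
  The Brunn--Minkowski inequality on the line, for midpoints. For \<open>a \<in> A\<close> close to \<open>sup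
  A\<close> and \<open>b \<in> B\<close> close to \<open>inf B\<close>, the translates \<open>A + b\<close> and
  \<open>a + B\<close> both lie in \<open>2 C\<close> and overlap at most in a short interval.
\<close>

lemma midpoint_sum_bounded:
  fixes A B C :: "real set"
  assumes [measurable]: "A \<in> sets borel" "B \<in> sets borel" "C \<in> sets borel"
    and ne: "A \<noteq> {}" "B \<noteq> {}" and bd: "bdd_above A" "bdd_below B"
    and mid: "\<And>a b. a \<in> A \<Longrightarrow> b \<in> B \<Longrightarrow> (a + b) / 2 \<in> C"
  shows "emeasure lborel A + emeasure lborel B \<le> 2 * emeasure lborel C"
proof (rule ennreal_le_epsilon)
  fix e :: real assume e: "e > 0"
  obtain a where a: "a \<in> A" "Sup A - e / 2 < a" using less_cSupD[OF ne(1), of "Sup A - e / 2"] e by auto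
  obtain b where b: "b \<in> B" "b < Inf B + e / 2" using cInf_lessD[OF ne(2), of "Inf B + e / 2"] e by auto
  have shift: "emeasure lborel ((\<lambda>x. - c + x) -` S) = emeasure lborel S" if "S \<in> sets borel" for c :: real and S
  proof -
    have "emeasure lborel S = emeasure (distr lborel borel (\<lambda>x. - c + x)) S" by (simp only: lborel_distr_plus)
    also have "\<dots> = emeasure lborel ((\<lambda>x. - c + x) -` S)"
      using that by (subst emeasure_distr) (auto simp del: uminus_add_conv_diff)
    finally show ?thesis ..
  qed
  define A' where "A' = (\<lambda>x. - b + x) -` A"
  define B' where "B' = (\<lambda>x. - a + x) -` B"
  have [measurable]: "A' \<in> sets borel" "B' \<in> sets borel"
    using measurable_sets[of "\<lambda>x. - b + x" borel borel A] measurable_sets[of "\<lambda>x. - a + x" borel borel B]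
    by (simp_all add: A'_def B'_def)
  have C2: "emeasure lborel ((\<lambda>x. x / 2) -` C) = 2 * emeasure lborel C"
  proof -
    have "emeasure lborel ((\<lambda>x. x / 2) -` C) = (\<integral>\<^sup>+ x. indicator ((\<lambda>x. x / 2) -` C) x \<partial>lborel)"
      using measurable_sets[of "\<lambda>x. x / 2" borel borel C] by simp
    also have "\<dots> = (\<integral>\<^sup>+ x. indicator C (x / 2) \<partial>lborel)" by (simp add: indicator_def)
    also have "\<dots> = 2 * (\<integral>\<^sup>+ x. indicator C x \<partial>lborel)"
      by (subst nn_integral_real_affine[where c = 2 and t = 0]) auto
    finally show ?thesis by simp
  qed
  have "emeasure lborel A + emeasure lborel B = emeasure lborel A' + emeasure lborel B'"
    by (simp only: A'_def B'_def shift assms)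
  also have "\<dots> = emeasure lborel (A' \<union> B') + emeasure lborel (A' \<inter> B')"
    by (rule emeasure_Un_Int) auto
  also have "\<dots> \<le> emeasure lborel ((\<lambda>x. x / 2) -` C) + emeasure lborel {a + Inf B .. Sup A + b}"
  proof (intro add_mono emeasure_mono)
    show "A' \<union> B' \<subseteq> (\<lambda>x. x / 2) -` C"
      using mid[OF _ b(1)] mid[OF a(1)] by (force simp: A'_def B'_def)
    show "A' \<inter> B' \<subseteq> {a + Inf B .. Sup A + b}"
      using cSup_upper[OF _ bd(1)] cInf_lower[OF _ bd(2)] by (force simp: A'_def B'_def)
  qed (use measurable_sets[of "\<lambda>x. x / 2" borel borel C] in auto)
  also have "emeasure lborel {a + Inf B .. Sup A + b} \<le> ennreal e"
    using a b by (cases "a + Inf B \<le> Sup A + b") (auto intro!: ennreal_leI)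
  finally show "emeasure lborel A + emeasure lborel B \<le> 2 * emeasure lborel C + ennreal e"
    unfolding C2 by (simp add: add_left_mono)
qed

lemma midpoint_sum:
  fixes A B C :: "real set"
  assumes [measurable]: "A \<in> sets borel" "B \<in> sets borel" "C \<in> sets borel"
    and ne: "A \<noteq> {}" "B \<noteq> {}"
    and mid: "\<And>a b. a \<in> A \<Longrightarrow> b \<in> B \<Longrightarrow> (a + b) / 2 \<in> C"
  shows "emeasure lborel A + emeasure lborel B \<le> 2 * emeasure lborel C"
proof -
  define A' where "A' n = A \<inter> {- real n .. real n}" for n :: nat
  define B' where "B' n = B \<inter> {- real n .. real n}" for n :: nat
  obtain a b where ab: "a \<in> A" "b \<in> B" using ne by auto
  obtain N :: nat where N: "\<bar>a\<bar> \<le> real N" "\<bar>b\<bar> \<le> real N"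
    using real_arch_simple[of "max \<bar>a\<bar> \<bar>b\<bar>"] by auto
  have U: "(\<Union>n. S \<inter> {- real n .. real n}) = S" for S :: "real set"
  proof safe
    fix x assume "x \<in> S"
    moreover obtain n :: nat where "\<bar>x\<bar> \<le> real n" using real_arch_simple by blast
    ultimately show "x \<in> (\<Union>n. S \<inter> {- real n .. real n})" by (auto intro!: exI[of _ n])
  qed
  have lim: "(\<lambda>n. emeasure lborel (S \<inter> {- real n .. real n})) \<longlonglongrightarrow> emeasure lborel S" if "S \<in> sets borel" for S :: "real set"
  proof -
    have "(\<lambda>n. emeasure lborel (S \<inter> {- real n .. real n})) \<longlonglongrightarrow> emeasure lborel (\<Union>n. S \<inter> {- real n .. real n})"
      using that by (intro Lim_emeasure_incseq) (auto simp: incseq_def)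
    then show ?thesis by (simp only: U)
  qed
  have "(\<lambda>n. emeasure lborel (A' n) + emeasure lborel (B' n)) \<longlonglongrightarrow> emeasure lborel A + emeasure lborel B"
    unfolding A'_def B'_def by (intro tendsto_add lim) auto
  moreover have "emeasure lborel (A' n) + emeasure lborel (B' n) \<le> 2 * emeasure lborel C" if "n \<ge> N" for n
  proof (rule midpoint_sum_bounded)
    have "a \<in> A' n" "b \<in> B' n" using N that ab by (auto simp: A'_def B'_def)
    then show "A' n \<noteq> {}" "B' n \<noteq> {}" by auto
    show "bdd_above (A' n)" unfolding A'_def by (rule bdd_above_mono[of "{- real n .. real n}"]) auto
    show "bdd_below (B' n)" unfolding B'_def by (rule bdd_below_mono[of "{- real n .. real n}"]) auto
  qed (auto simp: A'_def B'_def mid)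
  ultimately show ?thesis by (intro LIMSEQ_le_const2) auto
qed

lemma nn_integral_layer_cake:
  assumes "sigma_finite_measure M" and [measurable]: "f \<in> borel_measurable M"
  shows "(\<integral>\<^sup>+ x. f x \<partial>M) = (\<integral>\<^sup>+ t. indicator {0..} t * emeasure M {x \<in> space M. ennreal t < f x} \<partial>lborel)"
proof -
  interpret sigma_finite_measure M by fact
  interpret P: pair_sigma_finite M "lborel :: real measure" ..
  have len: "(\<integral>\<^sup>+ t. indicator {0..} t * indicator {t. ennreal t < y} t \<partial>lborel) = y" for y
  proof (cases y)
    case (real r)
    then have "(\<lambda>t. indicator {0..} t * indicator {t. ennreal t < y} t) = (indicator {0..<r} :: real \<Rightarrow> ennreal)"
      by (auto simp: indicator_def ennreal_less_iff fun_eq_iff)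
    then show ?thesis using real by simp
  next
    case top
    then have "(\<lambda>t. indicator {0..} t * indicator {t. ennreal t < y} t) = (indicator {0..} :: real \<Rightarrow> ennreal)"
      by (auto simp: indicator_def fun_eq_iff)
    moreover have "(SUP n. of_nat n) \<le> emeasure lborel {0 :: real ..}"
    proof (rule SUP_least)
      fix n :: nat
      show "of_nat n \<le> emeasure lborel {0 :: real ..}"
        using emeasure_mono[of "{0 .. real n}" "{0..}" lborel] by (simp add: ennreal_of_nat_eq_real_of_nat)
    qed
    ultimately show ?thesis using top by (simp add: ennreal_SUP_of_nat_eq_top top_unique)
  qed
  have "(\<integral>\<^sup>+ x. f x \<partial>M) = (\<integral>\<^sup>+ x. \<integral>\<^sup>+ t. indicator {0..} t * indicator {t. ennreal t < f x} t \<partial>lborel \<partial>M)"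
    by (simp only: len)
  also have "\<dots> = (\<integral>\<^sup>+ t. \<integral>\<^sup>+ x. indicator {0..} t * indicator {t. ennreal t < f x} t \<partial>M \<partial>lborel)"
    by (rule P.Fubini'[symmetric]) measurable
  also have "\<dots> = (\<integral>\<^sup>+ t. indicator {0..} t * emeasure M {x \<in> space M. ennreal t < f x} \<partial>lborel)"
  proof (rule nn_integral_cong)
    fix t :: real
    have "(\<integral>\<^sup>+ x. indicator {0..} t * indicator {t. ennreal t < f x} t \<partial>M) =
        (\<integral>\<^sup>+ x. indicator {0..} t * indicator {x \<in> space M. ennreal t < f x} x \<partial>M)"
      by (intro nn_integral_cong) (auto simp: indicator_def)
    then show "(\<integral>\<^sup>+ x. indicator {0..} t * indicator {t. ennreal t < f x} t \<partial>M) =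
        indicator {0..} t * emeasure M {x \<in> space M. ennreal t < f x}"
      by (simp add: nn_integral_cmult)
  qed
  finally show ?thesis .
qed

text \<open>
  After normalising both suprema to \<open>1\<close>, the superlevel sets of \<open>f\<close> and \<open>g\<close>
  at a level \<open>t\<close> are either both nonempty, and \<open>midpoint_sum\<close> applies, or both empty.
  Integrating over \<open>t\<close> gives even an inequality for the sum instead of the product.
\<close>

lemma prekopa_leindler_normalised:
  fixes f g h :: "real \<Rightarrow> ennreal"
  assumes [measurable]: "f \<in> borel_measurable borel" "g \<in> borel_measurable borel" "h \<in> borel_measurable borel"
    and sup: "(SUP x. f x) = 1" "(SUP x. g x) = 1"
    and mid: "\<And>x y. f x * g y \<le> (h ((x + y) / 2))\<^sup>2"
  shows "(\<integral>\<^sup>+ x. f x \<partial>lborel) + (\<integral>\<^sup>+ x. g x \<partial>lborel) \<le> 2 * (\<integral>\<^sup>+ x. h x \<partial>lborel)"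
proof -
  have le1: "f x \<le> 1" "g x \<le> 1" for x using SUP_upper[of x UNIV f] SUP_upper[of x UNIV g] sup by auto
  have ne: "emeasure lborel {x. ennreal t < f x} + emeasure lborel {x. ennreal t < g x} \<le>
      2 * emeasure lborel {x. ennreal t < h x}" if t: "t \<ge> 0" for t
  proof (cases "t < 1")
    case True
    show ?thesis
    proof (rule midpoint_sum)
      have "ennreal t < (SUP x. f x)" "ennreal t < (SUP x. g x)" using True t sup by (auto simp: ennreal_less_one_iff)
      then show "{x. ennreal t < f x} \<noteq> {}" "{x. ennreal t < g x} \<noteq> {}"
        unfolding less_SUP_iff by auto
      fix a b assume ab: "a \<in> {x. ennreal t < f x}" "b \<in> {x. ennreal t < g x}"
      obtain p where p: "f a = ennreal p" "p \<ge> 0" using le1(1)[of a] by (cases "f a") (auto simp: top_unique)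
      obtain q where q: "g b = ennreal q" "q \<ge> 0" using le1(2)[of b] by (cases "g b") (auto simp: top_unique)
      have "t < p" "t < q" using ab p q t by (auto simp: ennreal_less_iff)
      then have tt: "t\<^sup>2 < p * q" using t by (simp add: power2_eq_square mult_strict_mono')
      have "ennreal (p * q) \<le> (h ((a + b) / 2))\<^sup>2" using mid[of a b] p q by (simp add: ennreal_mult)
      then have "ennreal t < h ((a + b) / 2)"
      proof (cases "h ((a + b) / 2)")
        case (real k)
        then have "p * q \<le> k\<^sup>2" using \<open>ennreal (p * q) \<le> _\<close> by (simp add: ennreal_power)
        then show ?thesis using tt real t by (simp add: ennreal_less_iff) (meson less_le_trans power2_less_imp_less)
      qed simp
      then show "(a + b) / 2 \<in> {x. ennreal t < h x}" by simp
    qed measurable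
  next
    case False
    then have "ennreal t \<ge> 1" by simp
    then have "\<not> ennreal t < f x" "\<not> ennreal t < g x" for x
      using order_trans[OF le1(1)] order_trans[OF le1(2)] by (simp_all add: not_less)
    then show ?thesis by simp
  qed
  have "(\<integral>\<^sup>+ x. f x \<partial>lborel) + (\<integral>\<^sup>+ x. g x \<partial>lborel) =
     (\<integral>\<^sup>+ t. indicator {0..} t * (emeasure lborel {x. ennreal t < f x} + emeasure lborel {x. ennreal t < g x}) \<partial>lborel)"
    by (simp add: nn_integral_layer_cake[OF sigma_finite_lborel, of f] nn_integral_layer_cake[OF sigma_finite_lborel, of g]
          distrib_left nn_integral_add)
  also have "\<dots> \<le> (\<integral>\<^sup>+ t. 2 * (indicator {0..} t * emeasure lborel {x. ennreal t < h x}) \<partial>lborel)"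
    using ne by (intro nn_integral_mono) (auto simp: indicator_def)
  also have "\<dots> = 2 * (\<integral>\<^sup>+ x. h x \<partial>lborel)"
    by (simp add: nn_integral_layer_cake[OF sigma_finite_lborel, of h] nn_integral_cmult)
  finally show ?thesis .
qed

text \<open>
  Dividing \<open>f\<close>, \<open>g\<close>, \<open>h\<close> by \<open>sup f\<close>, \<open>sup g\<close> and
  the geometric mean of these reduces to the normalised case; the inequality between the arithmetic and the
  geometric mean turns the sum into a product.
\<close>

lemma prekopa_leindler_bounded:
  fixes f g h :: "real \<Rightarrow> ennreal"
  assumes [measurable]: "f \<in> borel_measurable borel" "g \<in> borel_measurable borel" "h \<in> borel_measurable borel"
    and bd: "\<And>x. f x \<le> ennreal N" "\<And>x. g x \<le> ennreal N"
    and mid: "\<And>x y. f x * g y \<le> (h ((x + y) / 2))\<^sup>2"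
  shows "(\<integral>\<^sup>+ x. f x \<partial>lborel) * (\<integral>\<^sup>+ x. g x \<partial>lborel) \<le> (\<integral>\<^sup>+ x. h x \<partial>lborel)\<^sup>2"
proof (cases "(SUP x. f x) = 0 \<or> (SUP x. g x) = 0")
  case True
  then have "(\<forall>x. f x = 0) \<or> (\<forall>x. g x = 0)" by (metis SUP_upper UNIV_I le_zero_eq)
  then show ?thesis by auto
next
  case False
  have "(SUP x. f x) \<le> ennreal N" "(SUP x. g x) \<le> ennreal N" using bd by (auto intro: SUP_least)
  then obtain a b where a: "(SUP x. f x) = ennreal a" "a > 0" and b: "(SUP x. g x) = ennreal b" "b > 0"
    using False by (cases "SUP x. f x"; cases "SUP x. g x") (auto simp: top_unique less_le)
  define c where "c = sqrt (a * b)"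
  have c: "c > 0" "c\<^sup>2 = a * b" using a b by (auto simp: c_def)
  define F where "F = (\<integral>\<^sup>+ x. f x \<partial>lborel)"
  define G where "G = (\<integral>\<^sup>+ x. g x \<partial>lborel)"
  define H where "H = (\<integral>\<^sup>+ x. h x \<partial>lborel)"
  have inv: "ennreal (1 / r) * ennreal r = 1" if "r > 0" for r
    using that by (simp flip: ennreal_mult)
  have "(\<integral>\<^sup>+ x. ennreal (1 / a) * f x \<partial>lborel) + (\<integral>\<^sup>+ x. ennreal (1 / b) * g x \<partial>lborel) \<le>
      2 * (\<integral>\<^sup>+ x. ennreal (1 / c) * h x \<partial>lborel)"
  proof (rule prekopa_leindler_normalised)
    show "(SUP x. ennreal (1 / a) * f x) = 1" using a inv by (simp flip: SUP_mult_left_ennreal)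
    show "(SUP x. ennreal (1 / b) * g x) = 1" using b inv by (simp flip: SUP_mult_left_ennreal)
    fix x y
    have "ennreal (1 / a) * f x * (ennreal (1 / b) * g y) = (ennreal (1 / a) * ennreal (1 / b)) * (f x * g y)"
      by (simp only: mult_ac)
    also have "ennreal (1 / a) * ennreal (1 / b) = (ennreal (1 / c))\<^sup>2"
      using a b c by (simp add: ennreal_power power_divide flip: ennreal_mult)
    also have "(ennreal (1 / c))\<^sup>2 * (f x * g y) \<le> (ennreal (1 / c))\<^sup>2 * (h ((x + y) / 2))\<^sup>2"
      by (intro mult_left_mono mid) simp
    finally show "ennreal (1 / a) * f x * (ennreal (1 / b) * g y) \<le> (ennreal (1 / c) * h ((x + y) / 2))\<^sup>2"
      by (simp add: power_mult_distrib)
  qed measurable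
  then have *: "ennreal (1 / a) * F + ennreal (1 / b) * G \<le> 2 * (ennreal (1 / c) * H)"
    by (simp add: nn_integral_cmult F_def G_def H_def)
  have "4 * (ennreal (1 / a) * F * (ennreal (1 / b) * G)) \<le> (2 * (ennreal (1 / c) * H))\<^sup>2"
    by (rule order_trans[OF ennreal_arith_geo_mean power_mono[OF *]]) simp
  then have "4 * ((ennreal (1 / a) * ennreal (1 / b)) * (F * G)) \<le> 4 * ((ennreal (1 / c))\<^sup>2 * H\<^sup>2)"
    by (simp only: power_mult_distrib mult_ac) (simp add: power2_eq_square mult_ac)
  then have "ennreal (a * b) * ((ennreal (1 / a) * ennreal (1 / b)) * (F * G)) \<le> ennreal (a * b) * ((ennreal (1 / c))\<^sup>2 * H\<^sup>2)"
    by (intro mult_left_mono) (auto simp: ennreal_mult_le_mult_iff)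
  moreover have "ennreal (a * b) * (ennreal (1 / a) * ennreal (1 / b)) = 1"
    using a b by (simp flip: ennreal_mult)
  moreover have "ennreal (a * b) * (ennreal (1 / c))\<^sup>2 = 1"
    using a b c by (simp add: ennreal_power power_divide flip: ennreal_mult)
  ultimately show ?thesis by (simp add: F_def G_def H_def mult.assoc[symmetric])
qed

lemma prekopa_leindler_line:
  fixes f g h :: "real \<Rightarrow> ennreal"
  assumes [measurable]: "f \<in> borel_measurable borel" "g \<in> borel_measurable borel" "h \<in> borel_measurable borel"
    and mid: "\<And>x y. f x * g y \<le> (h ((x + y) / 2))\<^sup>2"
  shows "(\<integral>\<^sup>+ x. f x \<partial>lborel) * (\<integral>\<^sup>+ x. g x \<partial>lborel) \<le> (\<integral>\<^sup>+ x. h x \<partial>lborel)\<^sup>2"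
proof -
  let ?T = "\<lambda>(N :: nat) f x. min (f x) (ennreal (real N))"
  have conv: "(\<integral>\<^sup>+ x. f x \<partial>lborel) = (SUP N. \<integral>\<^sup>+ x. ?T N f x \<partial>lborel)"
    if [measurable]: "f \<in> borel_measurable borel" for f :: "real \<Rightarrow> ennreal"
  proof -
    have "(SUP N. ?T N f x) = f x" for x
    proof -
      have "(SUP N. min (f x) (ennreal (real N))) = min (f x) (SUP N. ennreal (real N))"
        using inf_SUP[of "f x" "\<lambda>N. ennreal (real N)" UNIV] by (simp add: inf_min)
      then show ?thesis by (simp add: ennreal_of_nat_eq_real_of_nat[symmetric] ennreal_SUP_of_nat_eq_top)
    qed
    then have "(\<integral>\<^sup>+ x. f x \<partial>lborel) = (\<integral>\<^sup>+ x. (SUP N. ?T N f x) \<partial>lborel)" by simp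
    also have "\<dots> = (SUP N. \<integral>\<^sup>+ x. ?T N f x \<partial>lborel)"
      by (rule nn_integral_monotone_convergence_SUP)
         (auto simp: incseq_def le_fun_def min_le_iff_disj intro!: ennreal_leI)
    finally show ?thesis .
  qed
  have "(\<integral>\<^sup>+ x. ?T N f x \<partial>lborel) * (\<integral>\<^sup>+ x. ?T M g x \<partial>lborel) \<le> (\<integral>\<^sup>+ x. h x \<partial>lborel)\<^sup>2" for N M
  proof (rule prekopa_leindler_bounded[where N = "real (max N M)"])
    fix x y
    show "?T N f x * ?T M g y \<le> (h ((x + y) / 2))\<^sup>2"
      by (rule order_trans[OF mult_mono mid]) auto
  qed (auto simp: min_le_iff_disj intro!: ennreal_leI)
  then show ?thesis
    unfolding conv[OF assms(1)] conv[OF assms(2)]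
    by (simp add: SUP_mult_left_ennreal SUP_mult_right_ennreal SUP_le_iff)
qed

lemma fun_upd_extensional: "x \<in> extensional B \<Longrightarrow> x(i := t) \<in> extensional (insert i B)"
  by (simp add: extensional_def)

text \<open>
  Induction on the dimension: the marginals of \<open>f\<close>, \<open>g\<close>, \<open>h\<close> along one
  coordinate satisfy the hypothesis of the one-dimensional case by the induction hypothesis.
\<close>

lemma prekopa_leindler_PiM:
  fixes f g h :: "('i \<Rightarrow> real) \<Rightarrow> ennreal"
  assumes "finite B"
    and "f \<in> borel_measurable (Pi\<^sub>M B (\<lambda>_. lborel))" "g \<in> borel_measurable (Pi\<^sub>M B (\<lambda>_. lborel))"
      "h \<in> borel_measurable (Pi\<^sub>M B (\<lambda>_. lborel))"
    and "\<And>x y. x \<in> extensional B \<Longrightarrow> y \<in> extensional B \<Longrightarrow> f x * g y \<le> (h (\<lambda>b\<in>B. (x b + y b) / 2))\<^sup>2"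
  shows "(\<integral>\<^sup>+ x. f x \<partial>Pi\<^sub>M B (\<lambda>_. lborel)) * (\<integral>\<^sup>+ x. g x \<partial>Pi\<^sub>M B (\<lambda>_. lborel)) \<le>
    (\<integral>\<^sup>+ x. h x \<partial>Pi\<^sub>M B (\<lambda>_. lborel))\<^sup>2"
  using assms
proof (induction B arbitrary: f g h rule: finite_induct)
  case empty
  show ?case using empty(4)[of "\<lambda>_. undefined" "\<lambda>_. undefined"]
    by (simp add: lebesgue_product.nn_integral_empty extensional_def restrict_def)
next
  case (insert i B)
  note [measurable] = insert.prems(1-3)
  interpret B: finite_product_sigma_finite "\<lambda>_. lborel :: real measure" B by standard fact
  let ?I = "\<lambda>(k :: ('i \<Rightarrow> real) \<Rightarrow> ennreal) t. \<integral>\<^sup>+ x. k (x(i := t)) \<partial>Pi\<^sub>M B (\<lambda>_. lborel)"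
  have meas: "(\<lambda>(t, x). k (x(i := t))) \<in> borel_measurable (borel \<Otimes>\<^sub>M Pi\<^sub>M B (\<lambda>_. lborel))"
    if [measurable]: "k \<in> borel_measurable (Pi\<^sub>M (insert i B) (\<lambda>_. lborel))" for k :: "('i \<Rightarrow> real) \<Rightarrow> ennreal"
    by measurable
  have slice: "(\<lambda>x. k (x(i := t))) \<in> borel_measurable (Pi\<^sub>M B (\<lambda>_. lborel))"
    if "k \<in> borel_measurable (Pi\<^sub>M (insert i B) (\<lambda>_. lborel))" for k :: "('i \<Rightarrow> real) \<Rightarrow> ennreal" and t
    using measurable_Pair2[OF meas[OF that], of t] by simp
  have I_meas: "?I k \<in> borel_measurable borel" if "k \<in> borel_measurable (Pi\<^sub>M (insert i B) (\<lambda>_. lborel))" for k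
    using meas[OF that] by (rule B.borel_measurable_nn_integral)
  have "(\<integral>\<^sup>+ t. ?I f t \<partial>lborel) * (\<integral>\<^sup>+ t. ?I g t \<partial>lborel) \<le> (\<integral>\<^sup>+ t. ?I h t \<partial>lborel)\<^sup>2"
  proof (rule prekopa_leindler_line)
    fix t s :: real
    show "?I f t * ?I g s \<le> (?I h ((t + s) / 2))\<^sup>2"
    proof (rule insert.IH)
      fix x y :: "'i \<Rightarrow> real" assume xy: "x \<in> extensional B" "y \<in> extensional B"
      have "(\<lambda>b\<in>insert i B. ((x(i := t)) b + (y(i := s)) b) / 2) = (\<lambda>b\<in>B. (x b + y b) / 2)(i := (t + s) / 2)"
        using insert.hyps by (auto simp: fun_eq_iff)
      then show "f (x(i := t)) * g (y(i := s)) \<le> (h ((\<lambda>b\<in>B. (x b + y b) / 2)(i := (t + s) / 2)))\<^sup>2"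
        using insert.prems(4)[OF fun_upd_extensional[OF xy(1), of i t] fun_upd_extensional[OF xy(2), of i s]] by (simp only:)
    qed (rule slice, rule insert.prems)+
  qed (auto intro: I_meas insert.prems)
  then show ?case
    by (subst (1 2 3) lebesgue_product.product_nn_integral_insert_rev) (use insert in auto)
qed

text \<open>
  Brunn's theorem for an even density \<open>F\<close>. Let \<open>M v\<close> be the integral of \<open>F\<close>
  over the translate by \<open>v\<close>. Prekopa--Leindler for midpoints gives \<open>M(v) M(-v) \<le>
  M(0)\<^sup>2\<close>, that is \<open>M(v) \<le> M(0)\<close>, and \<open>M(2v) M(0) \<le> M(v)\<^sup>2\<close>;
  together \<open>M(2v) \<le> M(v)\<close>. Using midpoints only yields the comparison of \<open>v\<close> with
  \<open>2 v\<close>; this is the origin of the pair of variances \<open>s\<close> and \<open>4 s\<close> below.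
\<close>

lemma parallel_section_integral_mono:
  fixes F :: "'a::euclidean_space \<Rightarrow> ennreal"
  assumes B: "orthonormal_basis_of H B"
    and [measurable]: "F \<in> borel_measurable borel"
    and mid: "\<And>x y. F x * F y \<le> (F ((1/2) *\<^sub>R (x + y)))\<^sup>2"
    and even: "\<And>x. F (- x) = F x"
  shows "(\<integral>\<^sup>+ x. F (x + 2 *\<^sub>R v) \<partial>basis_measure B) \<le> (\<integral>\<^sup>+ x. F (x + v) \<partial>basis_measure B)"
proof -
  have fin: "finite B" using B by (simp add: orthonormal_basis_of_def)
  define M where "M v = (\<integral>\<^sup>+ x. F (x + v) \<partial>basis_measure B)" for v
  have pl: "M v * M w \<le> (M ((1/2) *\<^sub>R (v + w)))\<^sup>2" for v w
  proof -
    have M: "M v = (\<integral>\<^sup>+ c. F ((\<Sum>b\<in>B. c b *\<^sub>R b) + v) \<partial>Pi\<^sub>M B (\<lambda>_. lborel))" for v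
      unfolding M_def by (rule nn_integral_basis_measure) measurable
    show ?thesis unfolding M
    proof (rule prekopa_leindler_PiM[OF fin])
      fix x y :: "'a \<Rightarrow> real"
      have "(\<Sum>b\<in>B. (\<lambda>b\<in>B. (x b + y b) / 2) b *\<^sub>R b) + (1/2) *\<^sub>R (v + w) =
          (1/2) *\<^sub>R (((\<Sum>b\<in>B. x b *\<^sub>R b) + v) + ((\<Sum>b\<in>B. y b *\<^sub>R b) + w))"
        by (simp add: scaleR_add_right scaleR_sum_right scaleR_add_left add_divide_distrib sum.distrib algebra_simps)
      then show "F ((\<Sum>b\<in>B. x b *\<^sub>R b) + v) * F ((\<Sum>b\<in>B. y b *\<^sub>R b) + w) \<le>
          (F ((\<Sum>b\<in>B. (\<lambda>b\<in>B. (x b + y b) / 2) b *\<^sub>R b) + (1/2) *\<^sub>R (v + w)))\<^sup>2"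
        using mid by simp
    qed measurable
  qed
  have "M (- v) = M v" for v
  proof -
    have "M (- v) = (\<integral>\<^sup>+ x. F ((0 + (-1) *\<^sub>R x) + - v) \<partial>basis_measure B)"
      unfolding M_def by (rule nn_integral_basis_measure_isometry[OF fin, symmetric]) (auto simp: span_zero)
    also have "\<dots> = (\<integral>\<^sup>+ x. F (- (x + v)) \<partial>basis_measure B)" by (simp add: add.commute)
    finally show ?thesis by (simp only: even M_def)
  qed
  then have le0: "M v \<le> M 0" for v using pl[of v "- v"] by (simp add: ennreal_power2_le_iff flip: power2_eq_square)
  have "(M (2 *\<^sub>R v))\<^sup>2 \<le> M (2 *\<^sub>R v) * M 0" unfolding power2_eq_square by (intro mult_left_mono le0) simp
  also have "\<dots> \<le> (M v)\<^sup>2" using pl[of "2 *\<^sub>R v" 0] by simp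
  finally show ?thesis by (simp add: ennreal_power2_le_iff M_def)
qed

section \<open>The Minkowski functional\<close>

definition minkowski :: "'a::euclidean_space set \<Rightarrow> 'a \<Rightarrow> real" where
  "minkowski K x = Inf {t. 0 < t \<and> (1 / t) *\<^sub>R x \<in> K}"

locale symmetric_body =
  fixes K :: "'a::euclidean_space set"
  assumes body: "origin_symmetric_convex_body K"
begin

lemma compact: "compact K" and convex: "convex K" and symmetric: "x \<in> K \<Longrightarrow> - x \<in> K"
  using body by (auto simp: origin_symmetric_convex_body_def)

lemma ball_subset: obtains r where "r > 0" "cball 0 r \<subseteq> K"
proof -
  obtain c where "c \<in> interior K" using body by (auto simp: origin_symmetric_convex_body_def)
  then obtain r where r: "r > 0" "cball c r \<subseteq> K" by (auto simp: mem_interior_cball)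
  have "x \<in> K" if "norm x \<le> r" for x
  proof -
    have "c + x \<in> K" "c - x \<in> K" using r that by (auto simp: subset_iff dist_norm)
    then have "(1/2) *\<^sub>R (c + x) + (1/2) *\<^sub>R (- (c - x)) \<in> K"
      by (intro convexD[OF convex] symmetric) auto
    then show "x \<in> K" by (simp add: algebra_simps flip: scaleR_add_left)
  qed
  then show ?thesis using r(1) by (intro that[of r]) auto
qed

lemma zero_mem: "0 \<in> K" using ball_subset by (metis centre_in_cball less_imp_le subsetD)

lemma scale_mem: "x \<in> K \<Longrightarrow> 0 \<le> t \<Longrightarrow> t \<le> 1 \<Longrightarrow> t *\<^sub>R x \<in> K"
  using convexD[OF convex zero_mem, of x "1 - t" t] by simp

lemma minkowski_set_nonempty: "{t. 0 < t \<and> (1 / t) *\<^sub>R x \<in> K} \<noteq> {}"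
proof -
  obtain r where r: "r > 0" "cball 0 r \<subseteq> K" by (rule ball_subset)
  define t where "t = (norm x + 1) / r"
  have "t > 0" using r by (simp add: t_def add_nonneg_pos)
  moreover have "norm ((1 / t) *\<^sub>R x) \<le> r"
    using r \<open>t > 0\<close> by (simp add: t_def field_simps mult_left_le)
  ultimately have "0 < t \<and> (1 / t) *\<^sub>R x \<in> K" using r by (auto simp: subset_iff)
  then show ?thesis by blast
qed

lemma minkowski_nonneg: "0 \<le> minkowski K x"
  unfolding minkowski_def by (rule cInf_greatest[OF minkowski_set_nonempty]) auto

lemma minkowski_le_iff:
  assumes t: "t > 0"
  shows "minkowski K x \<le> t \<longleftrightarrow> (1 / t) *\<^sub>R x \<in> K"
proof
  assume "(1 / t) *\<^sub>R x \<in> K"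
  then show "minkowski K x \<le> t" unfolding minkowski_def using t
    by (intro cInf_lower) (auto intro!: bdd_belowI[of _ 0])
next
  assume le: "minkowski K x \<le> t"
  have mem: "(1 / s) *\<^sub>R x \<in> K" if "s > t" for s
  proof -
    have "minkowski K x < s" using le that by simp
    then obtain u where u: "0 < u" "(1 / u) *\<^sub>R x \<in> K" "u < s"
      unfolding minkowski_def using cInf_lessD[OF minkowski_set_nonempty] by blast
    then show ?thesis using scale_mem[OF u(2), of "u / s"] by simp
  qed
  have "(\<lambda>n. (1 / (t + 1 / real (Suc n))) *\<^sub>R x) \<longlonglongrightarrow> (1 / (t + 0)) *\<^sub>R x"
    using t by (intro tendsto_intros LIMSEQ_inverse_real_of_nat[unfolded inverse_eq_divide]) auto
  then show "(1 / t) *\<^sub>R x \<in> K"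
    using closed_sequentially[OF compact_imp_closed[OF compact], of "\<lambda>n. (1 / (t + 1 / real (Suc n))) *\<^sub>R x"] mem
    by simp
qed

lemma minkowski_le_1_iff: "minkowski K x \<le> 1 \<longleftrightarrow> x \<in> K"
  using minkowski_le_iff[of 1 x] by simp

lemma minkowski_eqI:
  assumes "\<And>t. t > 0 \<Longrightarrow> minkowski K x \<le> t \<longleftrightarrow> a \<le> t" "a \<ge> 0"
  shows "minkowski K x = a"
proof (rule antisym)
  show "minkowski K x \<le> a"
  proof (rule dense_ge)
    fix t assume "a < t"
    then show "minkowski K x \<le> t" using assms(1)[of t] assms(2) by linarith
  qed
  show "a \<le> minkowski K x"
  proof (rule dense_ge)
    fix t assume "minkowski K x < t"
    then show "a \<le> t" using assms(1)[of t] minkowski_nonneg[of x] by linarith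
  qed
qed

lemma minkowski_scaleR: "minkowski K (c *\<^sub>R x) = \<bar>c\<bar> * minkowski K x"
proof (cases "c = 0")
  case True
  have "minkowski K 0 = 0" by (rule minkowski_eqI) (auto simp: minkowski_le_iff zero_mem)
  then show ?thesis using True by simp
next
  case False
  have m: "minkowski K (- x) = minkowski K x" for x
    using symmetric minkowski_nonneg[of x] symmetric[of "- _"] by (intro minkowski_eqI) (force simp: minkowski_le_iff)+
  have "minkowski K (\<bar>c\<bar> *\<^sub>R x) = \<bar>c\<bar> * minkowski K x"
  proof (rule minkowski_eqI)
    fix t :: real assume "t > 0"
    then show "minkowski K (\<bar>c\<bar> *\<^sub>R x) \<le> t \<longleftrightarrow> \<bar>c\<bar> * minkowski K x \<le> t"
      using False minkowski_le_iff[of "t / \<bar>c\<bar>" x] minkowski_le_iff[of t "\<bar>c\<bar> *\<^sub>R x"] by (simp add: field_simps)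
  qed (simp add: minkowski_nonneg)
  moreover have "minkowski K (c *\<^sub>R x) = minkowski K (\<bar>c\<bar> *\<^sub>R x)"
    using m[of "c *\<^sub>R x"] by (cases "c > 0") (auto simp: abs_if)
  ultimately show ?thesis by simp
qed

lemma minkowski_triangle: "minkowski K (x + y) \<le> minkowski K x + minkowski K y"
proof (rule field_le_epsilon)
  fix e :: real assume e: "e > 0"
  define s where "s = minkowski K x + e / 2"
  define t where "t = minkowski K y + e / 2"
  have st: "s > 0" "t > 0" using minkowski_nonneg[of x] minkowski_nonneg[of y] e by (auto simp: s_def t_def add_nonneg_pos)
  have "(1 / s) *\<^sub>R x \<in> K" "(1 / t) *\<^sub>R y \<in> K"
    using st e by (auto simp flip: minkowski_le_iff simp: s_def t_def)
  then have "(s / (s + t)) *\<^sub>R ((1 / s) *\<^sub>R x) + (t / (s + t)) *\<^sub>R ((1 / t) *\<^sub>R y) \<in> K"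
    using st by (intro convexD[OF convex]) (auto simp flip: add_divide_distrib)
  then have "(1 / (s + t)) *\<^sub>R (x + y) \<in> K" using st by (simp add: scaleR_add_right)
  then have "minkowski K (x + y) \<le> s + t" using st by (subst minkowski_le_iff) auto
  then show "minkowski K (x + y) \<le> minkowski K x + minkowski K y + e" by (simp add: s_def t_def)
qed

lemma minkowski_bounds:
  obtains r R where "r > 0" "R > 0" "\<And>x. minkowski K x \<le> norm x / r" "\<And>x. norm x \<le> R * minkowski K x"
proof -
  obtain r where r: "r > 0" "cball 0 r \<subseteq> K" by (rule ball_subset)
  obtain R where R: "R > 0" "\<And>x. x \<in> K \<Longrightarrow> norm x \<le> R"
    using compact_imp_bounded[OF compact] by (auto simp: bounded_pos)
  show ?thesis
  proof (rule that[OF r(1) R(1)])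
    fix x
    show "minkowski K x \<le> norm x / r"
    proof (cases "x = 0")
      case False
      then show ?thesis using r by (subst minkowski_le_iff) auto
    qed (use minkowski_scaleR[of 0 0] in simp)
    show "norm x \<le> R * minkowski K x"
    proof -
      have "norm x / R \<le> t" if "t > minkowski K x" for t
      proof -
        have t: "t > 0" using minkowski_nonneg[of x] that by simp
        then have "norm ((1 / t) *\<^sub>R x) \<le> R" using that by (intro R(2)) (simp flip: minkowski_le_iff)
        then show ?thesis using t R(1) by (simp add: field_simps)
      qed
      then have "norm x / R \<le> minkowski K x" by (rule dense_ge)
      then show ?thesis using R(1) by (simp add: field_simps)
    qed
  qed
qed

lemma minkowski_pos: "x \<noteq> 0 \<Longrightarrow> minkowski K x > 0"
  using minkowski_bounds by (metis minkowski_nonneg less_le mult_zero_right norm_le_zero_iff)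

lemma continuous_minkowski: "continuous_on UNIV (minkowski K)"
proof -
  obtain r R where r: "r > 0" and le: "\<And>x. minkowski K x \<le> norm x / r" by (rule minkowski_bounds) blast
  have 1: "minkowski K x - minkowski K y \<le> norm (x - y) / r" for x y
    using minkowski_triangle[of "x - y" y] le[of "x - y"] by simp
  have "dist (minkowski K x) (minkowski K y) \<le> (1 / r) * dist x y" for x y
    using 1[of x y] 1[of y x] by (simp add: dist_norm abs_le_iff norm_minus_commute)
  then have "(1 / r)-lipschitz_on UNIV (minkowski K)" using r by (intro lipschitz_onI) auto
  then show ?thesis by (rule lipschitz_on_continuous_on)
qed

lemma measurable_minkowski [measurable]: "minkowski K \<in> borel_measurable borel"
  using continuous_minkowski by (rule borel_measurable_continuous_onI)

lemma sets_body [measurable]: "K \<in> sets borel"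
  using compact by (rule borel_compact)

end

text \<open>
  Invariance under all \<open>R\<^sub>\<theta>\<close> makes the norm of \<open>K\<close> a complex norm. In
  particular it is radial on complex lines.
\<close>

lemma minkowski_smult:
  fixes K :: "(complex ^ 'n) set"
  assumes body: "origin_symmetric_convex_body K" and inv: "rotation_invariant K"
  shows "minkowski K (u *s x) = cmod u * minkowski K x"
proof -
  interpret symmetric_body K using body by unfold_locales
  define \<theta> where "\<theta> = Arg2pi u"
  have \<theta>: "\<theta> \<in> {0..2 * pi}" using Arg2pi[of u] by (auto simp: \<theta>_def)
  have u: "u = of_real (cmod u) * cis \<theta>" using Arg2pi[of u] by (simp add: \<theta>_def cis_conv_exp is_Arg_def)
  have rot: "rotate_all \<theta> y \<in> K \<longleftrightarrow> y \<in> K" for y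
  proof -
    have "inj (rotate_all \<theta> :: complex ^ 'n \<Rightarrow> _)" by (auto simp: inj_def rotate_all_def vec_eq_iff)
    then show ?thesis using inv \<theta> unfolding rotation_invariant_def by (metis inj_image_mem_iff)
  qed
  have "minkowski K (rotate_all \<theta> y) = minkowski K y" for y
  proof (rule minkowski_eqI)
    fix t :: real assume "t > 0"
    moreover have "(1 / t) *\<^sub>R rotate_all \<theta> y = rotate_all \<theta> ((1 / t) *\<^sub>R y)"
      by (simp add: rotate_all_def vec_eq_iff)
    ultimately show "minkowski K (rotate_all \<theta> y) \<le> t \<longleftrightarrow> minkowski K y \<le> t" by (simp add: minkowski_le_iff rot)
  qed (rule minkowski_nonneg)
  moreover have "u *s x = cmod u *\<^sub>R rotate_all \<theta> x"
    by (subst u) (simp add: rotate_all_def vec_eq_iff scaleR_conv_of_real[where 'a = complex] mult.assoc)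
  ultimately show ?thesis by (simp add: minkowski_scaleR)
qed

text \<open>
  The cylinder over \<open>K \<inter> H\<^sub>z\<close> is convex, so its boundary is negligible; by Fubini the
  relative boundary of the section is negligible too. This makes indicator functions of bodies continuous almost
  everywhere on each hyperplane.
\<close>

lemma AE_hyperplane_minkowski_neq_1:
  fixes K :: "(complex ^ 'n) set"
  assumes body: "origin_symmetric_convex_body K" and z: "norm z = 1"
  shows "AE h in hyperplane_measure z. minkowski K h \<noteq> 1"
proof -
  interpret symmetric_body K using body by unfold_locales
  let ?C = "hproj z -` K" and ?N = "{x. minkowski K (hproj z x) = 1}"
  have lin: "linear (hproj z)"
    by (rule linearI) (simp_all add: hproj_def hprod_add_left hprod_scaleR_left vec_eq_iff algebra_simps scaleR_conv_of_real[where 'a = complex])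
  have [measurable]: "hproj z \<in> borel_measurable borel" unfolding hproj_def by measurable
  have "?N \<subseteq> frontier ?C"
  proof
    fix x assume x: "x \<in> ?N"
    then have "x \<in> ?C" by (simp flip: minkowski_le_1_iff)
    moreover have "x \<notin> interior ?C"
    proof
      assume "x \<in> interior ?C"
      then obtain e where e: "e > 0" "ball x e \<subseteq> ?C" by (auto simp: mem_interior)
      have x0: "x \<noteq> 0" using x minkowski_scaleR[of 0 0] linear_0[OF lin] by auto
      define t where "t = 1 + e / (2 * norm x)"
      have "dist x (t *\<^sub>R x) = e / 2" using x0 e
        by (simp add: dist_norm t_def algebra_simps)
      then have "t *\<^sub>R x \<in> ?C" using e by (intro subsetD[OF e(2)]) simp
      then have "\<bar>t\<bar> * minkowski K (hproj z x) \<le> 1"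
        using linear_scale[OF lin] minkowski_scaleR by (simp flip: minkowski_le_1_iff)
      moreover have "t > 1" using e x0 by (simp add: t_def)
      ultimately show False using x by simp
    qed
    ultimately show "x \<in> frontier ?C" using closure_subset[of ?C] by (auto simp: frontier_def simp del: vimage_eq)
  qed
  moreover have "negligible (frontier ?C)"
    by (intro negligible_convex_frontier convex_linear_vimage lin convex)
  ultimately have "negligible ?N" by (rule negligible_subset[rotated])
  then have "?N \<in> null_sets lborel"
    by (simp add: negligible_iff_null_sets null_sets_completion_iff)
  then have "0 = (\<integral>\<^sup>+ x. indicator ?N x \<partial>lborel)" by (simp add: null_setsD1)
  also have "\<dots> = (\<integral>\<^sup>+ u. \<integral>\<^sup>+ h. indicator {h. minkowski K h = 1} h \<partial>hyperplane_measure z \<partial>(lborel :: complex measure))"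
    using z by (intro nn_integral_hyperplane_split)
      (auto simp: hproj_def hprod_add_left hprod_scale_left hprod_self indicator_def)
  finally have "emeasure (hyperplane_measure z) {h. minkowski K h = 1} * emeasure (lborel :: complex measure) UNIV = 0"
    by simp
  then have "emeasure (hyperplane_measure z) {h. minkowski K h = 1} = 0" by simp
  then show ?thesis by (subst AE_iff_measurable[OF _ refl]) auto
qed

section \<open>The mass of the section kernel\<close>

text \<open>
  The partial fractions of \<open>1 / ((s + r) (4 s + r))\<close> as a Laplace transform in \<open>r\<close>;
  applied with \<open>r = \<bar>h\<bar>\<^sup>2\<close> it turns the section kernel into a superposition of
  Gaussians.
\<close>

lemma nn_integral_exp_difference:
  assumes s: "s > 0" and r: "r \<ge> 0"
  shows "(\<integral>\<^sup>+ t. ennreal ((exp (- (t * s)) - exp (- (t * (4 * s)))) / (3 * s) * exp (- (t * r))) * indicator {0..} t \<partial>lborel) =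
    ennreal (1 / ((s + r) * (4 * s + r)))"
proof -
  define F where "F t = (exp (- ((4 * s + r) * t)) / (4 * s + r) - exp (- ((s + r) * t)) / (s + r)) / (3 * s)" for t
  have sr: "s + r > 0" "4 * s + r > 0" using s r by auto
  have lim: "((\<lambda>t. exp (- (c * t))) \<longlongrightarrow> 0) at_top" if "c > 0" for c :: real
    using that by (intro filterlim_compose[OF exp_at_bot] filterlim_compose[OF filterlim_uminus_at_bot_at_top]
        filterlim_tendsto_pos_mult_at_top[OF tendsto_const _ filterlim_ident])
  have "(F \<longlongrightarrow> (0 / (4 * s + r) - 0 / (s + r)) / (3 * s)) at_top"
    unfolding F_def using s sr by (intro tendsto_intros lim) auto
  moreover have "(F has_real_derivative (exp (- (t * s)) - exp (- (t * (4 * s)))) / (3 * s) * exp (- (t * r))) (at t)" for t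
  proof -
    have "((\<lambda>t. exp (- (a * t)) / a) has_real_derivative - exp (- (a * t))) (at t)" if "a > 0" for a
      using that by (auto intro!: derivative_eq_intros)
    then have "(F has_real_derivative (- exp (- ((4 * s + r) * t)) - (- exp (- ((s + r) * t)))) / (3 * s)) (at t)"
      unfolding F_def using sr by (intro DERIV_cdivide DERIV_diff)
    moreover have "exp (- ((4 * s + r) * t)) = exp (- (t * (4 * s))) * exp (- (t * r))" "exp (- ((s + r) * t)) = exp (- (t * s)) * exp (- (t * r))"
      by (simp_all add: algebra_simps flip: exp_add)
    ultimately show ?thesis by (simp add: algebra_simps diff_divide_distrib)
  qed
  moreover have "0 - F 0 = 1 / ((s + r) * (4 * s + r))"
  proof -
    have "1 / (s + r) - 1 / (4 * s + r) = 3 * s / ((s + r) * (4 * s + r))" using sr by (simp add: field_simps)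
    moreover have "0 - F 0 = (1 / (s + r) - 1 / (4 * s + r)) / (3 * s)" by (simp add: F_def diff_divide_distrib)
    ultimately show ?thesis using s by simp
  qed
  ultimately show ?thesis
    using s r by (subst nn_integral_FTC_atLeast[where F = F and T = 0]) (auto simp: mult_left_mono)
qed

text \<open>
  The difference of \<open>1 / (s + r\<^sup>2)\<close> and \<open>1 / (4 s + r\<^sup>2)\<close>, divided by
  \<open>3 s\<close>.
\<close>

definition section_kernel :: "real \<Rightarrow> real \<Rightarrow> real" where
  "section_kernel s r = 1 / ((s + r\<^sup>2) * (4 * s + r\<^sup>2))"

lemma section_kernel_nonneg: "s > 0 \<Longrightarrow> 0 \<le> section_kernel s r"
  by (simp add: section_kernel_def)

lemma measurable_section_kernel [measurable]: "section_kernel s \<in> borel_measurable borel"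
  unfolding section_kernel_def by measurable

text \<open>
  The total mass of \<open>exp (- \<bar>h\<bar>\<^sup>2) section_kernel s \<bar>h\<bar>\<close> on a complex
  hyperplane, through the Laplace transform. In this form it visibly does not depend on the hyperplane.
\<close>

definition kernel_mass :: "nat \<Rightarrow> real \<Rightarrow> real" where
  "kernel_mass k s = enn2real (\<integral>\<^sup>+ t. ennreal ((exp (- (t * s)) - exp (- (t * (4 * s)))) / (3 * s)) *
      indicator {0..} t * ennreal ((gauss\<^sup>2 / (1 + t)) ^ k) \<partial>lborel)"

text \<open>
  Writing the kernel as a superposition of Gaussians and integrating over the hyperplane first, each
  \<open>t\<close> contributes the Gaussian integral \<open>(gauss\<^sup>2 / (1 +
  t))\<^sup>n\<^sup>-\<^sup>1\<close>.
\<close>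

lemma kernel_mass:
  fixes z :: "complex ^ 'n"
  assumes z: "norm z = 1" and s: "s > 0"
  shows "(\<integral>\<^sup>+ h. ennreal (exp (- (norm h)\<^sup>2) * section_kernel s (norm h)) \<partial>hyperplane_measure z) = ennreal (kernel_mass (CARD('n) - 1) s)"
    (is "?I = _")
    and "(\<integral>\<^sup>+ t. ennreal ((exp (- (t * s)) - exp (- (t * (4 * s)))) / (3 * s)) *
      indicator {0..} t * ennreal ((gauss\<^sup>2 / (1 + t)) ^ (CARD('n) - 1)) \<partial>lborel) = ennreal (kernel_mass (CARD('n) - 1) s)"
    (is "?J = _")
proof -
  interpret sigma_finite_measure "hyperplane_measure z" by (rule sigma_finite_hyperplane_measure)
  interpret P: pair_sigma_finite "hyperplane_measure z" "lborel :: real measure" ..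
  let ?E = "\<lambda>t. ennreal ((exp (- (t * s)) - exp (- (t * (4 * s)))) / (3 * s)) * indicator {0..} t"
  have E: "?E t * ennreal x = ennreal ((exp (- (t * s)) - exp (- (t * (4 * s)))) / (3 * s) * x) * indicator {0..} t" if "x \<ge> 0" for t x
  proof (cases "t \<ge> 0")
    case True
    then have "0 \<le> (exp (- (t * s)) - exp (- (t * (4 * s)))) / (3 * s)" using s by (auto simp: mult_left_mono)
    from ennreal_mult[OF this \<open>x \<ge> 0\<close>] show ?thesis using True by simp
  qed simp
  have "?I = (\<integral>\<^sup>+ h. \<integral>\<^sup>+ t. ?E t * ennreal (exp (- ((1 + t) * (norm h)\<^sup>2))) \<partial>lborel \<partial>hyperplane_measure z)"
  proof (rule nn_integral_cong)
    fix h :: "complex ^ 'n"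
    have "(\<integral>\<^sup>+ t. ?E t * ennreal (exp (- ((1 + t) * (norm h)\<^sup>2))) \<partial>lborel) =
      (\<integral>\<^sup>+ t. ennreal (exp (- (norm h)\<^sup>2)) * (ennreal ((exp (- (t * s)) - exp (- (t * (4 * s)))) / (3 * s) * exp (- (t * (norm h)\<^sup>2))) * indicator {0..} t) \<partial>lborel)"
    proof (rule nn_integral_cong)
      fix t :: real
      have "exp (- ((1 + t) * (norm h)\<^sup>2)) = exp (- (norm h)\<^sup>2) * exp (- (t * (norm h)\<^sup>2))" by (simp add: algebra_simps flip: exp_add)
      then have "?E t * ennreal (exp (- ((1 + t) * (norm h)\<^sup>2))) = ?E t * (ennreal (exp (- (norm h)\<^sup>2)) * ennreal (exp (- (t * (norm h)\<^sup>2))))"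
        by (simp only: ennreal_mult[OF exp_ge_zero exp_ge_zero])
      also have "\<dots> = ennreal (exp (- (norm h)\<^sup>2)) * (?E t * ennreal (exp (- (t * (norm h)\<^sup>2))))"
        by (simp only: mult.left_commute)
      also note E[OF exp_ge_zero, of t "- (t * (norm h)\<^sup>2)"]
      finally show "?E t * ennreal (exp (- ((1 + t) * (norm h)\<^sup>2))) =
         ennreal (exp (- (norm h)\<^sup>2)) * (ennreal ((exp (- (t * s)) - exp (- (t * (4 * s)))) / (3 * s) * exp (- (t * (norm h)\<^sup>2))) * indicator {0..} t)" .
    qed
    also have "\<dots> = ennreal (exp (- (norm h)\<^sup>2)) * ennreal (1 / ((s + (norm h)\<^sup>2) * (4 * s + (norm h)\<^sup>2)))"
      by (subst nn_integral_cmult) (simp_all only: nn_integral_exp_difference[OF s zero_le_power2], measurable)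
    finally show "ennreal (exp (- (norm h)\<^sup>2) * section_kernel s (norm h)) = (\<integral>\<^sup>+ t. ?E t * ennreal (exp (- ((1 + t) * (norm h)\<^sup>2))) \<partial>lborel)"
      using s by (simp add: section_kernel_def ennreal_mult' flip: ennreal_mult)
  qed
  also have "\<dots> = (\<integral>\<^sup>+ t. \<integral>\<^sup>+ h. ?E t * ennreal (exp (- ((1 + t) * (norm h)\<^sup>2))) \<partial>hyperplane_measure z \<partial>lborel)"
    by (rule P.Fubini'[symmetric]) measurable
  also have "\<dots> = ?J"
  proof (rule nn_integral_cong)
    fix t :: real
    show "(\<integral>\<^sup>+ h. ?E t * ennreal (exp (- ((1 + t) * (norm h)\<^sup>2))) \<partial>hyperplane_measure z) = ?E t * ennreal ((gauss\<^sup>2 / (1 + t)) ^ (CARD('n) - 1))"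
    proof (cases "t \<ge> 0")
      case True
      then show ?thesis using nn_integral_gauss_hyperplane[OF z, of "1 + t"] by (subst nn_integral_cmult) auto
    qed simp
  qed
  finally have IJ: "?I = ?J" .
  have "?I \<le> (\<integral>\<^sup>+ h. ennreal (1 / (s * (4 * s))) * ennreal (exp (- (1 * (norm h)\<^sup>2))) \<partial>hyperplane_measure z)"
  proof (intro nn_integral_mono)
    fix h :: "complex ^ 'n"
    have "section_kernel s (norm h) \<le> 1 / (s * (4 * s))"
      unfolding section_kernel_def using s by (intro divide_left_mono mult_mono mult_pos_pos add_pos_nonneg) auto
    then show "ennreal (exp (- (norm h)\<^sup>2) * section_kernel s (norm h)) \<le> ennreal (1 / (s * (4 * s))) * ennreal (exp (- (1 * (norm h)\<^sup>2)))"
      using s by (subst ennreal_mult[symmetric]) (auto intro!: ennreal_leI simp: mult.commute[of "exp _"] mult_right_mono simp del: times_divide_eq_left)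
  qed
  also have "\<dots> < top" by (subst nn_integral_cmult) (auto simp: nn_integral_gauss_hyperplane[OF z zero_less_one, simplified] ennreal_mult_less_top)
  finally have fin: "?I < top" .
  then show "?J = ennreal (kernel_mass (CARD('n) - 1) s)" unfolding IJ kernel_mass_def by simp
  then show "?I = ennreal (kernel_mass (CARD('n) - 1) s)" unfolding IJ .
qed

text \<open>
  The limit kernel \<open>\<bar>h\<bar>\<^sup>-\<^sup>4\<close> is not integrable at the origin of a real space of
  dimension \<open>2 (n - 1) \<le> 4\<close>. In the Laplace representation this shows for large \<open>t\<close>:
  for \<open>1 \<le> t \<le> 1 / s\<close> the integrand is at least of order \<open>t \<cdot>
  t\<^sup>-\<^sup>2\<close>, as \<open>n - 1 \<le> 2\<close>, whence the logarithm. The dimension restriction of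
  the affirmative part has its origin here.
\<close>

lemma kernel_mass_ge:
  assumes n: "CARD('n) = 2 \<or> CARD('n) = 3"
  obtains c where "c > 0" "\<And>s. 0 < s \<Longrightarrow> s \<le> 1 \<Longrightarrow> c * ln (1 / s) \<le> kernel_mass (CARD('n::finite) - 1) s"
proof -
  let ?k = "CARD('n) - 1"
  define c0 where "c0 = min (gauss\<^sup>2) ((gauss\<^sup>2)\<^sup>2)"
  \<comment> \<open>The factor \<open>exp (-4)\<close> bounds \<open>exp (- 4 t s)\<close> below for \<open>t s \<le>
    1\<close>, and \<open>c0 / (4 t\<^sup>2)\<close> bounds \<open>(gauss\<^sup>2 / (1 +
    t))\<^sup>n\<^sup>-\<^sup>1\<close> below for \<open>t \<ge> 1\<close>.\<close>
  define c where "c = exp (-4) * c0 / 4"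
  have c0: "c0 > 0" using gauss_pos by (simp add: c0_def)
  have c: "c > 0" using c0 by (simp add: c_def)
  have pw: "(gauss\<^sup>2 / (1 + t)) ^ ?k \<ge> c0 / (4 * t\<^sup>2)" if t: "t \<ge> 1" for t :: real
  proof -
    have "c0 / (4 * t\<^sup>2) \<le> c0 / (1 + t)\<^sup>2"
      using t c0 power_mono[of "1 + t" "2 * t" 2] by (intro divide_left_mono) (auto simp: power_mult_distrib)
    also have "\<dots> \<le> (gauss\<^sup>2 / (1 + t)) ^ ?k"
    proof (cases "CARD('n) = 2")
      case True
      have "c0 / (1 + t)\<^sup>2 \<le> gauss\<^sup>2 / (1 + t)"
        using t c0 by (intro frac_le) (auto simp: c0_def power2_eq_square)
      then show ?thesis using True by simp
    next
      case False
      then have "?k = 2" using n by simp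
      then show ?thesis using t by (simp add: power_divide c0_def divide_right_mono)
    qed
    finally show ?thesis .
  qed
  show ?thesis
  proof (rule that[OF c])
    fix s :: real assume s: "0 < s" "s \<le> 1"
    define z :: "complex ^ 'n" where "z = axis undefined 1"
    have z: "norm z = 1" by (simp add: z_def)
    have "ennreal (c * ln (1 / s)) = (\<integral>\<^sup>+ t. ennreal (c / t) * indicator {1..1 / s} t \<partial>lborel)"
      using s c by (subst nn_integral_FTC_Icc[where F = "\<lambda>t. c * ln t"]) (auto intro!: derivative_eq_intros simp: field_simps)
    also have "\<dots> \<le> (\<integral>\<^sup>+ t. ennreal ((exp (- (t * s)) - exp (- (t * (4 * s)))) / (3 * s)) *
      indicator {0..} t * ennreal ((gauss\<^sup>2 / (1 + t)) ^ ?k) \<partial>lborel)"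
    proof (intro nn_integral_mono)
      fix t :: real
      show "ennreal (c / t) * indicator {1..1 / s} t \<le> ennreal ((exp (- (t * s)) - exp (- (t * (4 * s)))) / (3 * s)) *
          indicator {0..} t * ennreal ((gauss\<^sup>2 / (1 + t)) ^ ?k)"
      proof (cases "t \<in> {1..1 / s}")
        case True
        then have t: "t \<ge> 1" "t * s \<le> 1" using s by (auto simp: field_simps)
        have "exp (- (t * s)) - exp (- (t * (4 * s))) = exp (- (t * (4 * s))) * (exp (3 * (t * s)) - 1)"
          by (simp add: algebra_simps flip: exp_add)
        moreover have "exp (-4) * (3 * (t * s)) \<le> exp (- (t * (4 * s))) * (exp (3 * (t * s)) - 1)"
        proof (intro mult_mono)
          show "3 * (t * s) \<le> exp (3 * (t * s)) - 1" using exp_ge_add_one_self[of "3 * (t * s)"] by linarith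
        qed (use t s in auto)
        ultimately have D: "exp (-4) * t \<le> (exp (- (t * s)) - exp (- (t * (4 * s)))) / (3 * s)"
          using s by (simp add: field_simps)
        have "0 \<le> exp (-4) * t" using t by simp
        with D have "0 \<le> (exp (- (t * s)) - exp (- (t * (4 * s)))) / (3 * s)" by linarith
        with D have "exp (-4) * t * (c0 / (4 * t\<^sup>2)) \<le> (exp (- (t * s)) - exp (- (t * (4 * s)))) / (3 * s) * (gauss\<^sup>2 / (1 + t)) ^ ?k"
          using t c0 pw[OF t(1)] by (intro mult_mono) auto
        moreover have "exp (-4) * t * (c0 / (4 * t\<^sup>2)) = c / t" using t by (simp add: c_def power2_eq_square)
        ultimately show ?thesis using True t s
          by (simp add: ennreal_mult''[symmetric] ennreal_leI)
      qed simp
    qed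
    also have "\<dots> = ennreal (kernel_mass ?k s)" by (rule kernel_mass(2)[OF z s(1)])
    finally show "c * ln (1 / s) \<le> kernel_mass ?k s"
      using enn2real_nonneg unfolding kernel_mass_def[of ?k] by (simp add: ennreal_le_iff)
  qed
qed

text \<open>
  The real dimension is \<open>2 n > 2\<close>. The proof writes \<open>1 / \<bar>x\<bar>\<^sup>2\<close> as the
  integral of \<open>exp (- t \<bar>x\<bar>\<^sup>2)\<close> over \<open>t \<ge> 0\<close>.
\<close>

lemma integrable_gauss_inverse_square:
  assumes n: "CARD('n) \<ge> 2"
  shows "integrable lborel (\<lambda>x :: complex ^ 'n. exp (- (norm x)\<^sup>2) / (norm x)\<^sup>2)"
proof (rule integrableI_nonneg)
  have "(\<integral>\<^sup>+ x. ennreal (exp (- (norm (x :: complex ^ 'n))\<^sup>2) / (norm x)\<^sup>2) \<partial>lborel) \<le>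
     (\<integral>\<^sup>+ x. \<integral>\<^sup>+ t. indicator {0..} t * ennreal (exp (- ((1 + t) * (norm (x :: complex ^ 'n))\<^sup>2))) \<partial>lborel \<partial>lborel)"
  proof (intro nn_integral_mono)
    fix x :: "complex ^ 'n"
    show "ennreal (exp (- (norm x)\<^sup>2) / (norm x)\<^sup>2) \<le> (\<integral>\<^sup>+ t. indicator {0..} t * ennreal (exp (- ((1 + t) * (norm x)\<^sup>2))) \<partial>lborel)"
    proof (cases "x = 0")
      case False
      have "ennreal (exp (- (norm x)\<^sup>2) / (norm x)\<^sup>2) = ennreal (exp (- (norm x)\<^sup>2)) * ennreal (1 / (norm x)\<^sup>2)"
        by (simp flip: ennreal_mult)
      also have "\<dots> = (\<integral>\<^sup>+ t. ennreal (exp (- (norm x)\<^sup>2)) * (ennreal (exp (- ((norm x)\<^sup>2 * t))) * indicator {0..} t) \<partial>lborel)"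
        using False by (subst nn_integral_cmult) (auto simp: nn_integral_exp)
      also have "\<dots> = (\<integral>\<^sup>+ t. indicator {0..} t * ennreal (exp (- ((1 + t) * (norm x)\<^sup>2))) \<partial>lborel)"
        by (intro nn_integral_cong) (auto simp: indicator_def algebra_simps simp flip: ennreal_mult exp_add)
      finally show ?thesis by simp
    qed simp
  qed
  also have "\<dots> = (\<integral>\<^sup>+ t. \<integral>\<^sup>+ x. indicator {0..} t * ennreal (exp (- ((1 + t) * (norm (x :: complex ^ 'n))\<^sup>2))) \<partial>lborel \<partial>lborel)"
    by (rule lborel_pair.Fubini') measurable
  also have "\<dots> \<le> (\<integral>\<^sup>+ t. ennreal ((gauss\<^sup>2) ^ CARD('n)) * (ennreal (1 / (1 + t)\<^sup>2) * indicator {0..} t) \<partial>lborel)"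
  proof (intro nn_integral_mono)
    fix t :: real
    show "(\<integral>\<^sup>+ x. indicator {0..} t * ennreal (exp (- ((1 + t) * (norm (x :: complex ^ 'n))\<^sup>2))) \<partial>lborel) \<le>
       ennreal ((gauss\<^sup>2) ^ CARD('n)) * (ennreal (1 / (1 + t)\<^sup>2) * indicator {0..} t)"
    proof (cases "t \<ge> 0")
      case True
      have "(gauss\<^sup>2) ^ CARD('n) / (1 + t) ^ CARD('n) \<le> (gauss\<^sup>2) ^ CARD('n) / (1 + t)\<^sup>2"
        using True n by (intro divide_left_mono power_increasing) auto
      then show ?thesis using True nn_integral_gauss_space[of "1 + t", where 'n = 'n]
        by (simp add: power_divide ennreal_leI flip: ennreal_mult)
    qed simp
  qed
  also have "\<dots> = ennreal ((gauss\<^sup>2) ^ CARD('n)) * ennreal (0 - (- 1))"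
  proof (subst nn_integral_cmult, measurable, subst nn_integral_FTC_atLeast[where F = "\<lambda>t. - 1 / (1 + t)" and T = 0])
    show "((\<lambda>t :: real. - 1 / (1 + t)) \<longlongrightarrow> 0) at_top"
      by (intro tendsto_divide_0[OF tendsto_const] filterlim_at_top_imp_at_infinity filterlim_tendsto_add_at_top[OF tendsto_const] filterlim_ident)
  qed (auto intro!: derivative_eq_intros simp: power2_eq_square field_simps)
  also have "\<dots> < \<infinity>" by (simp add: ennreal_mult_less_top)
  finally show "(\<integral>\<^sup>+ x. ennreal (exp (- (norm (x :: complex ^ 'n))\<^sup>2) / (norm x)\<^sup>2) \<partial>lborel) < \<infinity>" .
qed auto

section \<open>Pairing hyperplane averages\<close>

lemma (in pair_sigma_finite) integrable_product_mult:
  fixes f g :: "_ \<Rightarrow> real"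
  assumes f: "integrable M1 f" and g: "integrable M2 g"
  shows "integrable (M1 \<Otimes>\<^sub>M M2) (\<lambda>(x, y). f x * g y)"
proof (rule integrableI_bounded)
  have [measurable]: "f \<in> borel_measurable M1" "g \<in> borel_measurable M2" using f g by auto
  show "(\<lambda>(x, y). f x * g y) \<in> borel_measurable (M1 \<Otimes>\<^sub>M M2)" by measurable
  have "(\<integral>\<^sup>+ p. ennreal (norm (case p of (x, y) \<Rightarrow> f x * g y)) \<partial>(M1 \<Otimes>\<^sub>M M2)) =
      (\<integral>\<^sup>+ x. \<integral>\<^sup>+ y. ennreal (norm (f x)) * ennreal (norm (g y)) \<partial>M2 \<partial>M1)"
    by (subst M2.nn_integral_fst[symmetric]) (auto simp: abs_mult ennreal_mult)
  also have "\<dots> = (\<integral>\<^sup>+ x. ennreal (norm (f x)) \<partial>M1) * (\<integral>\<^sup>+ y. ennreal (norm (g y)) \<partial>M2)"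
    by (simp add: nn_integral_cmult nn_integral_multc)
  also have "\<dots> < \<infinity>" using f g by (simp add: integrable_iff_bounded ennreal_mult_less_top)
  finally show "(\<integral>\<^sup>+ p. ennreal (norm (case p of (x, y) \<Rightarrow> f x * g y)) \<partial>(M1 \<Otimes>\<^sub>M M2)) < \<infinity>" .
qed

lemma (in pair_sigma_finite) integral_product_mult:
  fixes f g :: "_ \<Rightarrow> real"
  assumes f: "integrable M1 f" and g: "integrable M2 g"
  shows "(\<integral>p. (case p of (x, y) \<Rightarrow> f x * g y) \<partial>(M1 \<Otimes>\<^sub>M M2)) = (\<integral>x. f x \<partial>M1) * (\<integral>y. g y \<partial>M2)"
proof -
  have "(\<integral>p. (case p of (x, y) \<Rightarrow> f x * g y) \<partial>(M1 \<Otimes>\<^sub>M M2)) = (\<integral>x. \<integral>y. f x * g y \<partial>M2 \<partial>M1)"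
    using integral_fst'[OF integrable_product_mult[OF f g]] by simp
  then show ?thesis by simp
qed

lemma integrable_gauss_space: "integrable lborel (\<lambda>x :: complex ^ 'n. exp (- (norm x)\<^sup>2))"
  using nn_integral_gauss_space[of 1, where 'n = 'n] by (intro integrableI_nonneg) auto

lemma integrable_gauss_complex: "integrable lborel (\<lambda>u. exp (- (cmod u)\<^sup>2))"
  and integral_gauss_complex: "(\<integral>u. exp (- (cmod u)\<^sup>2) \<partial>lborel) = gauss\<^sup>2"
proof -
  have "has_bochner_integral lborel (\<lambda>u. exp (- (cmod u)\<^sup>2)) (gauss\<^sup>2)"
    using nn_integral_gauss_complex[of 1] by (intro has_bochner_integral_nn_integral) auto
  then show "integrable lborel (\<lambda>u. exp (- (cmod u)\<^sup>2))" "(\<integral>u. exp (- (cmod u)\<^sup>2) \<partial>lborel) = gauss\<^sup>2"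
    by (auto simp: has_bochner_integral_iff)
qed

lemma integrable_gauss_hyperplane:
  fixes z :: "complex ^ 'n"
  assumes z: "norm z = 1"
  shows "integrable (hyperplane_measure z) (\<lambda>h. exp (- (norm h)\<^sup>2))"
    and "(\<integral>h. exp (- (norm h)\<^sup>2) \<partial>hyperplane_measure z) = (gauss\<^sup>2) ^ (CARD('n) - 1)"
proof -
  have "has_bochner_integral (hyperplane_measure z) (\<lambda>h. exp (- (norm h)\<^sup>2)) ((gauss\<^sup>2) ^ (CARD('n) - 1))"
    using nn_integral_gauss_hyperplane[OF z, of 1] by (intro has_bochner_integral_nn_integral) auto
  then show "integrable (hyperplane_measure z) (\<lambda>h. exp (- (norm h)\<^sup>2))"
    "(\<integral>h. exp (- (norm h)\<^sup>2) \<partial>hyperplane_measure z) = (gauss\<^sup>2) ^ (CARD('n) - 1)"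
    by (auto simp: has_bochner_integral_iff)
qed

lemma measurable_kernel_denominator [measurable]:
  "(\<lambda>(z, x). kernel_denominator t s z x) \<in> borel_measurable (borel \<Otimes>\<^sub>M borel)"
  unfolding kernel_denominator_def by measurable

lemma has_integral_two_kernels:
  fixes z x :: "complex ^ 'n"
  assumes z0: "z \<noteq> 0" and t: "t > 0" and s: "s > 0"
  shows "(\<integral>y. exp (- (norm y)\<^sup>2) * kern t (hprod y z) * kern s (hprod y x) \<partial>lborel) =
    (gauss\<^sup>2) ^ CARD('n) / kernel_denominator t s z x"
proof -
  have "0 \<le> kernel_denominator t s z x" using kernel_denominator_ge[of t s z x] t s by (auto intro: order_trans[rotated])
  then show ?thesis
    using nn_integral_two_kernels[OF assms, of x] t s kern_nonneg
    by (subst integral_eq_nn_integral) auto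
qed

lemma AE_fst_nonzero: "AE p in lborel \<Otimes>\<^sub>M (lborel :: 'b::euclidean_space measure). fst p \<noteq> (0 :: 'a::euclidean_space)"
proof (rule lborel_pair.AE_pair_measure)
  show "{p \<in> space (lborel \<Otimes>\<^sub>M (lborel :: 'b measure)). fst p \<noteq> (0 :: 'a)} \<in> sets (lborel \<Otimes>\<^sub>M lborel)"
    by measurable
  show "AE x in lborel. AE y in (lborel :: 'b measure). fst (x, y) \<noteq> (0 :: 'a)"
    using AE_lborel_singleton[of 0] by eventually_elim simp
qed

text \<open>
  The left-hand side is the pairing of Gaussian averages over hyperplanes, integrated over the directions; on the
  right the direction has been integrated out.
\<close>

lemma integral_kernels_swap:
  fixes \<Phi> \<psi> :: "complex ^ 'n \<Rightarrow> real"
  assumes \<Phi>: "integrable lborel \<Phi>" and \<psi>: "integrable lborel \<psi>" and t: "t > 0" and s: "s > 0"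
  shows "(\<integral>y. exp (- (norm y)\<^sup>2) * (\<integral>z. \<Phi> z * kern t (hprod y z) \<partial>lborel) * (\<integral>x. \<psi> x * kern s (hprod y x) \<partial>lborel) \<partial>lborel) =
    (gauss\<^sup>2) ^ CARD('n) * (\<integral>p. (case p of (z, x) \<Rightarrow> \<Phi> z * \<psi> x / kernel_denominator t s z x) \<partial>(lborel \<Otimes>\<^sub>M lborel))"
proof -
  have [measurable]: "\<Phi> \<in> borel_measurable borel" "\<psi> \<in> borel_measurable borel" using \<Phi> \<psi> by auto
  interpret L2: sigma_finite_measure "lborel \<Otimes>\<^sub>M lborel :: ((complex ^ 'n) \<times> (complex ^ 'n)) measure"
    by (rule sigma_finite_pair_measure) (rule sigma_finite_lborel)+
  interpret P: pair_sigma_finite "lborel :: (complex ^ 'n) measure" "lborel \<Otimes>\<^sub>M lborel :: ((complex ^ 'n) \<times> (complex ^ 'n)) measure" ..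
  let ?Q = "\<lambda>y p. case p of (z, x) \<Rightarrow> exp (- (norm y)\<^sup>2) * kern t (hprod y z) * kern s (hprod y x) * (\<Phi> z * \<psi> x)"
  have int: "integrable (lborel \<Otimes>\<^sub>M (lborel \<Otimes>\<^sub>M lborel)) (case_prod ?Q)"
  proof (rule Bochner_Integration.integrable_bound)
    show "integrable (lborel \<Otimes>\<^sub>M (lborel \<Otimes>\<^sub>M lborel)) (\<lambda>(y :: complex ^ 'n, p). exp (- (norm y)\<^sup>2) * ((1 / (t * s)) * (case p of (z, x) \<Rightarrow> \<Phi> z * \<psi> x)))"
      by (intro P.integrable_product_mult integrable_gauss_space integrable_mult_right lborel_pair.integrable_product_mult \<Phi> \<psi>)
    show "case_prod ?Q \<in> borel_measurable (lborel \<Otimes>\<^sub>M (lborel \<Otimes>\<^sub>M lborel))" by measurable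
    show "AE q in lborel \<Otimes>\<^sub>M (lborel \<Otimes>\<^sub>M lborel). norm (case_prod ?Q q) \<le>
        norm (case q of (y :: complex ^ 'n, p) \<Rightarrow> exp (- (norm y)\<^sup>2) * ((1 / (t * s)) * (case p of (z, x) \<Rightarrow> \<Phi> z * \<psi> x)))"
    proof (rule AE_I2, clarsimp simp: abs_mult)
      fix y z x :: "complex ^ 'n"
      have "kern t (hprod y z) * kern s (hprod y x) \<le> 1 / t * (1 / s)"
        using t s by (intro mult_mono kern_le kern_nonneg) auto
      then have "(kern t (hprod y z) * kern s (hprod y x)) * (exp (- (norm y)\<^sup>2) * (\<bar>\<Phi> z\<bar> * \<bar>\<psi> x\<bar>)) \<le> (1 / t * (1 / s)) * (exp (- (norm y)\<^sup>2) * (\<bar>\<Phi> z\<bar> * \<bar>\<psi> x\<bar>))"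
        by (rule mult_right_mono) simp
      then show "exp (- (norm y)\<^sup>2) * \<bar>kern t (hprod y z)\<bar> * \<bar>kern s (hprod y x)\<bar> * (\<bar>\<Phi> z\<bar> * \<bar>\<psi> x\<bar>) \<le> exp (- (norm y)\<^sup>2) * (\<bar>\<Phi> z\<bar> * \<bar>\<psi> x\<bar>) / (\<bar>t\<bar> * \<bar>s\<bar>)"
        using t s kern_nonneg by (simp add: mult_ac)
    qed
  qed
  have intk: "integrable lborel (\<lambda>z. \<Psi> z * kern r (hprod y z))" if "integrable lborel \<Psi>" "r > 0" for \<Psi> :: "complex ^ 'n \<Rightarrow> real" and r y
  proof (rule Bochner_Integration.integrable_bound[OF integrable_mult_left[OF that(1), of "1 / r"]])
    have [measurable]: "\<Psi> \<in> borel_measurable borel" using that by auto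
    show "(\<lambda>z. \<Psi> z * kern r (hprod y z)) \<in> borel_measurable lborel" by measurable
    show "AE z in lborel. norm (\<Psi> z * kern r (hprod y z)) \<le> norm (\<Psi> z * (1 / r))"
      unfolding norm_mult using kern_le[OF that(2)] kern_nonneg[OF that(2)] that(2)
      by (intro AE_I2 mult_left_mono) auto
  qed
  have "(\<integral>y. exp (- (norm y)\<^sup>2) * (\<integral>z. \<Phi> z * kern t (hprod y z) \<partial>lborel) * (\<integral>x. \<psi> x * kern s (hprod y x) \<partial>lborel) \<partial>lborel) =
      (\<integral>y. \<integral>p. ?Q y p \<partial>(lborel \<Otimes>\<^sub>M lborel) \<partial>lborel)"
  proof (rule Bochner_Integration.integral_cong[OF refl])
    fix y :: "complex ^ 'n"
    have "(\<integral>p. ?Q y p \<partial>(lborel \<Otimes>\<^sub>M lborel)) =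
      (\<integral>p. exp (- (norm y)\<^sup>2) * (case p of (z, x) \<Rightarrow> (\<Phi> z * kern t (hprod y z)) * (\<psi> x * kern s (hprod y x))) \<partial>(lborel \<Otimes>\<^sub>M lborel))"
      by (rule Bochner_Integration.integral_cong) (auto simp: mult_ac)
    also have "\<dots> = exp (- (norm y)\<^sup>2) * ((\<integral>z. \<Phi> z * kern t (hprod y z) \<partial>lborel) * (\<integral>x. \<psi> x * kern s (hprod y x) \<partial>lborel))"
      by (subst integral_mult_right_zero) (simp only: lborel_pair.integral_product_mult[OF intk[OF \<Phi> t] intk[OF \<psi> s]])
    finally show "exp (- (norm y)\<^sup>2) * (\<integral>z. \<Phi> z * kern t (hprod y z) \<partial>lborel) * (\<integral>x. \<psi> x * kern s (hprod y x) \<partial>lborel) =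
      (\<integral>p. ?Q y p \<partial>(lborel \<Otimes>\<^sub>M lborel))" by (simp only: mult.assoc)
  qed
  also have "\<dots> = (\<integral>p. \<integral>y. ?Q y p \<partial>lborel \<partial>(lborel \<Otimes>\<^sub>M lborel))"
    by (rule P.Fubini_integral[OF int, symmetric])
  also have "\<dots> = (\<integral>p. (gauss\<^sup>2) ^ CARD('n) * (case p of (z, x) \<Rightarrow> \<Phi> z * \<psi> x / kernel_denominator t s z x) \<partial>(lborel \<Otimes>\<^sub>M lborel))"
  proof (rule integral_cong_AE)
    show "(\<lambda>p. \<integral>y. ?Q y p \<partial>lborel) \<in> borel_measurable (lborel \<Otimes>\<^sub>M lborel)" by measurable
    show "(\<lambda>p. (gauss\<^sup>2) ^ CARD('n) * (case p of (z, x) \<Rightarrow> \<Phi> z * \<psi> x / kernel_denominator t s z x)) \<in> borel_measurable (lborel \<Otimes>\<^sub>M lborel)"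
      by measurable
    have "AE p in lborel \<Otimes>\<^sub>M lborel. fst p \<noteq> (0 :: complex ^ 'n)"
      by (rule AE_fst_nonzero)
    then show "AE p in lborel \<Otimes>\<^sub>M lborel. (\<integral>y. ?Q y p \<partial>lborel) = (gauss\<^sup>2) ^ CARD('n) * (case p of (z, x) \<Rightarrow> \<Phi> z * \<psi> x / kernel_denominator t s z x)"
    proof (rule AE_mp, intro AE_I2 impI)
      fix p :: "(complex ^ 'n) \<times> (complex ^ 'n)" assume "fst p \<noteq> 0"
      then obtain z x where p: "p = (z, x)" "z \<noteq> 0" by (cases p) auto
      show "(\<integral>y. ?Q y p \<partial>lborel) = (gauss\<^sup>2) ^ CARD('n) * (case p of (z, x) \<Rightarrow> \<Phi> z * \<psi> x / kernel_denominator t s z x)"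
        unfolding p(1) prod.case integral_mult_left_zero has_integral_two_kernels[OF p(2) t s] by simp
    qed
  qed
  finally show ?thesis by simp
qed

text \<open>
  As \<open>t \<rightarrow> 0\<close>; dominated by \<open>1 / (s \<bar>z\<bar>\<^sup>2)\<close>, which is
  integrable against \<open>\<Phi>\<close> since \<open>n \<ge> 2\<close>.
\<close>

lemma tendsto_integral_kernel_denominator:
  fixes \<Phi> \<psi> :: "complex ^ 'n \<Rightarrow> real"
  assumes n: "CARD('n) \<ge> 2"
    and [measurable]: "\<Phi> \<in> borel_measurable borel" and \<Phi>: "\<And>z. \<bar>\<Phi> z\<bar> \<le> C * exp (- (norm z)\<^sup>2)"
    and \<psi>: "integrable lborel \<psi>" and s: "s > 0"
    and t: "\<And>i. t i > 0" "t \<longlonglongrightarrow> 0"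
  shows "(\<lambda>i. \<integral>p. (case p of (z, x) \<Rightarrow> \<Phi> z * \<psi> x / kernel_denominator (t i) s z x) \<partial>(lborel \<Otimes>\<^sub>M lborel)) \<longlonglongrightarrow>
    (\<integral>p. (case p of (z, x) \<Rightarrow> \<Phi> z * \<psi> x / kernel_denominator 0 s z x) \<partial>(lborel \<Otimes>\<^sub>M lborel))"
    and "integrable (lborel \<Otimes>\<^sub>M lborel) (\<lambda>(z, x). \<Phi> z * \<psi> x / kernel_denominator 0 s z x)"
proof -
  have [measurable]: "\<psi> \<in> borel_measurable borel" using \<psi> by auto
  let ?w = "\<lambda>(z :: complex ^ 'n, x). (C * (exp (- (norm z)\<^sup>2) / (norm z)\<^sup>2)) * ((1 / s) * norm (\<psi> x))"
  have w: "integrable (lborel \<Otimes>\<^sub>M lborel) ?w"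
    by (intro lborel_pair.integrable_product_mult integrable_mult_right integrable_gauss_inverse_square[OF n] integrable_norm \<psi>)
  have AE: "AE p in lborel \<Otimes>\<^sub>M lborel. fst p \<noteq> (0 :: complex ^ 'n)"
    by (rule AE_fst_nonzero)
  have m: "(\<lambda>(z, x). \<Phi> z * \<psi> x / kernel_denominator r s z x) \<in> borel_measurable (lborel \<Otimes>\<^sub>M lborel)" for r
    by measurable
  have bound: "AE p in lborel \<Otimes>\<^sub>M lborel. norm (case p of (z, x) \<Rightarrow> \<Phi> z * \<psi> x / kernel_denominator r s z x) \<le> ?w p" if r: "r \<ge> 0" for r
    using AE
  proof (rule AE_mp, intro AE_I2 impI)
    fix p :: "(complex ^ 'n) \<times> (complex ^ 'n)" assume "fst p \<noteq> 0"
    then obtain z x where p: "p = (z, x)" "z \<noteq> 0" by (cases p) auto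
    have d: "s * (norm z)\<^sup>2 \<le> kernel_denominator r s z x" using s r by (intro kernel_denominator_ge) auto
    have pos: "0 < s * (norm z)\<^sup>2" using s p by simp
    have C: "0 \<le> C * exp (- (norm z)\<^sup>2)" using \<Phi>[of z] by linarith
    have "\<bar>\<Phi> z\<bar> * \<bar>\<psi> x\<bar> / kernel_denominator r s z x \<le> (C * exp (- (norm z)\<^sup>2)) * \<bar>\<psi> x\<bar> / (s * (norm z)\<^sup>2)"
      by (intro frac_le mult_right_mono \<Phi> mult_nonneg_nonneg[OF C] d pos) auto
    then show "norm (case p of (z, x) \<Rightarrow> \<Phi> z * \<psi> x / kernel_denominator r s z x) \<le> ?w p"
      unfolding p using d pos by (simp add: abs_mult mult_ac)
  qed
  have lim: "AE p in lborel \<Otimes>\<^sub>M lborel. (\<lambda>i. case p of (z, x) \<Rightarrow> \<Phi> z * \<psi> x / kernel_denominator (t i) s z x) \<longlonglongrightarrow>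
      (case p of (z, x) \<Rightarrow> \<Phi> z * \<psi> x / kernel_denominator 0 s z x)"
    using AE
  proof (rule AE_mp, intro AE_I2 impI)
    fix p :: "(complex ^ 'n) \<times> (complex ^ 'n)" assume "fst p \<noteq> 0"
    then obtain z x where p: "p = (z, x)" "z \<noteq> 0" by (cases p) auto
    have "0 < s * (norm z)\<^sup>2" using s p by simp
    also have "\<dots> \<le> kernel_denominator 0 s z x" using s by (intro kernel_denominator_ge) auto
    finally have "kernel_denominator 0 s z x > 0" .
    moreover have "(\<lambda>i. kernel_denominator (t i) s z x) \<longlonglongrightarrow> kernel_denominator 0 s z x"
      unfolding kernel_denominator_def by (intro tendsto_diff tendsto_mult tendsto_add tendsto_const t(2))
    ultimately show "(\<lambda>i. case p of (z, x) \<Rightarrow> \<Phi> z * \<psi> x / kernel_denominator (t i) s z x) \<longlonglongrightarrow>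
      (case p of (z, x) \<Rightarrow> \<Phi> z * \<psi> x / kernel_denominator 0 s z x)"
      unfolding p prod.case by (intro tendsto_divide tendsto_const) auto
  qed
  show "(\<lambda>i. \<integral>p. (case p of (z, x) \<Rightarrow> \<Phi> z * \<psi> x / kernel_denominator (t i) s z x) \<partial>(lborel \<Otimes>\<^sub>M lborel)) \<longlonglongrightarrow>
    (\<integral>p. (case p of (z, x) \<Rightarrow> \<Phi> z * \<psi> x / kernel_denominator 0 s z x) \<partial>(lborel \<Otimes>\<^sub>M lborel))"
    by (rule integral_dominated_convergence[OF m m w lim bound]) (use t in \<open>auto intro: less_imp_le\<close>)
  show "integrable (lborel \<Otimes>\<^sub>M lborel) (\<lambda>(z, x). \<Phi> z * \<psi> x / kernel_denominator 0 s z x)"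
    by (rule integrable_dominated_convergence[OF m m w lim bound]) (use t in \<open>auto intro: less_imp_le\<close>)
qed

lemma integral_split:
  fixes F :: "complex ^ 'n \<Rightarrow> real"
  assumes z: "norm z = 1" and c: "c > 0" and [measurable]: "F \<in> borel_measurable borel"
    and G [measurable]: "(\<lambda>(h, u). G h u) \<in> borel_measurable (hyperplane_measure z \<Otimes>\<^sub>M lborel)"
    and eq: "\<And>h u. hprod h z = 0 \<Longrightarrow> F (h + (of_real c * u) *s z) = G h u"
  shows "(\<integral>x. F x \<partial>lborel) = c\<^sup>2 * (\<integral>p. (case p of (h, u) \<Rightarrow> G h u) \<partial>(hyperplane_measure z \<Otimes>\<^sub>M lborel))"
    and "integrable lborel F \<longleftrightarrow> integrable (hyperplane_measure z \<Otimes>\<^sub>M lborel) (\<lambda>(h, u). G h u)"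
proof -
  obtain B where B: "orthonormal_basis_of (complex_hyperplane z) B" "hyperplane_measure z = basis_measure B"
    using subspace_lborel_basis[OF subspace_complex_hyperplane] by metis
  let ?P = "hyperplane_measure z \<Otimes>\<^sub>M (lborel :: complex measure)"
  interpret sigma_finite_measure "hyperplane_measure z" by (rule sigma_finite_hyperplane_measure)
  interpret P: pair_sigma_finite "hyperplane_measure z" "lborel :: complex measure" ..
  let ?T = "\<lambda>(h, u). h + (of_real c * u) *s z"
  have T [measurable]: "?T \<in> measurable ?P borel" by measurable
  note split = lborel_split[OF z B(1) c, folded B(2)]
  have AE: "AE p in ?P. F (?T p) = (case p of (h, u) \<Rightarrow> G h u)"
  proof (rule P.AE_pair_measure)
    show "{p \<in> space ?P. F (?T p) = (case p of (h, u) \<Rightarrow> G h u)} \<in> sets ?P" by measurable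
    show "AE h in hyperplane_measure z. AE u in lborel. F (?T (h, u)) = (case (h, u) of (h, u) \<Rightarrow> G h u)"
      using AE_hyperplane_measure[of z] by eventually_elim (simp add: eq)
  qed
  have "(\<integral>x. F x \<partial>lborel) = (\<integral>x. F x \<partial>density (distr ?P borel ?T) (\<lambda>_. ennreal (c\<^sup>2)))"
    using split by metis
  also have "\<dots> = c\<^sup>2 * (\<integral>p. F (?T p) \<partial>?P)"
    by (subst integral_density) (auto simp: integral_distr)
  also have "(\<integral>p. F (?T p) \<partial>?P) = (\<integral>p. (case p of (h, u) \<Rightarrow> G h u) \<partial>?P)"
    by (rule integral_cong_AE[OF _ G AE]) measurable
  finally show "(\<integral>x. F x \<partial>lborel) = c\<^sup>2 * (\<integral>p. (case p of (h, u) \<Rightarrow> G h u) \<partial>?P)" .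
  have "integrable lborel F \<longleftrightarrow> integrable (density (distr ?P borel ?T) (\<lambda>_. ennreal (c\<^sup>2))) F"
    using split by metis
  also have "\<dots> \<longleftrightarrow> integrable ?P (\<lambda>p. F (?T p))"
    using c by (subst integrable_density) (auto simp: integrable_distr_eq)
  also have "\<dots> \<longleftrightarrow> integrable ?P (\<lambda>(h, u). G h u)"
    by (rule integrable_cong_AE[OF _ G AE]) measurable
  finally show "integrable lborel F \<longleftrightarrow> integrable ?P (\<lambda>(h, u). G h u)" .
qed

text \<open>
  The substitution \<open>x = h + (\<surd>r / \<bar>y\<bar>) u y / \<bar>y\<bar>\<close> exhibits the Gaussian
  average as a mean of the integrals over translates of \<open>H\<^sub>y\<close>.
\<close>

lemma nn_integral_kern_split:
  fixes F :: "complex ^ 'n \<Rightarrow> ennreal" and y :: "complex ^ 'n"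
  assumes [measurable]: "F \<in> borel_measurable borel" and y: "y \<noteq> 0" and r: "r > 0"
  defines "\<zeta> \<equiv> (1 / norm y) *\<^sub>R y"
  shows "(\<integral>\<^sup>+ x. F x * ennreal (kern r (hprod y x)) \<partial>lborel) =
    ennreal (1 / (norm y)\<^sup>2) * (\<integral>\<^sup>+ u. ennreal (exp (- (cmod u)\<^sup>2)) *
      (\<integral>\<^sup>+ h. F (h + (of_real (sqrt r / norm y) * u) *s \<zeta>) \<partial>hyperplane_measure \<zeta>) \<partial>lborel)"
proof -
  have \<zeta>: "norm \<zeta> = 1" and y_eq: "y = norm y *\<^sub>R \<zeta>" using y by (simp_all add: \<zeta>_def)
  interpret sigma_finite_measure "hyperplane_measure \<zeta>" by (rule sigma_finite_hyperplane_measure)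
  define c where "c = sqrt r / norm y"
  have c: "c > 0" "c\<^sup>2 / r = 1 / (norm y)\<^sup>2" using y r by (auto simp: c_def power_divide)
  have "(\<integral>\<^sup>+ x. F x * ennreal (kern r (hprod y x)) \<partial>lborel) =
      (\<integral>\<^sup>+ u. \<integral>\<^sup>+ h. F (h + u *s \<zeta>) * ennreal (kern r (of_real (norm y) * u)) \<partial>hyperplane_measure \<zeta> \<partial>lborel)"
  proof (rule nn_integral_hyperplane_split(1)[OF \<zeta>])
    fix h u assume h: "hprod h \<zeta> = 0"
    have "cmod (hprod y (h + u *s \<zeta>)) = norm y * cmod (hprod (h + u *s \<zeta>) \<zeta>)"
      by (subst y_eq) (simp add: hprod_scaleR_left norm_mult norm_hprod_commute[of \<zeta>])
    then have "cmod (hprod y (h + u *s \<zeta>)) = cmod (of_real (norm y) * u)"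
      using h \<zeta> by (simp add: hprod_add_left hprod_scale_left hprod_self norm_mult)
    then show "F (h + u *s \<zeta>) * ennreal (kern r (hprod y (h + u *s \<zeta>))) = F (h + u *s \<zeta>) * ennreal (kern r (of_real (norm y) * u))"
      by (simp add: kern_def)
  qed measurable
  also have "\<dots> = ennreal (c\<^sup>2) * (\<integral>\<^sup>+ u. \<integral>\<^sup>+ h. F (h + (of_real c * u) *s \<zeta>) * ennreal (kern r (of_real (norm y) * (of_real c * u))) \<partial>hyperplane_measure \<zeta> \<partial>lborel)"
    by (rule nn_integral_complex_scale[OF c(1)]) measurable
  also have "\<dots> = ennreal (c\<^sup>2) * (\<integral>\<^sup>+ u. ennreal (1 / r) * (ennreal (exp (- (cmod u)\<^sup>2)) * (\<integral>\<^sup>+ h. F (h + (of_real c * u) *s \<zeta>) \<partial>hyperplane_measure \<zeta>)) \<partial>lborel)"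
  proof -
    have k: "ennreal (kern r (of_real (norm y) * (of_real c * u))) = ennreal (1 / r) * ennreal (exp (- (cmod u)\<^sup>2))" for u
    proof -
      have "(cmod (of_real (norm y) * (of_real c * u)))\<^sup>2 / r = (cmod u)\<^sup>2"
        using y r c by (simp add: norm_mult power_mult_distrib c_def power_divide)
      then show ?thesis using r by (simp add: kern_def flip: ennreal_mult)
    qed
    show ?thesis unfolding k by (intro arg_cong2[where f = "(*)"] refl nn_integral_cong, subst nn_integral_multc) (auto simp: mult_ac)
  qed
  also have "\<dots> = (ennreal (c\<^sup>2) * ennreal (1 / r)) * (\<integral>\<^sup>+ u. ennreal (exp (- (cmod u)\<^sup>2)) * (\<integral>\<^sup>+ h. F (h + (of_real c * u) *s \<zeta>) \<partial>hyperplane_measure \<zeta>) \<partial>lborel)"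
    by (subst nn_integral_cmult) (auto simp: mult.assoc)
  also have "ennreal (c\<^sup>2) * ennreal (1 / r) = ennreal (1 / (norm y)\<^sup>2)" using c r by (simp flip: ennreal_mult)
  finally show ?thesis by (simp only: c_def)
qed

lemma integrable_mult_kern:
  fixes \<psi> :: "complex ^ 'n \<Rightarrow> real"
  assumes "integrable lborel \<psi>" "r > 0"
  shows "integrable lborel (\<lambda>x. \<psi> x * kern r (hprod y x))"
proof (rule Bochner_Integration.integrable_bound[OF integrable_mult_left[OF assms(1), of "1 / r"]])
  have [measurable]: "\<psi> \<in> borel_measurable borel" using assms by auto
  show "(\<lambda>x. \<psi> x * kern r (hprod y x)) \<in> borel_measurable lborel" by measurable
  show "AE x in lborel. norm (\<psi> x * kern r (hprod y x)) \<le> norm (\<psi> x * (1 / r))"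
    unfolding norm_mult using kern_le[OF assms(2)] kern_nonneg[OF assms(2)] assms(2)
    by (intro AE_I2 mult_left_mono) auto
qed

lemma abs_integral_kern_le:
  fixes \<psi> :: "complex ^ 'n \<Rightarrow> real"
  assumes \<psi>: "integrable lborel \<psi>" and r: "r > 0"
  shows "\<bar>\<integral>x. \<psi> x * kern r (hprod y x) \<partial>lborel\<bar> \<le> (\<integral>x. \<bar>\<psi> x\<bar> \<partial>lborel) / r"
proof -
  have "\<bar>\<integral>x. \<psi> x * kern r (hprod y x) \<partial>lborel\<bar> \<le> (\<integral>x. \<bar>\<psi> x * kern r (hprod y x)\<bar> \<partial>lborel)"
    by (rule integral_abs_bound)
  also have "\<dots> \<le> (\<integral>x. \<bar>\<psi> x\<bar> * (1 / r) \<partial>lborel)"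
  proof (intro integral_mono integrable_abs integrable_mult_kern[OF \<psi> r] integrable_mult_left \<psi>)
    fix x
    show "\<bar>\<psi> x * kern r (hprod y x)\<bar> \<le> \<bar>\<psi> x\<bar> * (1 / r)"
      unfolding abs_mult using kern_le[OF r] kern_nonneg[OF r] by (intro mult_left_mono) auto
  qed
  finally show ?thesis by simp
qed

text \<open>
  Replacing \<open>s\<close> by \<open>4 s\<close> doubles the displacement of each translate of
  \<open>H\<^sub>y\<close>, so the claim holds translate by translate.
\<close>

lemma integral_kern_antimono:
  fixes \<psi> :: "complex ^ 'n \<Rightarrow> real" and y :: "complex ^ 'n"
  assumes \<psi>: "integrable lborel \<psi>" and nonneg: "\<And>x. 0 \<le> \<psi> x" and even: "\<And>x. \<psi> (- x) = \<psi> x"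
    and mid: "\<And>x y. \<psi> x * \<psi> y \<le> (\<psi> ((1/2) *\<^sub>R (x + y)))\<^sup>2"
    and y: "y \<noteq> 0" and s: "s > 0"
  shows "(\<integral>x. \<psi> x * kern (4 * s) (hprod y x) \<partial>lborel) \<le> (\<integral>x. \<psi> x * kern s (hprod y x) \<partial>lborel)"
proof -
  have [measurable]: "\<psi> \<in> borel_measurable borel" using \<psi> by auto
  define \<zeta> where "\<zeta> = (1 / norm y) *\<^sub>R y"
  obtain B where B: "orthonormal_basis_of (complex_hyperplane \<zeta>) B" "hyperplane_measure \<zeta> = basis_measure B"
    using subspace_lborel_basis[OF subspace_complex_hyperplane] by metis
  let ?F = "\<lambda>x. ennreal (\<psi> x)"
  have eq: "(\<integral>\<^sup>+ x. ennreal (\<psi> x * kern r (hprod y x)) \<partial>lborel) = ennreal (1 / (norm y)\<^sup>2) * (\<integral>\<^sup>+ u. ennreal (exp (- (cmod u)\<^sup>2)) *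
      (\<integral>\<^sup>+ h. ?F (h + (of_real (sqrt r / norm y) * u) *s \<zeta>) \<partial>hyperplane_measure \<zeta>) \<partial>lborel)" if "r > 0" for r
    using nn_integral_kern_split[of ?F y r] y that nonneg by (simp add: ennreal_mult' \<zeta>_def)
  have "(\<integral>\<^sup>+ x. ennreal (\<psi> x * kern (4 * s) (hprod y x)) \<partial>lborel) \<le> (\<integral>\<^sup>+ x. ennreal (\<psi> x * kern s (hprod y x)) \<partial>lborel)"
    unfolding eq[OF s] eq[OF mult_pos_pos[OF zero_less_numeral s]]
  proof (rule mult_left_mono[OF nn_integral_mono[OF mult_left_mono]])
    fix u :: complex
    define v where "v = (of_real (sqrt s / norm y) * u) *s \<zeta>"
    have "(of_real (sqrt (4 * s) / norm y) * u) *s \<zeta> = 2 *\<^sub>R v"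
      by (simp add: v_def real_sqrt_mult vec_eq_iff scaleR_conv_of_real[where 'a = complex] mult_ac)
    moreover have "(\<integral>\<^sup>+ h. ?F (h + 2 *\<^sub>R v) \<partial>hyperplane_measure \<zeta>) \<le> (\<integral>\<^sup>+ h. ?F (h + v) \<partial>hyperplane_measure \<zeta>)"
      unfolding B(2)
    proof (rule parallel_section_integral_mono[OF B(1)])
      show "?F x * ?F y \<le> (?F ((1/2) *\<^sub>R (x + y)))\<^sup>2" for x y
        using mid[of x y] nonneg by (simp add: ennreal_power ennreal_leI flip: ennreal_mult)
    qed (auto simp: even)
    ultimately show "(\<integral>\<^sup>+ h. ?F (h + (of_real (sqrt (4 * s) / norm y) * u) *s \<zeta>) \<partial>hyperplane_measure \<zeta>) \<le>
      (\<integral>\<^sup>+ h. ?F (h + (of_real (sqrt s / norm y) * u) *s \<zeta>) \<partial>hyperplane_measure \<zeta>)"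
      by (simp add: v_def)
  qed auto
  moreover have "(\<integral>\<^sup>+ x. ennreal (\<psi> x * kern r (hprod y x)) \<partial>lborel) = ennreal (\<integral>x. \<psi> x * kern r (hprod y x) \<partial>lborel)" if "r > 0" for r
    using nonneg kern_nonneg[OF that] by (intro nn_integral_eq_integral integrable_mult_kern \<psi> that) auto
  moreover have "0 \<le> (\<integral>x. \<psi> x * kern s (hprod y x) \<partial>lborel)"
    using nonneg kern_nonneg[OF s] by (intro Bochner_Integration.integral_nonneg) auto
  ultimately show ?thesis using s by (simp add: ennreal_le_iff)
qed

lemma integral_kern_section:
  fixes \<Phi> :: "complex ^ 'n \<Rightarrow> real" and y :: "complex ^ 'n"
  assumes [measurable]: "\<Phi> \<in> borel_measurable borel" and y: "y \<noteq> 0" and t: "t > 0"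
  defines "\<zeta> \<equiv> (1 / norm y) *\<^sub>R y"
  shows "(\<integral>z. \<Phi> z * kern t (hprod y z) \<partial>lborel) = (1 / (norm y)\<^sup>2) *
    (\<integral>p. (case p of (h, u) \<Rightarrow> \<Phi> (h + (of_real (sqrt t / norm y) * u) *s \<zeta>) * exp (- (cmod u)\<^sup>2)) \<partial>(hyperplane_measure \<zeta> \<Otimes>\<^sub>M lborel))"
proof -
  have \<zeta>: "norm \<zeta> = 1" and y_eq: "y = norm y *\<^sub>R \<zeta>" using y by (simp_all add: \<zeta>_def)
  define c where "c = sqrt t / norm y"
  have c: "c > 0" "c\<^sup>2 * (1 / t) = 1 / (norm y)\<^sup>2" using y t by (auto simp: c_def power_divide)
  let ?G = "\<lambda>h u. (1 / t) * (\<Phi> (h + (of_real c * u) *s \<zeta>) * exp (- (cmod u)\<^sup>2))"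
  have "(\<integral>z. \<Phi> z * kern t (hprod y z) \<partial>lborel) = c\<^sup>2 * (\<integral>p. (case p of (h, u) \<Rightarrow> ?G h u) \<partial>(hyperplane_measure \<zeta> \<Otimes>\<^sub>M lborel))"
  proof (rule integral_split(1)[OF \<zeta> c(1)])
    fix h u assume h: "hprod h \<zeta> = 0"
    have "cmod (hprod y (h + (of_real c * u) *s \<zeta>)) = norm y * cmod (hprod (h + (of_real c * u) *s \<zeta>) \<zeta>)"
      by (subst y_eq) (simp add: hprod_scaleR_left norm_mult norm_hprod_commute[of \<zeta>])
    then have "cmod (hprod y (h + (of_real c * u) *s \<zeta>)) = norm y * (c * cmod u)"
      using h \<zeta> c(1) by (simp add: hprod_add_left hprod_scale_left hprod_self norm_mult)
    then have "(cmod (hprod y (h + (of_real c * u) *s \<zeta>)))\<^sup>2 / t = (cmod u)\<^sup>2"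
      using y t by (simp add: c_def power_mult_distrib power_divide)
    then show "\<Phi> (h + (of_real c * u) *s \<zeta>) * kern t (hprod y (h + (of_real c * u) *s \<zeta>)) = ?G h u"
      by (simp add: kern_def)
  qed measurable
  also have "\<dots> = (c\<^sup>2 * (1 / t)) * (\<integral>p. (case p of (h, u) \<Rightarrow> \<Phi> (h + (of_real c * u) *s \<zeta>) * exp (- (cmod u)\<^sup>2)) \<partial>(hyperplane_measure \<zeta> \<Otimes>\<^sub>M lborel))"
    by (simp only: mult.assoc split_beta' integral_mult_right_zero)
  finally show ?thesis by (simp only: c(2)) (simp only: c_def)
qed

text \<open>
  As \<open>t \<rightarrow> 0\<close> the Gaussian average of \<open>\<Phi>\<close> becomes the integral over the
  section. \<open>\<Phi>\<close> will be discontinuous on the boundaries of two bodies, so continuity is required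
  only at almost every point of the hyperplane. The uniform bound in the first statement dominates the later limit
  under the integral over directions.
\<close>

lemma section_limit:
  fixes \<Phi> :: "complex ^ 'n \<Rightarrow> real" and y :: "complex ^ 'n"
  assumes [measurable]: "\<Phi> \<in> borel_measurable borel" and \<Phi>: "\<And>z. \<bar>\<Phi> z\<bar> \<le> C * exp (- (norm z)\<^sup>2)"
    and y: "y \<noteq> 0"
  defines "\<zeta> \<equiv> (1 / norm y) *\<^sub>R y"
  assumes cont: "AE h in hyperplane_measure \<zeta>. isCont \<Phi> h"
  shows "\<And>t. t > 0 \<Longrightarrow> \<bar>\<integral>z. \<Phi> z * kern t (hprod y z) \<partial>lborel\<bar> \<le> C * (gauss\<^sup>2) ^ CARD('n) / (norm y)\<^sup>2"
    and "\<And>t. (\<And>i. t i > 0) \<Longrightarrow> t \<longlonglongrightarrow> 0 \<Longrightarrow>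
      (\<lambda>i. \<integral>z. \<Phi> z * kern (t i) (hprod y z) \<partial>lborel) \<longlonglongrightarrow> gauss\<^sup>2 / (norm y)\<^sup>2 * (\<integral>h. \<Phi> h \<partial>hyperplane_measure \<zeta>)"
proof -
  have \<zeta>: "norm \<zeta> = 1" using y by (simp add: \<zeta>_def)
  have C: "C \<ge> 0" using \<Phi>[of 0] by simp
  let ?P = "hyperplane_measure \<zeta> \<Otimes>\<^sub>M (lborel :: complex measure)"
  interpret sigma_finite_measure "hyperplane_measure \<zeta>" by (rule sigma_finite_hyperplane_measure)
  interpret P: pair_sigma_finite "hyperplane_measure \<zeta>" "lborel :: complex measure" ..
  let ?G = "\<lambda>t p. case p of (h, u) \<Rightarrow> \<Phi> (h + (of_real (sqrt t / norm y) * u) *s \<zeta>) * exp (- (cmod u)\<^sup>2)"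
  let ?w = "\<lambda>(h :: complex ^ 'n, u). (C * exp (- (norm h)\<^sup>2)) * exp (- (cmod u)\<^sup>2)"
  have w: "integrable ?P ?w"
    by (intro P.integrable_product_mult integrable_mult_right integrable_gauss_hyperplane \<zeta> integrable_gauss_complex)
  have w_int: "(\<integral>p. ?w p \<partial>?P) = C * (gauss\<^sup>2) ^ CARD('n)"
  proof -
    have "(\<integral>p. ?w p \<partial>?P) = C * ((gauss\<^sup>2) ^ (CARD('n) - 1) * gauss\<^sup>2)"
      using P.integral_product_mult[OF integrable_mult_right[OF integrable_gauss_hyperplane(1)[OF \<zeta>]] integrable_gauss_complex, of C]
      by (simp add: integrable_gauss_hyperplane(2)[OF \<zeta>] integral_gauss_complex)
    then show ?thesis by (simp only: power_minus_mult[OF zero_less_card_finite])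
  qed
  have m: "?G t \<in> borel_measurable ?P" for t by measurable
  have AEh: "AE p in ?P. hprod (fst p) \<zeta> = 0"
  proof (rule P.AE_pair_measure)
    show "{p \<in> space ?P. hprod (fst p) \<zeta> = 0} \<in> sets ?P" by measurable
  qed (use AE_hyperplane_measure[of \<zeta>] in auto)
  have bound: "AE p in ?P. norm (?G t p) \<le> ?w p" for t
    using AEh
  proof (rule AE_mp, intro AE_I2 impI)
    fix p :: "(complex ^ 'n) \<times> complex" assume "hprod (fst p) \<zeta> = 0"
    then obtain h u where p: "p = (h, u)" "hprod h \<zeta> = 0" by (cases p) auto
    have "\<bar>\<Phi> (h + (of_real (sqrt t / norm y) * u) *s \<zeta>)\<bar> \<le> C * exp (- (norm h)\<^sup>2)"
      using norm_add_smult[OF \<zeta> p(2)] C by (intro order_trans[OF \<Phi>] mult_left_mono) auto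
    then show "norm (?G t p) \<le> ?w p" unfolding p by (simp add: abs_mult mult_right_mono)
  qed
  have eq: "(\<integral>z. \<Phi> z * kern t (hprod y z) \<partial>lborel) = (1 / (norm y)\<^sup>2) * (\<integral>p. ?G t p \<partial>?P)" if "t > 0" for t
    using integral_kern_section[of \<Phi> y t] y that by (simp add: \<zeta>_def)
  show "\<bar>\<integral>z. \<Phi> z * kern t (hprod y z) \<partial>lborel\<bar> \<le> C * (gauss\<^sup>2) ^ CARD('n) / (norm y)\<^sup>2" if "t > 0" for t
  proof -
    have "\<bar>\<integral>p. ?G t p \<partial>?P\<bar> \<le> (\<integral>p. ?w p \<partial>?P)"
      using bound[of t] w
      by (intro order_trans[OF integral_abs_bound] integral_mono_AE integrable_abs Bochner_Integration.integrable_bound[OF w m]) auto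
    then show ?thesis unfolding eq[OF that] w_int by (simp add: abs_mult divide_right_mono)
  qed
  show "(\<lambda>i. \<integral>z. \<Phi> z * kern (t i) (hprod y z) \<partial>lborel) \<longlonglongrightarrow> gauss\<^sup>2 / (norm y)\<^sup>2 * (\<integral>h. \<Phi> h \<partial>hyperplane_measure \<zeta>)"
    if t: "\<And>i. t i > 0" "t \<longlonglongrightarrow> 0" for t
  proof -
    have \<Phi>int: "integrable (hyperplane_measure \<zeta>) \<Phi>"
      using C \<Phi> by (intro Bochner_Integration.integrable_bound[OF integrable_mult_right[OF integrable_gauss_hyperplane(1)[OF \<zeta>], of C]]) auto
    have "(\<lambda>i. \<integral>p. ?G (t i) p \<partial>?P) \<longlonglongrightarrow> (\<integral>p. (case p of (h, u) \<Rightarrow> \<Phi> h * exp (- (cmod u)\<^sup>2)) \<partial>?P)"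
    proof (rule integral_dominated_convergence[OF _ m w _ bound])
      show "(\<lambda>(h, u). \<Phi> h * exp (- (cmod u)\<^sup>2)) \<in> borel_measurable ?P" by measurable
      obtain N where N: "{h \<in> space (hyperplane_measure \<zeta>). \<not> isCont \<Phi> h} \<subseteq> N" "N \<in> null_sets (hyperplane_measure \<zeta>)"
        using cont by (auto elim!: AE_E simp: null_sets_def)
      have "AE p in ?P. fst p \<notin> N"
      proof (rule P.AE_pair_measure)
        have [measurable]: "N \<in> sets borel" using N(2) by (auto simp: null_sets_def)
        show "{p \<in> space ?P. fst p \<notin> N} \<in> sets ?P" by measurable
      qed (use AE_not_in[OF N(2)] in auto)
      then show "AE p in ?P. (\<lambda>i. ?G (t i) p) \<longlonglongrightarrow> (case p of (h, u) \<Rightarrow> \<Phi> h * exp (- (cmod u)\<^sup>2))"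
      proof (rule AE_mp, intro AE_I2 impI)
        fix p :: "(complex ^ 'n) \<times> complex" assume "fst p \<notin> N"
        then obtain h u where p: "p = (h, u)" "isCont \<Phi> h" using N(1) by (cases p) auto
        have "(\<lambda>i. h + (of_real (sqrt (t i) / norm y) * u) *s \<zeta>) \<longlonglongrightarrow> h + (of_real (sqrt 0 / norm y) * u) *s \<zeta>"
          unfolding Re_Im_smult[of "_ * u"] using y
          by (intro tendsto_intros t(2)) auto
        then have "(\<lambda>i. \<Phi> (h + (of_real (sqrt (t i) / norm y) * u) *s \<zeta>)) \<longlonglongrightarrow> \<Phi> h"
          by (intro isCont_tendsto_compose[OF p(2)]) simp
        then show "(\<lambda>i. ?G (t i) p) \<longlonglongrightarrow> (case p of (h, u) \<Rightarrow> \<Phi> h * exp (- (cmod u)\<^sup>2))"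
          unfolding p prod.case by (intro tendsto_mult tendsto_const)
      qed
    qed
    also have "(\<integral>p. (case p of (h, u) \<Rightarrow> \<Phi> h * exp (- (cmod u)\<^sup>2)) \<partial>?P) = (\<integral>h. \<Phi> h \<partial>hyperplane_measure \<zeta>) * gauss\<^sup>2"
      using P.integral_product_mult[OF \<Phi>int integrable_gauss_complex] by (simp add: integral_gauss_complex)
    finally have "(\<lambda>i. (1 / (norm y)\<^sup>2) * (\<integral>p. ?G (t i) p \<partial>?P)) \<longlonglongrightarrow> (1 / (norm y)\<^sup>2) * ((\<integral>h. \<Phi> h \<partial>hyperplane_measure \<zeta>) * gauss\<^sup>2)"
      by (intro tendsto_mult tendsto_const)
    then show ?thesis using eq[OF t(1)] by (simp add: mult.commute)
  qed
qed

text \<open>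
  Let \<open>g\<^sub>i(y)\<close> be the Gaussian averages of \<open>\<Phi>\<close> around
  \<open>H\<^sub>y\<close> and \<open>a\<^sub>s(y)\<close> those of \<open>\<psi>\<close>. In the limit
  \<open>g\<^sub>i\<close> is a nonnegative section integral, and \<open>a\<^sub>s - a\<^sub>4\<^sub>s \<ge>
  0\<close>, so the integral of their product over the directions is nonnegative up to an error from the negative
  part of \<open>g\<^sub>i\<close>. Only this negative part is subjected to dominated convergence, so a limit of
  the whole product is never needed.
\<close>

lemma kernel_difference_nonneg:
  fixes \<Phi> \<psi> :: "complex ^ 'n \<Rightarrow> real"
  assumes n: "CARD('n) \<ge> 2"
    and \<Phi>m [measurable]: "\<Phi> \<in> borel_measurable borel" and \<Phi>: "\<And>z. \<bar>\<Phi> z\<bar> \<le> C * exp (- (norm z)\<^sup>2)"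
    and cont: "\<And>\<zeta>. norm \<zeta> = 1 \<Longrightarrow> AE h in hyperplane_measure \<zeta>. isCont \<Phi> h"
    and sections: "\<And>\<zeta>. norm \<zeta> = 1 \<Longrightarrow> 0 \<le> (\<integral>h. \<Phi> h \<partial>hyperplane_measure \<zeta>)"
    and \<psi>: "integrable lborel \<psi>" and nonneg: "\<And>x. 0 \<le> \<psi> x" and even: "\<And>x. \<psi> (- x) = \<psi> x"
    and mid: "\<And>x y. \<psi> x * \<psi> y \<le> (\<psi> ((1/2) *\<^sub>R (x + y)))\<^sup>2"
    and s: "s > 0"
  shows "(\<integral>p. (case p of (z, x) \<Rightarrow> \<Phi> z * \<psi> x / kernel_denominator 0 (4 * s) z x) \<partial>(lborel \<Otimes>\<^sub>M lborel)) \<le>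
    (\<integral>p. (case p of (z, x) \<Rightarrow> \<Phi> z * \<psi> x / kernel_denominator 0 s z x) \<partial>(lborel \<Otimes>\<^sub>M lborel))"
proof -
  have [measurable]: "\<psi> \<in> borel_measurable borel" using \<psi> by auto
  have C: "C \<ge> 0" using \<Phi>[of 0] by simp
  have s4: "4 * s > 0" using s by simp
  define t where "t i = 1 / real (Suc i)" for i
  have t: "\<And>i. t i > 0" "t \<longlonglongrightarrow> 0"
    unfolding t_def using LIMSEQ_inverse_real_of_nat by (auto simp: inverse_eq_divide)
  have \<Phi>int: "integrable lborel \<Phi>"
    using C \<Phi> by (intro Bochner_Integration.integrable_bound[OF integrable_mult_right[OF integrable_gauss_space, of C]]) auto
  define R where "R i r = (\<integral>p. (case p of (z, x) \<Rightarrow> \<Phi> z * \<psi> x / kernel_denominator (t i) r z x) \<partial>(lborel \<Otimes>\<^sub>M lborel))" for i r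
  define g where "g i y = (\<integral>z. \<Phi> z * kern (t i) (hprod y z) \<partial>lborel)" for i y
  define a where "a r y = (\<integral>x. \<psi> x * kern r (hprod y x) \<partial>lborel)" for r y
  have [measurable]: "g i \<in> borel_measurable borel" for i
    unfolding g_def measurable_lborel1[symmetric] by measurable
  have [measurable]: "a r \<in> borel_measurable borel" for r
    unfolding a_def measurable_lborel1[symmetric] by measurable
  have e: "integrable lborel (\<lambda>y :: complex ^ 'n. exp (- (norm y)\<^sup>2))" by (rule integrable_gauss_space)
  define A where "A = (\<integral>x. \<bar>\<psi> x\<bar> \<partial>lborel)"
  have A: "A \<ge> 0" unfolding A_def by (rule Bochner_Integration.integral_nonneg) simp
  have a_le: "\<bar>a r y\<bar> \<le> A / r" if "r > 0" for r y unfolding a_def A_def by (rule abs_integral_kern_le[OF \<psi> that])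
  have int_ega: "integrable lborel (\<lambda>y. exp (- (norm y)\<^sup>2) * g i y * a r y)" if r: "r > 0" for i r
  proof (rule Bochner_Integration.integrable_bound[OF integrable_mult_left[OF e, of "(\<integral>z. \<bar>\<Phi> z\<bar> \<partial>lborel) / t i * (A / r)"]])
    show "AE y in lborel. norm (exp (- (norm y)\<^sup>2) * g i y * a r y) \<le> norm (exp (- (norm y)\<^sup>2) * ((\<integral>z. \<bar>\<Phi> z\<bar> \<partial>lborel) / t i * (A / r)))"
    proof (rule AE_I2)
      fix y :: "complex ^ 'n"
      have gl: "\<bar>g i y\<bar> \<le> (\<integral>z. \<bar>\<Phi> z\<bar> \<partial>lborel) / t i" unfolding g_def by (rule abs_integral_kern_le[OF \<Phi>int t(1)])
      have "\<bar>g i y\<bar> * \<bar>a r y\<bar> \<le> (\<integral>z. \<bar>\<Phi> z\<bar> \<partial>lborel) / t i * (A / r)"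
        using a_le[OF r, of y] gl by (intro mult_mono) auto
      then have "exp (- (norm y)\<^sup>2) * (\<bar>g i y\<bar> * \<bar>a r y\<bar>) \<le> exp (- (norm y)\<^sup>2) * \<bar>(\<integral>z. \<bar>\<Phi> z\<bar> \<partial>lborel) / t i * (A / r)\<bar>"
        by (intro mult_left_mono order_trans[OF _ abs_ge_self]) auto
      then show "norm (exp (- (norm y)\<^sup>2) * g i y * a r y) \<le> norm (exp (- (norm y)\<^sup>2) * ((\<integral>z. \<bar>\<Phi> z\<bar> \<partial>lborel) / t i * (A / r)))"
        by (simp only: real_norm_def abs_mult abs_exp_cancel mult.assoc)
    qed
  qed measurable
  have R_eq: "(gauss\<^sup>2) ^ CARD('n) * R i r = (\<integral>y. exp (- (norm y)\<^sup>2) * g i y * a r y \<partial>lborel)" if "r > 0" for i r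
    unfolding R_def g_def a_def by (rule integral_kernels_swap[OF \<Phi>int \<psi> t(1) that, symmetric])
  have AE0: "AE y in lborel. y \<noteq> (0 :: complex ^ 'n)" by (rule AE_lborel_singleton)
  let ?m = "\<lambda>i y. exp (- (norm y)\<^sup>2) * max 0 (- g i y) * (a s y - a (4 * s) y)"
  let ?w = "\<lambda>y :: complex ^ 'n. (C * (gauss\<^sup>2) ^ CARD('n) * (2 * (A / s))) * (exp (- (norm y)\<^sup>2) / (norm y)\<^sup>2)"
  have w: "integrable lborel ?w" by (intro integrable_mult_right integrable_gauss_inverse_square[OF n])
  have unit: "norm ((1 / norm y) *\<^sub>R y) = 1" if "y \<noteq> 0" for y :: "complex ^ 'n" using that by simp
  have bound: "AE y in lborel. norm (?m i y) \<le> ?w y" for i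
    using AE0
  proof eventually_elim
    case (elim y)
    have "\<bar>max 0 (- g i y)\<bar> \<le> C * (gauss\<^sup>2) ^ CARD('n) / (norm y)\<^sup>2"
      using section_limit(1)[OF \<Phi>m \<Phi> elim cont[OF unit[OF elim]] t(1)[of i]] unfolding g_def by linarith
    moreover have "\<bar>a s y - a (4 * s) y\<bar> \<le> 2 * (A / s)"
      using a_le[OF s, of y] a_le[OF s4, of y] divide_left_mono[OF _ A, of s "4 * s"] s by (auto simp: abs_le_iff)
    ultimately have "\<bar>max 0 (- g i y)\<bar> * \<bar>a s y - a (4 * s) y\<bar> \<le> C * (gauss\<^sup>2) ^ CARD('n) / (norm y)\<^sup>2 * (2 * (A / s))"
      using C by (intro mult_mono) auto
    then have "exp (- (norm y)\<^sup>2) * (\<bar>max 0 (- g i y)\<bar> * \<bar>a s y - a (4 * s) y\<bar>) \<le> exp (- (norm y)\<^sup>2) * (C * (gauss\<^sup>2) ^ CARD('n) / (norm y)\<^sup>2 * (2 * (A / s)))"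
      by (rule mult_left_mono) simp
    then show "norm (?m i y) \<le> ?w y" by (simp add: abs_mult mult_ac)
  qed
  have lim: "AE y in lborel. (\<lambda>i. ?m i y) \<longlonglongrightarrow> 0"
    using AE0
  proof eventually_elim
    case (elim y)
    let ?I = "gauss\<^sup>2 / (norm y)\<^sup>2 * (\<integral>h. \<Phi> h \<partial>hyperplane_measure ((1 / norm y) *\<^sub>R y))"
    have "?I \<ge> 0" using sections[OF unit[OF elim]] by (intro mult_nonneg_nonneg) auto
    moreover have "(\<lambda>i. g i y) \<longlonglongrightarrow> ?I"
      unfolding g_def using section_limit(2)[OF \<Phi>m \<Phi> elim cont[OF unit[OF elim]] t] .
    then have "(\<lambda>i. max 0 (- g i y)) \<longlonglongrightarrow> max 0 (- ?I)" by (intro tendsto_intros)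
    ultimately have "(\<lambda>i. max 0 (- g i y)) \<longlonglongrightarrow> 0" by simp
    then have "(\<lambda>i. ?m i y) \<longlonglongrightarrow> exp (- (norm y)\<^sup>2) * 0 * (a s y - a (4 * s) y)" by (intro tendsto_intros)
    then show ?case by simp
  qed
  have m0: "(\<lambda>i. \<integral>y. ?m i y \<partial>lborel) \<longlonglongrightarrow> (\<integral>y. 0 \<partial>(lborel :: (complex ^ 'n) measure))"
    by (rule integral_dominated_convergence[OF _ _ w lim bound]) measurable
  have mint: "integrable lborel (?m i)" for i
    by (rule integrable_dominated_convergence2[OF _ _ w lim bound]) measurable
  have ge: "- (\<integral>y. ?m i y \<partial>lborel) \<le> (gauss\<^sup>2) ^ CARD('n) * (R i s - R i (4 * s))" for i
  proof -
    have "- (\<integral>y. ?m i y \<partial>lborel) = (\<integral>y. - ?m i y \<partial>lborel)" by simp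
    also have "\<dots> \<le> (\<integral>y. exp (- (norm y)\<^sup>2) * g i y * a s y - exp (- (norm y)\<^sup>2) * g i y * a (4 * s) y \<partial>lborel)"
    proof (rule integral_mono_AE)
      show "AE y in lborel. - ?m i y \<le> exp (- (norm y)\<^sup>2) * g i y * a s y - exp (- (norm y)\<^sup>2) * g i y * a (4 * s) y"
        using AE0
      proof eventually_elim
        case (elim y)
        have "0 \<le> a s y - a (4 * s) y"
          unfolding a_def using integral_kern_antimono[OF \<psi> nonneg even mid elim s] by simp
        then have "(exp (- (norm y)\<^sup>2) * (a s y - a (4 * s) y)) * (- max 0 (- g i y)) \<le> (exp (- (norm y)\<^sup>2) * (a s y - a (4 * s) y)) * g i y"
          by (intro mult_left_mono) auto
        then show ?case by (simp add: algebra_simps)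
      qed
    qed (intro integrable_minus mint Bochner_Integration.integrable_diff int_ega s s4)+
    also have "\<dots> = (gauss\<^sup>2) ^ CARD('n) * (R i s - R i (4 * s))"
      using int_ega[OF s, of i] int_ega[OF s4, of i] by (simp add: right_diff_distrib R_eq[OF s] R_eq[OF s4])
    finally show ?thesis .
  qed
  let ?L = "\<lambda>r. (\<integral>p. (case p of (z, x) \<Rightarrow> \<Phi> z * \<psi> x / kernel_denominator 0 r z x) \<partial>(lborel \<Otimes>\<^sub>M lborel))"
  have "(\<lambda>i. R i r) \<longlonglongrightarrow> ?L r" if "r > 0" for r
    unfolding R_def by (rule tendsto_integral_kernel_denominator(1)[OF n \<Phi>m \<Phi> \<psi> that t])
  then have "(\<lambda>i. (gauss\<^sup>2) ^ CARD('n) * (R i s - R i (4 * s))) \<longlonglongrightarrow> (gauss\<^sup>2) ^ CARD('n) * (?L s - ?L (4 * s))"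
    using s s4 by (intro tendsto_mult tendsto_diff tendsto_const)
  moreover have "(\<lambda>i. - (\<integral>y. ?m i y \<partial>lborel)) \<longlonglongrightarrow> 0" using tendsto_minus[OF m0] by simp
  ultimately have "0 \<le> (gauss\<^sup>2) ^ CARD('n) * (?L s - ?L (4 * s))"
    by (rule tendsto_le[OF sequentially_bot]) (simp add: ge)
  moreover have "(gauss\<^sup>2) ^ CARD('n) > 0" using gauss_pos by simp
  ultimately have "0 \<le> ?L s - ?L (4 * s)" by (meson mult_pos_neg not_le)
  then show ?thesis by simp
qed

text \<open>
  The transversal masses \<open>m h\<close>, the integrals of \<open>\<psi>\<close> over the complex lines
  parallel to \<open>z\<close>, are averaged with weight \<open>section_kernel s \<bar>h\<bar>\<close>. Outside of
  any ball around \<open>0\<close> the weight stays bounded, while its total mass tends to infinity by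
  \<open>kernel_mass_ge\<close>. The normalised weight therefore concentrates at \<open>h = 0\<close>, and the
  means tend to \<open>m 0\<close>. The mass is taken with respect to \<open>exp (- \<bar>h\<bar>\<^sup>2)\<close>
  to keep it finite.
\<close>

lemma section_kernel_mean:
  fixes \<psi> :: "complex ^ 'n \<Rightarrow> real" and z :: "complex ^ 'n"
  assumes n: "CARD('n) = 2 \<or> CARD('n) = 3"
    and cont: "continuous_on UNIV \<psi>" and nonneg: "\<And>x. 0 \<le> \<psi> x" and le: "\<And>x. \<psi> x \<le> exp (- (norm x)\<^sup>2)"
    and z: "norm z = 1"
  defines "T \<equiv> \<lambda>s. \<integral>x. \<psi> x * section_kernel s (norm (hproj z x)) \<partial>lborel"
  shows "\<And>s. s > 0 \<Longrightarrow> 0 \<le> T s \<and> T s \<le> gauss\<^sup>2 * kernel_mass (CARD('n) - 1) s"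
    and "\<And>s. (\<And>i. s i > 0) \<Longrightarrow> s \<longlonglongrightarrow> 0 \<Longrightarrow>
      (\<lambda>i. T (s i) / kernel_mass (CARD('n) - 1) (s i)) \<longlonglongrightarrow> (\<integral>u. \<psi> (u *s z) \<partial>lborel)"
proof -
  let ?H = "hyperplane_measure z"
  let ?P = "?H \<Otimes>\<^sub>M (lborel :: complex measure)"
  let ?N = "kernel_mass (CARD('n) - 1)"
  let ?e = "\<lambda>x :: complex ^ 'n. exp (- (norm x)\<^sup>2)"
  interpret sigma_finite_measure ?H by (rule sigma_finite_hyperplane_measure)
  interpret P: pair_sigma_finite ?H "lborel :: complex measure" ..
  have [measurable]: "\<psi> \<in> borel_measurable borel" using cont by (rule borel_measurable_continuous_onI)
  define m where "m h = (\<integral>u. \<psi> (h + u *s z) \<partial>lborel)" for h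
  have [measurable]: "m \<in> borel_measurable borel"
    unfolding m_def by measurable
  have \<psi>_le: "\<psi> (h + u *s z) \<le> ?e h * exp (- (cmod u)\<^sup>2)" if "hprod h z = 0" for h u
    using le[of "h + u *s z"] norm_add_smult[OF z that, of u] by (simp add: exp_add[symmetric])
  have m_int: "integrable lborel (\<lambda>u. \<psi> (h + u *s z))" if "hprod h z = 0" for h
    using nonneg \<psi>_le[OF that]
    by (intro Bochner_Integration.integrable_bound[OF integrable_mult_right[OF integrable_gauss_complex, of "?e h"]]) auto
  have m_nonneg: "0 \<le> m h" for h unfolding m_def using nonneg by (intro Bochner_Integration.integral_nonneg) auto
  have m_le: "m h \<le> gauss\<^sup>2 * ?e h" if "hprod h z = 0" for h
  proof -
    have "m h \<le> (\<integral>u. ?e h * exp (- (cmod u)\<^sup>2) \<partial>lborel)"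
      unfolding m_def by (intro integral_mono m_int that integrable_mult_right integrable_gauss_complex \<psi>_le)
    then show ?thesis by (simp add: integral_gauss_complex mult.commute)
  qed
  have eint: "integrable ?H (\<lambda>h. ?e h * section_kernel s (norm h))"
    and emass: "(\<integral>h. ?e h * section_kernel s (norm h) \<partial>?H) = ?N s" if s: "s > 0" for s
  proof -
    have "0 \<le> ?N s" unfolding kernel_mass_def by simp
    then have "has_bochner_integral ?H (\<lambda>h. ?e h * section_kernel s (norm h)) (?N s)"
      using kernel_mass(1)[OF z s] section_kernel_nonneg[OF s]
      by (intro has_bochner_integral_nn_integral) auto
    then show "integrable ?H (\<lambda>h. ?e h * section_kernel s (norm h))"
      "(\<integral>h. ?e h * section_kernel s (norm h) \<partial>?H) = ?N s" by (auto simp: has_bochner_integral_iff)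
  qed
  have AEh: "AE h in ?H. hprod h z = 0" by (rule AE_hyperplane_measure)
  have mint: "integrable ?H (\<lambda>h. m h * section_kernel s (norm h))" if s: "s > 0" for s
  proof (rule Bochner_Integration.integrable_bound[OF integrable_mult_right[OF eint[OF s], of "gauss\<^sup>2"]])
    show "AE h in ?H. norm (m h * section_kernel s (norm h)) \<le> norm (gauss\<^sup>2 * (?e h * section_kernel s (norm h)))"
      using AEh
    proof eventually_elim
      case (elim h)
      show ?case using mult_right_mono[OF m_le[OF elim] section_kernel_nonneg[OF s, of "norm h"]] m_nonneg section_kernel_nonneg[OF s]
        by (simp add: abs_mult mult_ac)
    qed
  qed measurable
  have T_eq: "T s = (\<integral>h. m h * section_kernel s (norm h) \<partial>?H)" if s: "s > 0" for s
  proof -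
    let ?G = "\<lambda>h u. \<psi> (h + u *s z) * section_kernel s (norm h)"
    have G: "integrable ?P (\<lambda>(h, u). ?G h u)"
    proof (rule Bochner_Integration.integrable_bound)
      show "integrable ?P (\<lambda>(h, u). (?e h * section_kernel s (norm h)) * exp (- (cmod u)\<^sup>2))"
        by (intro P.integrable_product_mult eint s integrable_gauss_complex)
      show "(\<lambda>(h, u). ?G h u) \<in> borel_measurable ?P" by measurable
      have "AE p in ?P. hprod (fst p) z = 0"
      proof (rule P.AE_pair_measure)
        show "{p \<in> space ?P. hprod (fst p) z = 0} \<in> sets ?P" by measurable
      qed (use AEh in auto)
      then show "AE p in ?P. norm (case p of (h, u) \<Rightarrow> ?G h u) \<le> norm (case p of (h, u) \<Rightarrow> (?e h * section_kernel s (norm h)) * exp (- (cmod u)\<^sup>2))"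
      proof (rule AE_mp, intro AE_I2 impI)
        fix p :: "(complex ^ 'n) \<times> complex" assume "hprod (fst p) z = 0"
        then obtain h u where p: "p = (h, u)" "hprod h z = 0" by (cases p) auto
        show "norm (case p of (h, u) \<Rightarrow> ?G h u) \<le> norm (case p of (h, u) \<Rightarrow> (?e h * section_kernel s (norm h)) * exp (- (cmod u)\<^sup>2))"
          unfolding p prod.case
          using mult_right_mono[OF \<psi>_le[OF p(2), of u] section_kernel_nonneg[OF s, of "norm h"]] nonneg section_kernel_nonneg[OF s]
          by (simp add: abs_mult mult_ac)
      qed
    qed
    have "T s = 1\<^sup>2 * (\<integral>p. (case p of (h, u) \<Rightarrow> ?G h u) \<partial>?P)"
      unfolding T_def
    proof (rule integral_split(1)[OF z])
      fix h u assume h: "hprod h z = 0"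
      then show "\<psi> (h + (of_real 1 * u) *s z) * section_kernel s (norm (hproj z (h + (of_real 1 * u) *s z))) = ?G h u"
        using z by (simp add: hproj_def hprod_add_left hprod_scale_left hprod_self)
    qed (auto simp: hproj_def)
    also have "\<dots> = (\<integral>h. \<integral>u. ?G h u \<partial>lborel \<partial>?H)"
      using P.integral_fst[OF G] by simp
    finally show ?thesis by (simp add: m_def)
  qed
  show "0 \<le> T s \<and> T s \<le> gauss\<^sup>2 * ?N s" if s: "s > 0" for s
  proof
    show "0 \<le> T s" unfolding T_eq[OF s] using m_nonneg section_kernel_nonneg[OF s]
      by (intro Bochner_Integration.integral_nonneg) auto
    have "T s \<le> (\<integral>h. gauss\<^sup>2 * (?e h * section_kernel s (norm h)) \<partial>?H)"
      unfolding T_eq[OF s]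
    proof (rule integral_mono_AE[OF mint[OF s] integrable_mult_right[OF eint[OF s]]])
      show "AE h in ?H. m h * section_kernel s (norm h) \<le> gauss\<^sup>2 * (?e h * section_kernel s (norm h))"
        using AEh
      proof eventually_elim
        case (elim h)
        show ?case using mult_right_mono[OF m_le[OF elim] section_kernel_nonneg[OF s, of "norm h"]] by (simp only: mult.assoc)
      qed
    qed
    then show "T s \<le> gauss\<^sup>2 * ?N s" by (simp add: emass[OF s])
  qed
  have m_cont: "continuous (at 0 within {h. hprod h z = 0}) m"
    unfolding continuous_within_sequentially
  proof (intro allI impI)
    fix X assume X: "(\<forall>i. X i \<in> {h. hprod h z = 0}) \<and> X \<longlonglongrightarrow> 0"
    have "(\<lambda>i. \<integral>u. \<psi> (X i + u *s z) \<partial>lborel) \<longlonglongrightarrow> (\<integral>u. \<psi> (0 + u *s z) \<partial>lborel)"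
    proof (rule integral_dominated_convergence[OF _ _ integrable_gauss_complex])
      show "AE u in lborel. (\<lambda>i. \<psi> (X i + u *s z)) \<longlonglongrightarrow> \<psi> (0 + u *s z)"
        using X cont by (intro AE_I2 continuous_on_tendsto_compose[OF cont] tendsto_add tendsto_const) auto
      show "AE u in lborel. norm (\<psi> (X i + u *s z)) \<le> exp (- (cmod u)\<^sup>2)" for i
      proof (rule AE_I2)
        fix u
        have "?e (X i) * exp (- (cmod u)\<^sup>2) \<le> 1 * exp (- (cmod u)\<^sup>2)" by (intro mult_right_mono) auto
        moreover have "\<psi> (X i + u *s z) \<le> ?e (X i) * exp (- (cmod u)\<^sup>2)" using \<psi>_le X by simp
        ultimately show "norm (\<psi> (X i + u *s z)) \<le> exp (- (cmod u)\<^sup>2)"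
          using nonneg[of "X i + u *s z"] unfolding real_norm_def by linarith
      qed
    qed measurable
    then show "(m \<circ> X) \<longlonglongrightarrow> m 0" by (simp add: m_def comp_def)
  qed
  show "(\<lambda>i. T (s i) / ?N (s i)) \<longlonglongrightarrow> (\<integral>u. \<psi> (u *s z) \<partial>lborel)" if s: "\<And>i. s i > 0" "s \<longlonglongrightarrow> 0" for s
  proof -
    have N_top: "filterlim (\<lambda>i. ?N (s i)) at_top sequentially"
    proof -
      obtain c where c: "c > 0" "\<And>r. 0 < r \<Longrightarrow> r \<le> 1 \<Longrightarrow> c * ln (1 / r) \<le> ?N r"
        using kernel_mass_ge[OF n] by blast
      have "filterlim (\<lambda>i. 1 / s i) at_top sequentially"
        using filterlim_inverse_at_top[OF s(2)] s(1) by (simp add: inverse_eq_divide)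
      then have "filterlim (\<lambda>i. c * ln (1 / s i)) at_top sequentially"
        by (intro filterlim_tendsto_pos_mult_at_top[OF tendsto_const c(1)] filterlim_compose[OF ln_at_top])
      moreover have "eventually (\<lambda>i. c * ln (1 / s i) \<le> ?N (s i)) sequentially"
        using order_tendstoD(2)[OF s(2), of 1] by (rule eventually_mono[OF _ c(2)]) (use s in auto)
      ultimately show ?thesis by (rule filterlim_at_top_mono)
    qed
    have "(\<lambda>i. T (s i) / ?N (s i) - m 0) \<longlonglongrightarrow> 0"
    proof (rule LIMSEQ_I)
      fix e :: real assume e: "e > 0"
      \<comment> \<open>The mass \<open>?N\<close> carries the factor \<open>exp (- \<bar>h\<bar>\<^sup>2)\<close>, so
        \<open>m\<close> has to be compared with \<open>m 0 exp (- \<bar>h\<bar>\<^sup>2)\<close>.\<close>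
      let ?F = "\<lambda>h. m h * exp ((norm h)\<^sup>2)"
      have "continuous (at 0 within {h. hprod h z = 0}) ?F"
        by (intro continuous_intros m_cont)
      then have "\<exists>r>0. \<forall>h\<in>{h. hprod h z = 0}. dist h 0 < r \<longrightarrow> dist (?F h) (?F 0) < e / 2"
        using half_gt_zero[OF e] unfolding continuous_within_eps_delta by blast
      then obtain r where r: "r > 0" and r_le: "\<forall>h\<in>{h. hprod h z = 0}. dist h 0 < r \<longrightarrow> dist (?F h) (?F 0) < e / 2"
        by blast
      have r_less: "\<bar>?F h - m 0\<bar> < e / 2" if "hprod h z = 0" "norm h < r" for h
        using r_le that by (simp add: dist_norm)
      define D where "D = gauss\<^sup>2 / r ^ 4 * (gauss\<^sup>2) ^ (CARD('n) - 1)"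
      have D: "D \<ge> 0" using r by (simp add: D_def)
      \<comment> \<open>The first term comes from \<open>\<bar>h\<bar> < r\<close>, where \<open>m\<close> is almost constant,
        the bounded second term from \<open>\<bar>h\<bar> \<ge> r\<close>, where the kernel is at most
        \<open>r\<^sup>-\<^sup>4\<close>.\<close>
      have main: "\<bar>T r' - m 0 * ?N r'\<bar> \<le> e / 2 * ?N r' + D" if r': "r' > 0" for r'
      proof -
        let ?k = "\<lambda>h :: complex ^ 'n. section_kernel r' (norm h)"
        have "T r' - m 0 * ?N r' = (\<integral>h. m h * ?k h - m 0 * (?e h * ?k h) \<partial>?H)"
          unfolding T_eq[OF r'] emass[OF r', symmetric]
          using mint[OF r'] eint[OF r'] by simp
        also have "\<bar>\<dots>\<bar> \<le> (\<integral>h. \<bar>m h * ?k h - m 0 * (?e h * ?k h)\<bar> \<partial>?H)" by (rule integral_abs_bound)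
        also have "\<dots> \<le> (\<integral>h. e / 2 * (?e h * ?k h) + gauss\<^sup>2 / r ^ 4 * ?e h \<partial>?H)"
        proof (rule integral_mono_AE)
          show "integrable ?H (\<lambda>h. \<bar>m h * ?k h - m 0 * (?e h * ?k h)\<bar>)"
            using mint[OF r'] eint[OF r'] by (intro integrable_abs Bochner_Integration.integrable_diff integrable_mult_right)
          show "integrable ?H (\<lambda>h. e / 2 * (?e h * ?k h) + gauss\<^sup>2 / r ^ 4 * ?e h)"
            using eint[OF r'] by (intro Bochner_Integration.integrable_add integrable_mult_right integrable_gauss_hyperplane z)
          show "AE h in ?H. \<bar>m h * ?k h - m 0 * (?e h * ?k h)\<bar> \<le> e / 2 * (?e h * ?k h) + gauss\<^sup>2 / r ^ 4 * ?e h"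
            using AEh
          proof eventually_elim
            case (elim h)
            have k: "0 \<le> ?k h" by (rule section_kernel_nonneg[OF r'])
            have "\<bar>m h * ?k h - m 0 * (?e h * ?k h)\<bar> = \<bar>m h - m 0 * ?e h\<bar> * ?k h"
            proof -
              have "m h * ?k h - m 0 * (?e h * ?k h) = (m h - m 0 * ?e h) * ?k h" by (simp add: algebra_simps)
              then show ?thesis using k by (simp only: abs_mult abs_of_nonneg)
            qed
            also have "\<dots> \<le> e / 2 * (?e h * ?k h) + gauss\<^sup>2 / r ^ 4 * ?e h"
            proof (cases "norm h < r")
              case True
              have "m h - m 0 * ?e h = (?F h - m 0) * ?e h" by (simp add: algebra_simps flip: exp_add)
              then have "\<bar>m h - m 0 * ?e h\<bar> = \<bar>?F h - m 0\<bar> * ?e h" by (simp add: abs_mult)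
              also have "\<dots> \<le> e / 2 * ?e h" using r_less[OF elim True] by (intro mult_right_mono) auto
              finally have "\<bar>m h - m 0 * ?e h\<bar> * ?k h \<le> e / 2 * ?e h * ?k h" using k by (rule mult_right_mono)
              moreover have "0 \<le> gauss\<^sup>2 / r ^ 4 * ?e h" using r by simp
              ultimately show ?thesis by (simp only: mult.assoc)
            next
              case False
              have m0: "m 0 \<le> gauss\<^sup>2" using m_le[of 0] by simp
              have "m 0 * ?e h \<le> gauss\<^sup>2 * ?e h" "0 \<le> m 0 * ?e h" using m0 m_nonneg by (auto intro: mult_right_mono)
              then have d: "\<bar>m h - m 0 * ?e h\<bar> \<le> gauss\<^sup>2 * ?e h"
                using m_le[OF elim] m_nonneg[of h] unfolding abs_le_iff by linarith
              have "?k h \<le> 1 / r ^ 4"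
              proof -
                have rr: "r\<^sup>2 \<le> (norm h)\<^sup>2" using False r by (intro power_mono) auto
                then have "r\<^sup>2 * r\<^sup>2 \<le> (r' + (norm h)\<^sup>2) * (4 * r' + (norm h)\<^sup>2)" using r' by (intro mult_mono) auto
                moreover have "r\<^sup>2 * r\<^sup>2 = r ^ 4" by (simp flip: power_add)
                ultimately show ?thesis unfolding section_kernel_def using r r'
                  by (intro divide_left_mono mult_pos_pos add_pos_nonneg zero_less_power) auto
              qed
              then have "\<bar>m h - m 0 * ?e h\<bar> * ?k h \<le> gauss\<^sup>2 * ?e h * (1 / r ^ 4)" using d k by (intro mult_mono) auto
              moreover have "0 \<le> e / 2 * (?e h * ?k h)" using e k by simp
              ultimately show ?thesis by simp
            qed
            finally show ?case .
          qed
        qed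
        also have "\<dots> = e / 2 * ?N r' + D"
          using eint[OF r'] integrable_gauss_hyperplane(1)[OF z]
          by (simp add: emass[OF r'] integrable_gauss_hyperplane(2)[OF z] D_def)
        finally show ?thesis .
      qed
      have "eventually (\<lambda>i. ?N (s i) > 2 * D / e + 1) sequentially"
        using N_top by (auto simp: filterlim_at_top_dense)
      then obtain n0 where n0: "\<And>i. i \<ge> n0 \<Longrightarrow> ?N (s i) > 2 * D / e + 1" by (auto simp: eventually_sequentially)
      have "norm (T (s i) / ?N (s i) - m 0 - 0) < e" if i: "i \<ge> n0" for i
      proof -
        have N: "?N (s i) > 2 * D / e + 1" using n0[OF i] .
        have "0 \<le> 2 * D / e" using D e by simp
        then have N0: "?N (s i) > 0" using N by linarith
        have "D < e / 2 * ?N (s i)" using N e by (simp add: field_simps)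
        then have "\<bar>T (s i) - m 0 * ?N (s i)\<bar> < e * ?N (s i)" using main[OF s(1), of i] by (simp add: field_simps)
        moreover have "T (s i) / ?N (s i) - m 0 = (T (s i) - m 0 * ?N (s i)) / ?N (s i)" using N0 by (simp add: field_simps)
        ultimately show ?thesis using N0 by (simp add: abs_divide divide_less_eq)
      qed
      then show "\<exists>no. \<forall>i\<ge>no. norm (T (s i) / ?N (s i) - m 0 - 0) < e" by blast
    qed
    then have "(\<lambda>i. T (s i) / ?N (s i)) \<longlonglongrightarrow> m 0" by (rule LIM_zero_cancel)
    then show ?thesis by (simp add: m_def)
  qed
qed

text \<open>
  At \<open>t = 0\<close> the denominator sees \<open>x\<close> only through its distance to the complex line
  spanned by \<open>z\<close>.
\<close>

lemma kernel_denominator_hproj: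
  assumes z: "z \<noteq> 0"
  shows "kernel_denominator 0 s z x = (norm z)\<^sup>2 * (s + (norm (hproj ((1 / norm z) *\<^sub>R z) x))\<^sup>2)"
proof -
  define e where "e = (1 / norm z) *\<^sub>R z"
  have e: "norm e = 1" and z_eq: "z = norm z *\<^sub>R e" using z by (simp_all add: e_def)
  have "(cmod (hprod x z))\<^sup>2 = (norm z)\<^sup>2 * (cmod (hprod x e))\<^sup>2"
    by (subst z_eq) (simp add: hprod_scaleR_right norm_mult power_mult_distrib)
  then show ?thesis unfolding kernel_denominator_def e_def[symmetric] norm_hproj[OF e]
    by (simp add: algebra_simps)
qed

lemma kernel_denominator_difference:
  assumes z: "z \<noteq> 0" and s: "s > 0"
  shows "1 / kernel_denominator 0 s z x - 1 / kernel_denominator 0 (4 * s) z x =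
    3 * s / (norm z)\<^sup>2 * section_kernel s (norm (hproj ((1 / norm z) *\<^sub>R z) x))"
proof -
  define q where "q = (norm (hproj ((1 / norm z) *\<^sub>R z) x))\<^sup>2"
  have q: "s + q > 0" "4 * s + q > 0" using s by (auto simp: q_def add_pos_nonneg)
  have "1 / (s + q) - 1 / (4 * s + q) = 3 * s / ((s + q) * (4 * s + q))" using q by (simp add: field_simps)
  then have "(1 / (norm z)\<^sup>2) * (1 / (s + q) - 1 / (4 * s + q)) = 3 * s / (norm z)\<^sup>2 * (1 / ((s + q) * (4 * s + q)))"
    by simp
  then show ?thesis
    unfolding kernel_denominator_hproj[OF z] section_kernel_def q_def[symmetric] by (simp add: right_diff_distrib)
qed

section \<open>The affirmative part\<close>

text \<open>
  The choice \<open>\<psi> x = exp (- (R \<parallel>x\<parallel>\<^sub>K)\<^sup>2)\<close> is log-concave and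
  even, and with \<open>R\<close> a bound for the norm on \<open>K\<close> it lies below \<open>exp (-
  \<bar>x\<bar>\<^sup>2)\<close>. The difference of the two kernels in \<open>kernel_difference_nonneg\<close> is
  \<open>3 s / \<bar>z\<bar>\<^sup>2\<close> times the section kernel; divide by its mass and let \<open>s
  \<rightarrow> 0\<close>. By \<open>section_kernel_mean\<close> what remains is the integral of
  \<open>\<psi>\<close> over the complex line through \<open>z\<close>, and there \<open>\<psi>\<close> is a
  Gaussian, with integral \<open>gauss\<^sup>2 \<bar>z\<bar>\<^sup>2 / (R
  \<parallel>z\<parallel>\<^sub>K)\<^sup>2\<close>.
\<close>

lemma weighted_volume_nonneg:
  fixes \<Phi> :: "complex ^ 'n \<Rightarrow> real"
  assumes n: "CARD('n) = 2 \<or> CARD('n) = 3"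
    and body: "origin_symmetric_convex_body K" and inv: "rotation_invariant K"
    and \<Phi>m [measurable]: "\<Phi> \<in> borel_measurable borel" and \<Phi>: "\<And>z. \<bar>\<Phi> z\<bar> \<le> C * exp (- (norm z)\<^sup>2)"
    and cont: "\<And>\<zeta>. norm \<zeta> = 1 \<Longrightarrow> AE h in hyperplane_measure \<zeta>. isCont \<Phi> h"
    and sections: "\<And>\<zeta>. norm \<zeta> = 1 \<Longrightarrow> 0 \<le> (\<integral>h. \<Phi> h \<partial>hyperplane_measure \<zeta>)"
  shows "0 \<le> (\<integral>z. \<Phi> z / (minkowski K z)\<^sup>2 \<partial>lborel)"
    and "integrable lborel (\<lambda>z. \<Phi> z / (minkowski K z)\<^sup>2)"
proof -
  interpret symmetric_body K using body by unfold_locales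
  have n2: "CARD('n) \<ge> 2" using n by auto
  have C: "C \<ge> 0" using \<Phi>[of 0] by simp
  obtain r R where r: "r > 0" and R: "R > 0" and gle: "\<And>x. minkowski K x \<le> norm x / r" and gge: "\<And>x. norm x \<le> R * minkowski K x"
    by (rule minkowski_bounds) (rule that)
  define \<psi> where "\<psi> x = exp (- (R * minkowski K x)\<^sup>2)" for x
  have \<psi>_cont: "continuous_on UNIV \<psi>"
    unfolding \<psi>_def by (intro continuous_intros continuous_minkowski)
  have [measurable]: "\<psi> \<in> borel_measurable borel" using \<psi>_cont by (rule borel_measurable_continuous_onI)
  have \<psi>_nonneg: "0 \<le> \<psi> x" for x by (simp add: \<psi>_def)
  have \<psi>_le: "\<psi> x \<le> exp (- (norm x)\<^sup>2)" for x
    unfolding \<psi>_def using power_mono[OF gge[of x], of 2] by simp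
  have \<psi>: "integrable lborel \<psi>"
    using \<psi>_le \<psi>_nonneg by (intro Bochner_Integration.integrable_bound[OF integrable_gauss_space]) auto
  have even: "\<psi> (- x) = \<psi> x" for x using minkowski_scaleR[of "-1" x] by (simp add: \<psi>_def)
  have mid: "\<psi> x * \<psi> y \<le> (\<psi> ((1/2) *\<^sub>R (x + y)))\<^sup>2" for x y
  proof -
    let ?a = "R * minkowski K x" and ?b = "R * minkowski K y"
    have "minkowski K ((1/2) *\<^sub>R (x + y)) \<le> (minkowski K x + minkowski K y) / 2"
      using minkowski_triangle[of x y] by (simp add: minkowski_scaleR)
    then have "R * minkowski K ((1/2) *\<^sub>R (x + y)) \<le> (?a + ?b) / 2"
      using mult_left_mono[OF _ less_imp_le[OF R]] by (fastforce simp: algebra_simps)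
    then have "(R * minkowski K ((1/2) *\<^sub>R (x + y)))\<^sup>2 \<le> ((?a + ?b) / 2)\<^sup>2"
      using R minkowski_nonneg by (intro power_mono) auto
    moreover have "2 * ((?a + ?b) / 2)\<^sup>2 \<le> ?a\<^sup>2 + ?b\<^sup>2"
      using zero_le_power2[of "?a - ?b"] by (simp add: power2_eq_square field_simps)
    ultimately have "- ?a\<^sup>2 + - ?b\<^sup>2 \<le> - (R * minkowski K ((1/2) *\<^sub>R (x + y)))\<^sup>2 + - (R * minkowski K ((1/2) *\<^sub>R (x + y)))\<^sup>2" by linarith
    then show ?thesis unfolding \<psi>_def power2_eq_square[of "exp _"] by (simp only: exp_add[symmetric] exp_le_cancel_iff)
  qed
  define T where "T s z = (\<integral>x. \<psi> x * section_kernel s (norm (hproj ((1 / norm z) *\<^sub>R z) x)) \<partial>lborel)" for s and z :: "complex ^ 'n"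
  have T_meas [measurable]: "T s \<in> borel_measurable borel" for s
    unfolding T_def hproj_def measurable_lborel1[symmetric] by measurable
  let ?N = "kernel_mass (CARD('n) - 1)"
  have unit: "norm ((1 / norm z) *\<^sub>R z) = 1" if "z \<noteq> 0" for z :: "complex ^ 'n" using that by simp
  have T_bd: "0 \<le> T s z" "T s z \<le> gauss\<^sup>2 * ?N s" if "z \<noteq> 0" "s > 0" for s and z :: "complex ^ 'n"
    using section_kernel_mean(1)[OF n \<psi>_cont \<psi>_nonneg \<psi>_le unit[OF that(1)] that(2)] by (auto simp: T_def)
  have N0: "0 \<le> ?N s" for s by (simp add: kernel_mass_def)
  have AE0: "AE z in lborel. z \<noteq> (0 :: complex ^ 'n)" by (rule AE_lborel_singleton)
  have pos: "0 \<le> (\<integral>z. \<Phi> z / (norm z)\<^sup>2 * T s z \<partial>lborel)" if s: "s > 0" for s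
  proof -
    have s4: "4 * s > 0" using s by simp
    define t where "t i = 1 / real (Suc i)" for i
    have t: "\<And>i. t i > 0" "t \<longlonglongrightarrow> 0"
      unfolding t_def using LIMSEQ_inverse_real_of_nat by (auto simp: inverse_eq_divide)
    let ?A = "\<lambda>r p. case p of (z, x) \<Rightarrow> \<Phi> z * \<psi> x / kernel_denominator 0 r z x"
    have int: "integrable (lborel \<Otimes>\<^sub>M lborel) (?A r)" if "r > 0" for r
      by (rule tendsto_integral_kernel_denominator(2)[OF n2 \<Phi>m \<Phi> \<psi> that t])
    let ?D = "\<lambda>z x. \<Phi> z * \<psi> x / kernel_denominator 0 s z x - \<Phi> z * \<psi> x / kernel_denominator 0 (4 * s) z x"
    have intD: "integrable (lborel \<Otimes>\<^sub>M lborel) (\<lambda>(z, x). ?D z x)"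
      using Bochner_Integration.integrable_diff[OF int[OF s] int[OF s4]] by (simp add: split_beta')
    have "0 \<le> (\<integral>p. ?A s p \<partial>(lborel \<Otimes>\<^sub>M lborel)) - (\<integral>p. ?A (4 * s) p \<partial>(lborel \<Otimes>\<^sub>M lborel))"
      using kernel_difference_nonneg[OF n2 \<Phi>m \<Phi> cont sections \<psi> \<psi>_nonneg even mid s] by simp
    also have "\<dots> = (\<integral>p. (case p of (z, x) \<Rightarrow> ?D z x) \<partial>(lborel \<Otimes>\<^sub>M lborel))"
      using Bochner_Integration.integral_diff[OF int[OF s] int[OF s4]] by (simp add: split_beta')
    also have "\<dots> = (\<integral>z. \<integral>x. ?D z x \<partial>lborel \<partial>lborel)" by (rule lborel_pair.integral_fst[OF intD, symmetric])
    also have "\<dots> = (\<integral>z. 3 * s * (\<Phi> z / (norm z)\<^sup>2 * T s z) \<partial>lborel)"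
    proof (rule integral_cong_AE)
      show "(\<lambda>z. \<integral>x. ?D z x \<partial>lborel) \<in> borel_measurable lborel" by measurable
      show "(\<lambda>z. 3 * s * (\<Phi> z / (norm z)\<^sup>2 * T s z)) \<in> borel_measurable lborel" by measurable
      show "AE z in lborel. (\<integral>x. ?D z x \<partial>lborel) = 3 * s * (\<Phi> z / (norm z)\<^sup>2 * T s z)"
        using AE0
      proof eventually_elim
        case (elim z)
        have "?D z x = (\<Phi> z * (3 * s / (norm z)\<^sup>2)) * (\<psi> x * section_kernel s (norm (hproj ((1 / norm z) *\<^sub>R z) x)))" for x
        proof -
          have "?D z x = \<Phi> z * \<psi> x * (1 / kernel_denominator 0 s z x - 1 / kernel_denominator 0 (4 * s) z x)"
            by (simp add: right_diff_distrib)
          then show ?thesis unfolding kernel_denominator_difference[OF elim s] by (simp add: mult_ac)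
        qed
        then show ?case by (simp add: T_def)
      qed
    qed
    also have "\<dots> = 3 * s * (\<integral>z. \<Phi> z / (norm z)\<^sup>2 * T s z \<partial>lborel)" by (rule integral_mult_right_zero)
    finally show ?thesis using s by (simp add: zero_le_mult_iff)
  qed
  define s where "s i = 1 / real (Suc i)" for i
  have s: "\<And>i. s i > 0" "s \<longlonglongrightarrow> 0"
    unfolding s_def using LIMSEQ_inverse_real_of_nat by (auto simp: inverse_eq_divide)
  let ?F = "\<lambda>i z. \<Phi> z / (norm z)\<^sup>2 * (T (s i) z / ?N (s i))"
  let ?L = "\<lambda>z. gauss\<^sup>2 / R\<^sup>2 * (\<Phi> z / (minkowski K z)\<^sup>2)"
  let ?w = "\<lambda>z :: complex ^ 'n. (C * gauss\<^sup>2) * (exp (- (norm z)\<^sup>2) / (norm z)\<^sup>2)"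
  have w: "integrable lborel ?w" by (intro integrable_mult_right integrable_gauss_inverse_square n2)
  have bound: "AE z in lborel. norm (?F i z) \<le> ?w z" for i
    using AE0
  proof eventually_elim
    case (elim z)
    have TN: "0 \<le> T (s i) z / ?N (s i)" "T (s i) z / ?N (s i) \<le> gauss\<^sup>2"
    proof -
      show "0 \<le> T (s i) z / ?N (s i)" using T_bd(1)[OF elim s(1)] N0 by (intro divide_nonneg_nonneg) auto
      show "T (s i) z / ?N (s i) \<le> gauss\<^sup>2"
      proof (cases "?N (s i) = 0")
        case False
        then have "?N (s i) > 0" using N0[of "s i"] by linarith
        then show ?thesis using T_bd(2)[OF elim s(1), of i] by (simp add: divide_le_eq)
      qed simp
    qed
    have "\<bar>\<Phi> z\<bar> / (norm z)\<^sup>2 * (T (s i) z / ?N (s i)) \<le> C * exp (- (norm z)\<^sup>2) / (norm z)\<^sup>2 * gauss\<^sup>2"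
      using TN \<Phi>[of z] C by (intro mult_mono divide_right_mono) auto
    moreover have "norm (?F i z) = \<bar>\<Phi> z\<bar> / (norm z)\<^sup>2 * (T (s i) z / ?N (s i))"
      unfolding real_norm_def abs_mult abs_of_nonneg[OF TN(1)] by simp
    ultimately show "norm (?F i z) \<le> ?w z" by (simp add: mult_ac)
  qed
  have lim: "AE z in lborel. (\<lambda>i. ?F i z) \<longlonglongrightarrow> ?L z"
    using AE0
  proof eventually_elim
    case (elim z)
    let ?\<zeta> = "(1 / norm z) *\<^sub>R z"
    have g: "minkowski K ?\<zeta> > 0" using elim by (intro minkowski_pos) simp
    have "(\<lambda>i. T (s i) z / ?N (s i)) \<longlonglongrightarrow> (\<integral>u. \<psi> (u *s ?\<zeta>) \<partial>lborel)"
      unfolding T_def by (rule section_kernel_mean(2)[OF n \<psi>_cont \<psi>_nonneg \<psi>_le unit[OF elim] s])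
    also have "(\<integral>u. \<psi> (u *s ?\<zeta>) \<partial>lborel) = gauss\<^sup>2 / (R * minkowski K ?\<zeta>)\<^sup>2"
    proof -
      have "\<psi> (u *s ?\<zeta>) = exp (- ((R * minkowski K ?\<zeta>)\<^sup>2 * (cmod u)\<^sup>2))" for u
        unfolding \<psi>_def minkowski_smult[OF body inv] by (simp add: power_mult_distrib mult_ac)
      moreover have "has_bochner_integral lborel (\<lambda>u. exp (- ((R * minkowski K ?\<zeta>)\<^sup>2 * (cmod u)\<^sup>2))) (gauss\<^sup>2 / (R * minkowski K ?\<zeta>)\<^sup>2)"
        using nn_integral_gauss_complex[of "(R * minkowski K ?\<zeta>)\<^sup>2"] R g by (intro has_bochner_integral_nn_integral) auto
      ultimately show ?thesis by (simp add: has_bochner_integral_iff)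
    qed
    finally have "(\<lambda>i. ?F i z) \<longlonglongrightarrow> \<Phi> z / (norm z)\<^sup>2 * (gauss\<^sup>2 / (R * minkowski K ?\<zeta>)\<^sup>2)"
      by (intro tendsto_mult tendsto_const)
    moreover have "minkowski K ?\<zeta> = minkowski K z / norm z" by (simp add: minkowski_scaleR)
    ultimately show ?case using elim by (simp add: power_mult_distrib power_divide mult_ac)
  qed
  have conv: "(\<lambda>i. \<integral>z. ?F i z \<partial>lborel) \<longlonglongrightarrow> (\<integral>z. ?L z \<partial>lborel)"
    by (rule integral_dominated_convergence[OF _ _ w lim bound]) measurable
  have F_nonneg: "0 \<le> (\<integral>z. ?F i z \<partial>lborel)" for i
  proof -
    have "(\<integral>z. ?F i z \<partial>lborel) = (\<integral>z. (1 / ?N (s i)) * (\<Phi> z / (norm z)\<^sup>2 * T (s i) z) \<partial>lborel)"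
      by (rule Bochner_Integration.integral_cong) (auto simp: mult_ac)
    then show ?thesis using pos[OF s(1), of i] N0[of "s i"] by (simp del: times_divide_eq_left)
  qed
  have "0 \<le> (\<integral>z. ?L z \<partial>lborel)" by (rule LIMSEQ_le_const[OF conv]) (use F_nonneg in blast)
  then have "0 \<le> gauss\<^sup>2 / R\<^sup>2 * (\<integral>z. \<Phi> z / (minkowski K z)\<^sup>2 \<partial>lborel)" by (simp only: integral_mult_right_zero)
  moreover have c: "gauss\<^sup>2 / R\<^sup>2 > 0" using gauss_pos R by simp
  ultimately show "0 \<le> (\<integral>z. \<Phi> z / (minkowski K z)\<^sup>2 \<partial>lborel)" by (meson mult_pos_neg not_le)
  have "integrable lborel ?L"
    by (rule integrable_dominated_convergence[OF _ _ w lim bound]) measurable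
  from integrable_mult_right[OF this, of "R\<^sup>2 / gauss\<^sup>2"] show "integrable lborel (\<lambda>z. \<Phi> z / (minkowski K z)\<^sup>2)"
    using gauss_pos R by simp
qed

lemma mu_section_hyperplane:
  assumes [measurable]: "f \<in> borel_measurable borel" "D \<in> sets borel"
  shows "mu_section f D (complex_hyperplane \<zeta>) = (\<integral>h. indicator D h * f h \<partial>hyperplane_measure \<zeta>)"
  unfolding mu_section_def set_lebesgue_integral_def
proof (rule integral_cong_AE)
  have [measurable]: "complex_hyperplane \<zeta> \<in> sets borel"
    by (intro borel_closed closed_subspace subspace_complex_hyperplane)
  show "(\<lambda>x. indicat_real (D \<inter> complex_hyperplane \<zeta>) x *\<^sub>R f x) \<in> borel_measurable (hyperplane_measure \<zeta>)" by measurable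
  show "(\<lambda>h. indicator D h * f h) \<in> borel_measurable (hyperplane_measure \<zeta>)" by measurable
  show "AE x in hyperplane_measure \<zeta>. indicat_real (D \<inter> complex_hyperplane \<zeta>) x *\<^sub>R f x = indicator D x * f x"
    using AE_hyperplane_measure[of \<zeta>] by eventually_elim (simp add: indicator_def mem_complex_hyperplane)
qed

text \<open>
  With \<open>\<Phi> = f (1\<^sub>L - 1\<^sub>K)\<close>, the inequality \<open>\<Phi>(z) /
  \<parallel>z\<parallel>\<^sub>K\<^sup>2 \<le> \<Phi>(z)\<close> holds for every \<open>z\<close>: the sign of
  \<open>\<Phi>\<close> and the size of \<open>\<parallel>z\<parallel>\<^sub>K\<close> both change at the boundary
  of \<open>K\<close>.
\<close>

theorem mu_le_if_sections_le:
  fixes f :: "complex ^ 'n \<Rightarrow> real"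
  assumes n: "CARD('n) = 2 \<or> CARD('n) = 3"
    and f: "continuous_on UNIV f" and f_pos: "\<And>x. f x > 0"
    and K: "origin_symmetric_convex_body K" and L: "origin_symmetric_convex_body L"
    and inv: "rotation_invariant K"
    and sections: "\<And>\<xi>. \<xi> \<in> sphere 0 1 \<Longrightarrow> mu_section f K (complex_hyperplane \<xi>) \<le> mu_section f L (complex_hyperplane \<xi>)"
  shows "mu f K \<le> mu f L"
proof -
  interpret K: symmetric_body K using K by unfold_locales
  interpret L: symmetric_body L using L by unfold_locales
  have f_meas [measurable]: "f \<in> borel_measurable borel" using f by (rule borel_measurable_continuous_onI)
  have "compact (f ` (K \<union> L))"
    using K.compact L.compact by (intro compact_continuous_image continuous_on_subset[OF f]) auto
  then obtain M where M: "\<And>x. x \<in> K \<union> L \<Longrightarrow> f x \<le> M" "M > 0"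
    unfolding bounded_pos[THEN sym, symmetric] using compact_imp_bounded[of "f ` (K \<union> L)"] by (auto simp: bounded_pos) (metis abs_le_D1 UnCI)
  obtain R where R: "\<And>x. x \<in> K \<union> L \<Longrightarrow> norm x \<le> R" "R > 0"
    using compact_imp_bounded[OF compact_Un[OF K.compact L.compact]] by (auto simp: bounded_pos)
  \<comment> \<open>On a bounded set any bound for \<open>f\<close> can be traded for a Gaussian bound.\<close>
  define C where "C = M * exp (R\<^sup>2)"
  have dom: "f x \<le> C * exp (- (norm x)\<^sup>2)" if "x \<in> K \<union> L" for x
  proof -
    have "1 \<le> exp (R\<^sup>2) * exp (- (norm x)\<^sup>2)" using power_mono[OF R(1)[OF that], of 2] by (simp flip: exp_add)
    then have "M * 1 \<le> M * (exp (R\<^sup>2) * exp (- (norm x)\<^sup>2))" using M(2) by (intro mult_left_mono) auto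
    then show ?thesis using M(1)[OF that] by (simp add: C_def)
  qed
  have C: "C \<ge> 0" using M(2) by (simp add: C_def)
  have part: "\<bar>indicator D x * f x\<bar> \<le> C * exp (- (norm x)\<^sup>2)" if "D = K \<or> D = L" for D x
    using dom[of x] f_pos[of x] that C by (auto simp: indicator_def)
  have int: "integrable lborel (\<lambda>x. indicator D x * f x)" if D: "D = K \<or> D = L" for D
  proof (rule Bochner_Integration.integrable_bound[OF integrable_mult_right[OF integrable_gauss_space, of C]])
    have [measurable]: "D \<in> sets borel" using D by auto
    show "(\<lambda>x. indicator D x * f x) \<in> borel_measurable lborel" by measurable
  qed (use part[OF D] C in auto)
  have inth: "integrable (hyperplane_measure \<zeta>) (\<lambda>x. indicator D x * f x)" if D: "D = K \<or> D = L" and \<zeta>: "norm \<zeta> = 1" for D \<zeta>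
  proof (rule Bochner_Integration.integrable_bound[OF integrable_mult_right[OF integrable_gauss_hyperplane(1)[OF \<zeta>], of C]])
    have [measurable]: "D \<in> sets borel" using D by auto
    show "(\<lambda>x. indicator D x * f x) \<in> borel_measurable (hyperplane_measure \<zeta>)" by measurable
  qed (use part[OF D] C in auto)
  have sec: "mu_section f D (complex_hyperplane \<zeta>) = (\<integral>h. indicator D h * f h \<partial>hyperplane_measure \<zeta>)" if D: "D = K \<or> D = L" for D \<zeta>
    by (rule mu_section_hyperplane) (use D in auto)
  define \<Phi> where "\<Phi> z = indicator L z * f z - indicator K z * f z" for z
  have [measurable]: "\<Phi> \<in> borel_measurable borel" unfolding \<Phi>_def by measurable
  have \<Phi>_bd: "\<bar>\<Phi> z\<bar> \<le> C * exp (- (norm z)\<^sup>2)" for z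
    using dom[of z] f_pos[of z] C by (auto simp: \<Phi>_def indicator_def)
  have cont: "AE h in hyperplane_measure \<zeta>. isCont \<Phi> h" if \<zeta>: "norm \<zeta> = 1" for \<zeta>
    using AE_hyperplane_minkowski_neq_1[OF K \<zeta>] AE_hyperplane_minkowski_neq_1[OF L \<zeta>]
  proof eventually_elim
    case (elim h)
    have ind: "isCont (indicator D :: complex ^ 'n \<Rightarrow> real) h" if "minkowski D h \<noteq> 1" "symmetric_body D" for D
    proof -
      interpret D: symmetric_body D by fact
      have op: "open {x. minkowski D x < 1}" "open {x. minkowski D x > 1}"
        using open_Collect_less[OF D.continuous_minkowski continuous_on_const] open_Collect_less[OF continuous_on_const D.continuous_minkowski] by auto
      have "\<forall>\<^sub>F x in nhds h. (indicator D x :: real) = indicator D h"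
      proof (cases "minkowski D h < 1")
        case True
        then have "h \<in> D" by (simp flip: D.minkowski_le_1_iff)
        moreover have "\<forall>\<^sub>F x in nhds h. x \<in> {x. minkowski D x < 1}" using True op(1) by (intro eventually_nhds_in_open) auto
        then have "\<forall>\<^sub>F x in nhds h. x \<in> D" by (rule eventually_mono) (simp flip: D.minkowski_le_1_iff)
        ultimately show ?thesis by (auto elim!: eventually_mono)
      next
        case False
        then have h: "minkowski D h > 1" using that(1) by simp
        then have "h \<notin> D" by (simp flip: D.minkowski_le_1_iff)
        moreover have "\<forall>\<^sub>F x in nhds h. x \<in> {x. minkowski D x > 1}" using h op(2) by (intro eventually_nhds_in_open) auto
        then have "\<forall>\<^sub>F x in nhds h. x \<notin> D" by (rule eventually_mono) (simp flip: D.minkowski_le_1_iff)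
        ultimately show ?thesis by (auto elim!: eventually_mono)
      qed
      then show ?thesis by (subst isCont_cong) auto
    qed
    have "isCont f h" using f by (simp add: continuous_on_eq_continuous_at)
    then show ?case unfolding \<Phi>_def
      using ind[OF elim(1) K.symmetric_body_axioms] ind[OF elim(2) L.symmetric_body_axioms] by (intro continuous_intros)
  qed
  have \<Phi>_sec: "0 \<le> (\<integral>h. \<Phi> h \<partial>hyperplane_measure \<zeta>)" if \<zeta>: "norm \<zeta> = 1" for \<zeta>
    using sections[of \<zeta>] \<zeta> inth[OF _ \<zeta>, of K] inth[OF _ \<zeta>, of L] by (simp add: \<Phi>_def sec)
  have \<Phi>_int: "integrable lborel \<Phi>" unfolding \<Phi>_def using int[of K] int[of L] by simp
  have mu: "mu f L - mu f K = (\<integral>z. \<Phi> z \<partial>lborel)"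
    using int[of K] int[of L] by (simp add: mu_def set_lebesgue_integral_def \<Phi>_def)
  note W = weighted_volume_nonneg[OF n K inv _ \<Phi>_bd cont \<Phi>_sec]
  have "0 \<le> (\<integral>z. \<Phi> z / (minkowski K z)\<^sup>2 \<partial>lborel)" by (rule W(1)) auto
  also have "\<dots> \<le> (\<integral>z. \<Phi> z \<partial>lborel)"
  proof (rule integral_mono)
    show "integrable lborel (\<lambda>z. \<Phi> z / (minkowski K z)\<^sup>2)" by (rule W(2)) auto
    fix z :: "complex ^ 'n"
    show "\<Phi> z / (minkowski K z)\<^sup>2 \<le> \<Phi> z"
    proof (cases "z = 0")
      case True
      then show ?thesis by (simp add: \<Phi>_def K.zero_mem L.zero_mem)
    next
      case False
      have g: "minkowski K z > 0" using K.minkowski_pos[OF False] .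
      show ?thesis
      proof (cases "z \<in> K")
        case True
        then have "(minkowski K z)\<^sup>2 \<le> 1" using g by (simp add: K.minkowski_le_1_iff power_le_one)
        moreover have "\<Phi> z \<le> 0" using True f_pos[of z] by (auto simp: \<Phi>_def indicator_def)
        ultimately show ?thesis using g mult_left_mono_neg[of "(minkowski K z)\<^sup>2" 1 "\<Phi> z"] by (simp add: divide_le_eq)
      next
        case False
        then have "1 \<le> (minkowski K z)\<^sup>2" using K.minkowski_le_1_iff[of z] by (simp add: one_le_power)
        moreover have "\<Phi> z \<ge> 0" using False f_pos[of z] by (auto simp: \<Phi>_def indicator_def)
        ultimately show ?thesis using g mult_left_mono[of 1 "(minkowski K z)\<^sup>2" "\<Phi> z"] by (simp add: divide_le_eq)
      qed
    qed
  qed (rule \<Phi>_int)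
  finally show ?thesis using mu by simp
qed

section \<open>Bodies of revolution\<close>

text \<open>
  In terms of \<open>a = \<bar>\<langle>x, e\<rangle>\<bar>\<^sup>2\<close> and \<open>b = \<bar>x\<bar>\<^sup>2 -
  a\<close> the body is \<open>{a \<le> A, b + C a \<le> B}\<close>: a cylinder for \<open>C = 0\<close>, a
  truncated ellipsoid for \<open>C > 0\<close>.
\<close>

definition revolution_body :: "complex ^ 'n \<Rightarrow> real \<Rightarrow> real \<Rightarrow> real \<Rightarrow> (complex ^ 'n) set" where
  "revolution_body e A B C =
     {x. (cmod (hprod x e))\<^sup>2 \<le> A \<and> (norm x)\<^sup>2 - (cmod (hprod x e))\<^sup>2 + C * (cmod (hprod x e))\<^sup>2 \<le> B}"

lemma measurable_revolution_body [measurable]: "revolution_body e A B C \<in> sets borel"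
  unfolding revolution_body_def by measurable

lemma power2_norm_le_iff: "(norm x)\<^sup>2 \<le> r \<longleftrightarrow> norm x \<le> sqrt r"
  by (metis abs_norm_cancel real_sqrt_abs real_sqrt_le_iff)

lemma revolution_body_norm_le:
  assumes "C \<ge> 0" "x \<in> revolution_body e A B C"
  shows "(norm x)\<^sup>2 \<le> A + B"
proof -
  have "0 \<le> C * (cmod (hprod x e))\<^sup>2" using assms(1) by simp
  then show ?thesis using assms(2) unfolding revolution_body_def by clarsimp
qed

lemma origin_symmetric_revolution_body:
  assumes e: "norm e = 1" and A: "A > 0" and B: "B > 0" and C: "C \<ge> 0"
  shows "origin_symmetric_convex_body (revolution_body e A B C)"
proof -
  \<comment> \<open>The body is an intersection of preimages of balls under linear maps: \<open>\<bar>T x\<bar>\<^sup>2 = b +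
    C a\<close>.\<close>
  let ?T = "\<lambda>x. hproj e x + (of_real (sqrt C) * hprod x e) *s e"
  have lin: "linear ?T"
    by (rule linearI)
       (simp_all add: hproj_def hprod_add_left hprod_scaleR_left vec_eq_iff algebra_simps scaleR_conv_of_real[where 'a = complex])
  have lin': "linear (\<lambda>x. hprod x e)"
    by (rule linearI) (simp_all add: hprod_add_left hprod_scaleR_left scaleR_conv_of_real[where 'a = complex])
  have eq: "revolution_body e A B C = (\<lambda>x. hprod x e) -` cball 0 (sqrt A) \<inter> ?T -` cball 0 (sqrt B)"
  proof -
    have "(norm (?T x))\<^sup>2 = (norm x)\<^sup>2 - (cmod (hprod x e))\<^sup>2 + C * (cmod (hprod x e))\<^sup>2" for x
      using norm_add_smult[OF e hprod_hproj[OF e]] norm_hproj[OF e] C by (simp add: norm_mult power_mult_distrib)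
    then have "norm (?T x) \<le> sqrt B \<longleftrightarrow> (norm x)\<^sup>2 - (cmod (hprod x e))\<^sup>2 + C * (cmod (hprod x e))\<^sup>2 \<le> B" for x
      by (metis power2_norm_le_iff)
    moreover have "cmod (hprod x e) \<le> sqrt A \<longleftrightarrow> (cmod (hprod x e))\<^sup>2 \<le> A" for x
      by (metis power2_norm_le_iff)
    ultimately show ?thesis by (auto simp: revolution_body_def)
  qed
  have "convex (revolution_body e A B C)"
    unfolding eq by (intro convex_Int convex_linear_vimage lin lin' convex_cball)
  moreover have "closed (revolution_body e A B C)"
    unfolding eq using lin lin'
    by (intro closed_Int closed_vimage linear_continuous_on linear_linear[THEN iffD2] closed_cball) (auto simp: linear_conv_bounded_linear)
  moreover have "bounded (revolution_body e A B C)"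
    unfolding bounded_iff
    by (intro exI[of _ "sqrt (A + B)"] ballI, subst power2_norm_le_iff[symmetric]) (rule revolution_body_norm_le[OF C])
  moreover have "interior (revolution_body e A B C) \<noteq> {}"
  proof -
    define r where "r = min A (B / (1 + C))"
    have "r \<le> B / (1 + C)" by (simp add: r_def)
    then have r: "r > 0" "r \<le> A" "(1 + C) * r \<le> B" using A B C by (auto simp: r_def le_divide_eq mult.commute)
    have "cball 0 (sqrt r) \<subseteq> revolution_body e A B C"
    proof
      fix x :: "complex ^ 'a" assume "x \<in> cball 0 (sqrt r)"
      then have x: "(norm x)\<^sup>2 \<le> r" by (simp add: power2_norm_le_iff)
      have h: "(cmod (hprod x e))\<^sup>2 \<le> (norm x)\<^sup>2" using power_mono[OF cmod_hprod_le[of x e], of 2] e by simp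
      have hr: "(cmod (hprod x e))\<^sup>2 \<le> r" using x h by linarith
      have "C * (cmod (hprod x e))\<^sup>2 \<le> C * r" using hr C by (rule mult_left_mono)
      moreover have "(norm x)\<^sup>2 - (cmod (hprod x e))\<^sup>2 \<le> r" using x zero_le_power2[of "cmod (hprod x e)"] by linarith
      ultimately show "x \<in> revolution_body e A B C"
        using hr r unfolding revolution_body_def by (simp add: algebra_simps)
    qed
    then have "0 \<in> interior (revolution_body e A B C)"
      using r(1) unfolding mem_interior_cball by (intro exI[of _ "sqrt r"]) auto
    then show ?thesis by blast
  qed
  moreover have "uminus ` revolution_body e A B C = revolution_body e A B C"
  proof -
    have "- x \<in> revolution_body e A B C" if "x \<in> revolution_body e A B C" for x
      using that by (simp add: revolution_body_def hprod_minus_left)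
    then show ?thesis by (force intro: image_eqI[of _ uminus "- _"])
  qed
  ultimately show ?thesis by (simp add: origin_symmetric_convex_body_def compact_eq_bounded_closed)
qed

lemma rotation_invariant_revolution_body: "rotation_invariant (revolution_body e A B C)"
proof -
  have rot: "rotate_all \<theta> x = cis \<theta> *s x" for \<theta> and x :: "complex ^ 'a" by (simp add: rotate_all_def vec_eq_iff)
  have mem: "cis \<theta> *s x \<in> revolution_body e A B C \<longleftrightarrow> x \<in> revolution_body e A B C" for \<theta> x
    by (simp add: revolution_body_def hprod_scale_left norm_mult norm_smult)
  have "rotate_all \<theta> ` revolution_body e A B C = revolution_body e A B C" for \<theta>
  proof (intro subset_antisym subsetI)
    fix x assume x: "x \<in> revolution_body e A B C"
    have "x = rotate_all \<theta> (cis (- \<theta>) *s x)"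
      unfolding rot vector_smult_assoc by (simp add: cis_mult)
    then show "x \<in> rotate_all \<theta> ` revolution_body e A B C" using mem[of "- \<theta>" x] x by blast
  qed (auto simp: rot mem)
  then show ?thesis by (simp add: rotation_invariant_def)
qed

lemma emeasure_basis_measure_ball:
  assumes B: "orthonormal_basis_of H B" and k: "card B = 2 * k" "k > 0"
  shows "emeasure (basis_measure B) {y. (norm y)\<^sup>2 \<le> \<rho>} = ennreal (unit_ball_vol (2 * k)) * ennreal ((max 0 \<rho>) ^ k)"
proof -
  have pos: "emeasure (basis_measure B) {y. (norm y)\<^sup>2 \<le> r} = ennreal (unit_ball_vol (2 * k)) * ennreal (r ^ k)" if r: "r > 0" for r
  proof -
    have "{y. (norm y)\<^sup>2 \<le> r} = cball (0 :: 'a) (sqrt r)"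
      by (simp add: power2_norm_le_iff cball_def)
    moreover have "sqrt r ^ (2 * k) = r ^ k" using r by (simp add: power_mult)
    ultimately show ?thesis using emeasure_basis_measure_cball[OF B, of "sqrt r"] r k by (simp add: ennreal_mult')
  qed
  consider "\<rho> < 0" | "\<rho> = 0" | "\<rho> > 0" by linarith
  then show ?thesis
  proof cases
    case 1
    then have "{y :: 'a. (norm y)\<^sup>2 \<le> \<rho>} = {}" by (auto simp: not_le intro: less_le_trans)
    then show ?thesis using 1 k by (simp add: zero_power)
  next
    case 2
    have "emeasure (basis_measure B) {y. (norm y)\<^sup>2 \<le> \<rho>} \<le> 0"
    proof (rule ennreal_le_epsilon)
      fix d :: real assume d: "d > 0"
      let ?v = "unit_ball_vol (2 * k)"
      define r where "r = min 1 (d / ?v)"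
      have v: "?v > 0" by (rule unit_ball_vol_pos) simp
      have r: "r > 0" "r \<le> 1" "?v * r \<le> d" using d v by (auto simp: r_def min_def field_simps)
      have "emeasure (basis_measure B) {y. (norm y)\<^sup>2 \<le> \<rho>} \<le> emeasure (basis_measure B) {y. (norm y)\<^sup>2 \<le> r}"
        using 2 r by (intro emeasure_mono) auto
      also have "\<dots> = ennreal (?v * r ^ k)" using pos[OF r(1)] v r by (simp add: ennreal_mult')
      also have "\<dots> \<le> ennreal (?v * r)"
        using v r power_decreasing[of 1 k r] k by (intro ennreal_leI mult_left_mono) auto
      also have "\<dots> \<le> ennreal d" using r by (intro ennreal_leI)
      finally show "emeasure (basis_measure B) {y. (norm y)\<^sup>2 \<le> \<rho>} \<le> 0 + ennreal d" by simp
    qed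
    then show ?thesis using 2 k by (simp add: zero_power)
  next
    case 3
    then show ?thesis using pos by simp
  qed
qed

text \<open>
  The area of \<open>{u. \<bar>u\<bar>\<^sup>2 < r}\<close> is proportional to \<open>r\<close>, so the law of
  \<open>\<bar>u\<bar>\<^sup>2\<close> is a multiple of Lebesgue measure. The proof compares the laws of \<open>-
  \<bar>u\<bar>\<^sup>2\<close>, for which the half-lines \<open>{x<..}\<close> generating the Borel sets are of
  finite measure.
\<close>

lemma nn_integral_complex_radial:
  assumes [measurable]: "F \<in> borel_measurable borel"
  shows "(\<integral>\<^sup>+ u. F ((cmod u)\<^sup>2) \<partial>lborel) = ennreal (unit_ball_vol 2) * (\<integral>\<^sup>+ a. F a * indicator {0..} a \<partial>lborel)"
proof -
  let ?v = "unit_ball_vol 2"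
  have v: "?v > 0" by (rule unit_ball_vol_pos) simp
  let ?M = "distr lborel borel (\<lambda>u :: complex. - (cmod u)\<^sup>2)"
  let ?N = "density lborel (\<lambda>a :: real. ennreal ?v * indicator {..0} a)"
  have N: "emeasure ?N {x<..} = ennreal (?v * max 0 (- x))" for x
  proof -
    have "emeasure ?N {x<..} = (\<integral>\<^sup>+ a. ennreal ?v * indicator {x<..0} a \<partial>lborel)"
      by (subst emeasure_density) (auto intro!: nn_integral_cong simp: indicator_def)
    also have "\<dots> = ennreal ?v * emeasure lborel {x<..0}" by (rule nn_integral_cmult_indicator) auto
    also have "\<dots> = ennreal (?v * max 0 (- x))"
      using v by (cases "x \<le> 0") (auto simp: ennreal_mult'[symmetric] less_imp_le max_def)
    finally show ?thesis .
  qed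
  have M: "emeasure ?M {x<..} = ennreal (?v * max 0 (- x))" for x
  proof -
    have "emeasure ?M {x<..} = emeasure lborel {u :: complex. (cmod u)\<^sup>2 < - x}"
      by (subst emeasure_distr) (auto intro!: arg_cong2[where f = emeasure])
    also have "\<dots> = ennreal (?v * max 0 (- x))"
    proof (cases "x < 0")
      case True
      have "{u :: complex. (cmod u)\<^sup>2 < - x} = ball 0 (sqrt (- x))"
        using True by (auto simp: real_less_rsqrt) (metis norm_ge_zero real_sqrt_less_iff real_sqrt_unique)
      then show ?thesis using True by (simp add: emeasure_ball)
    next
      case False
      then have "{u :: complex. (cmod u)\<^sup>2 < - x} = {}" by (auto simp: not_less intro: order_trans[of _ 0])
      then show ?thesis using False by simp
    qed
    finally show ?thesis .
  qed
  have MN: "?M = ?N"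
    by (rule measure_eqI_lessThan) (simp_all add: M N)
  have "(\<integral>\<^sup>+ u. F ((cmod u)\<^sup>2) \<partial>lborel) = (\<integral>\<^sup>+ a. F (- a) \<partial>?M)"
    by (subst nn_integral_distr) auto
  also have "\<dots> = (\<integral>\<^sup>+ a. ennreal ?v * (indicator {..0} a * F (- a)) \<partial>lborel)"
    unfolding MN by (subst nn_integral_density) (auto simp: mult_ac)
  also have "\<dots> = ennreal ?v * (\<integral>\<^sup>+ a. indicator {..0} a * F (- a) \<partial>lborel)" by (rule nn_integral_cmult) measurable
  also have "(\<integral>\<^sup>+ a. indicator {..0} a * F (- a) \<partial>lborel) = (\<integral>\<^sup>+ a. F a * indicator {0..} a \<partial>lborel)"
    by (subst nn_integral_real_affine[where c = "-1" and t = 0]) (auto intro!: nn_integral_cong simp: indicator_def)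
  finally show ?thesis .
qed

text \<open>
  The integral of \<open>(B - D a)\<^sub>+\<^sup>k\<close> over \<open>[0, A]\<close>; as a function of
  \<open>a\<close> the integrand is the volume of a slice of a body of revolution, up to a constant.
\<close>

definition profile_integral :: "nat \<Rightarrow> real \<Rightarrow> real \<Rightarrow> real \<Rightarrow> real" where
  "profile_integral k A B D = (\<integral>a. indicator {0..A} a * (max 0 (B - D * a)) ^ k \<partial>lborel)"

lemma integrable_profile: "integrable lborel (\<lambda>a. indicator {0..A} a * (max 0 (B - D * a)) ^ k :: real)"
proof -
  have "continuous_on {0..A} (\<lambda>a. (max 0 (B - D * a)) ^ k)" by (intro continuous_intros)
  from borel_integrable_compact[OF compact_Icc this] show ?thesis by (simp add: indicator_def)
qed

lemma nn_integral_profile: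
  "(\<integral>\<^sup>+ a. ennreal (indicator {0..A} a * (max 0 (B - D * a)) ^ k) \<partial>lborel) = ennreal (profile_integral k A B D)"
  unfolding profile_integral_def by (rule nn_integral_eq_integral[OF integrable_profile]) auto

lemma nn_integral_complex_profile:
  assumes v: "v > 0" and A: "A > 0"
  shows "(\<integral>\<^sup>+ u. indicator {u. v * (cmod u)\<^sup>2 \<le> A} u * ennreal ((max 0 (B - v * D * (cmod u)\<^sup>2)) ^ k) \<partial>lborel) =
    ennreal (unit_ball_vol 2 / v) * ennreal (profile_integral k A B D)"
proof -
  let ?F = "\<lambda>a. indicator {a. v * a \<le> A} a * ennreal ((max 0 (B - v * D * a)) ^ k)"
  have "(\<integral>\<^sup>+ u. indicator {u. v * (cmod u)\<^sup>2 \<le> A} u * ennreal ((max 0 (B - v * D * (cmod u)\<^sup>2)) ^ k) \<partial>lborel) =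
      (\<integral>\<^sup>+ u. ?F ((cmod u)\<^sup>2) \<partial>lborel)" by (simp add: indicator_def)
  also have "\<dots> = ennreal (unit_ball_vol 2) * (\<integral>\<^sup>+ a. ?F a * indicator {0..} a \<partial>lborel)"
    by (rule nn_integral_complex_radial) measurable
  also have "(\<integral>\<^sup>+ a. ?F a * indicator {0..} a \<partial>lborel) =
      ennreal (1 / v) * (\<integral>\<^sup>+ a. ennreal (indicator {0..A} a * (max 0 (B - D * a)) ^ k) \<partial>lborel)"
    using v by (subst nn_integral_real_affine[where c = "1 / v" and t = 0])
      (auto intro!: arg_cong2[where f = "(*)"] nn_integral_cong simp: indicator_def zero_le_divide_iff)
  finally show ?thesis using v by (simp add: nn_integral_profile ennreal_mult'[symmetric] mult.assoc[symmetric] flip: ennreal_mult')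
qed

lemma emeasure_revolution_body:
  fixes e :: "complex ^ 'n"
  assumes e: "norm e = 1" and n: "CARD('n) \<ge> 2" and A: "A > 0"
  shows "emeasure lborel (revolution_body e A B C) =
    ennreal (unit_ball_vol (2 * (CARD('n) - 1)) * unit_ball_vol 2) * ennreal (profile_integral (CARD('n) - 1) A B C)"
proof -
  let ?k = "CARD('n) - 1"
  obtain E where E: "orthonormal_basis_of (complex_hyperplane e) E" "hyperplane_measure e = basis_measure E"
    using subspace_lborel_basis[OF subspace_complex_hyperplane] by metis
  have "emeasure lborel (revolution_body e A B C) = (\<integral>\<^sup>+ x. indicator (revolution_body e A B C) x \<partial>lborel)" by simp
  also have "\<dots> = (\<integral>\<^sup>+ u. \<integral>\<^sup>+ h. indicator {u. 1 * (cmod u)\<^sup>2 \<le> A} u * indicator {y. (norm y)\<^sup>2 \<le> B - 1 * C * (cmod u)\<^sup>2} h \<partial>hyperplane_measure e \<partial>lborel)"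
  proof (rule nn_integral_hyperplane_split(1)[OF e])
    fix h u assume h: "hprod h e = 0"
    have "hprod (h + u *s e) e = u" using h e by (simp add: hprod_add_left hprod_scale_left hprod_self)
    then show "indicator (revolution_body e A B C) (h + u *s e) =
        (indicator {u. 1 * (cmod u)\<^sup>2 \<le> A} u * indicator {y. (norm y)\<^sup>2 \<le> B - 1 * C * (cmod u)\<^sup>2} h :: ennreal)"
      using norm_add_smult[OF e h, of u] by (simp add: revolution_body_def indicator_def algebra_simps)
  qed measurable
  also have "\<dots> = (\<integral>\<^sup>+ u. ennreal (unit_ball_vol (2 * ?k)) * (indicator {u. 1 * (cmod u)\<^sup>2 \<le> A} u * ennreal ((max 0 (B - 1 * C * (cmod u)\<^sup>2)) ^ ?k)) \<partial>lborel)"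
    unfolding E(2) using emeasure_basis_measure_ball[OF E(1) card_orthonormal_basis_hyperplane[OF e E(1)]] n
    by (intro nn_integral_cong) (simp add: nn_integral_cmult mult_ac)
  also have "\<dots> = ennreal (unit_ball_vol (2 * ?k)) * (ennreal (unit_ball_vol 2 / 1) * ennreal (profile_integral ?k A B C))"
    by (subst nn_integral_cmult) (simp_all only: nn_integral_complex_profile[OF zero_less_one A], measurable)
  finally show ?thesis by (simp add: ennreal_mult' mult.assoc)
qed

text \<open>
  The section is again a body of revolution, about the projection of \<open>e\<close> to
  \<open>H\<^sub>\<xi>\<close>. A point \<open>y + u \<zeta>\<close> has \<open>a = v
  \<bar>u\<bar>\<^sup>2\<close>, so \<open>b = \<bar>y\<bar>\<^sup>2 + ((1 - v) / v) a\<close>: tilting the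
  hyperplane adds \<open>(1 - v) / v\<close> to the slope \<open>C\<close> and otherwise changes only a constant
  factor.
\<close>

lemma emeasure_revolution_section:
  fixes e \<xi> :: "complex ^ 'n"
  assumes e: "norm e = 1" and \<xi>: "norm \<xi> = 1" and n: "CARD('n) \<ge> 3"
  defines "v \<equiv> 1 - (cmod (hprod e \<xi>))\<^sup>2"
  assumes v: "v > 0" and A: "A > 0"
  shows "emeasure (hyperplane_measure \<xi>) (revolution_body e A B C) =
    ennreal (unit_ball_vol (2 * (CARD('n) - 2)) * (unit_ball_vol 2 / v)) *
    ennreal (profile_integral (CARD('n) - 2) A B (C + (1 - v) / v))"
proof -
  let ?k = "CARD('n) - 2"
  define \<zeta> where "\<zeta> = (1 / sqrt v) *\<^sub>R hproj \<xi> e"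
  have "(norm (hproj \<xi> e))\<^sup>2 = v" using norm_hproj[OF \<xi>, of e] e by (simp add: v_def)
  then have np: "norm (hproj \<xi> e) = sqrt v" by (metis norm_ge_zero real_sqrt_unique)
  have \<zeta>: "norm \<zeta> = 1" using v np by (simp add: \<zeta>_def)
  have \<zeta>\<xi>: "hprod \<zeta> \<xi> = 0" by (simp add: \<zeta>_def hprod_scaleR_left hprod_hproj[OF \<xi>])
  have e_eq: "e = sqrt v *\<^sub>R \<zeta> + hprod e \<xi> *s \<xi>" using v by (simp add: \<zeta>_def hproj_def)
  let ?H = "complex_hyperplane \<xi>"
  have sub: "subspace (?H \<inter> complex_hyperplane \<zeta>)" by (intro subspace_inter subspace_complex_hyperplane)
  obtain V where V: "orthonormal_basis_of (?H \<inter> complex_hyperplane \<zeta>) V" using orthonormal_basis_of_exists[OF sub] by blast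
  have mem: "\<zeta> \<in> ?H" "\<i> *s \<zeta> \<in> ?H" using \<zeta>\<xi> by (simp_all add: mem_complex_hyperplane hprod_scale_left)
  note ext = orthonormal_basis_extend_subspace[OF subspace_complex_hyperplane \<zeta> mem V]
  have fin: "finite V" using V by (simp add: orthonormal_basis_of_def)
  have "card (insert \<zeta> (insert (\<i> *s \<zeta>) V)) = 2 * (CARD('n) - 1)"
    by (rule card_orthonormal_basis_hyperplane[OF \<xi> ext(1)])
  then have card: "card V = 2 * ?k" using ext(2,3) fin by simp
  have AE: "AE y in basis_measure V. hprod y \<xi> = 0 \<and> hprod y \<zeta> = 0"
    using AE_basis_measure_span[of V] V by (simp add: orthonormal_basis_of_def mem_complex_hyperplane)
  let ?D = "C + (1 - v) / v"
  have "emeasure (hyperplane_measure \<xi>) (revolution_body e A B C) =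
      (\<integral>\<^sup>+ x. indicator (revolution_body e A B C) x \<partial>basis_measure (insert \<zeta> (insert (\<i> *s \<zeta>) V)))"
    unfolding hyperplane_measure_eq_basis_measure[OF \<xi> ext(1)] by (subst nn_integral_indicator) auto
  also have "\<dots> = (\<integral>\<^sup>+ u. \<integral>\<^sup>+ y. indicator (revolution_body e A B C) (y + u *s \<zeta>) \<partial>basis_measure V \<partial>lborel)"
    by (rule nn_integral_basis_measure_extend[OF V ext(2,3)]) measurable
  also have "\<dots> = (\<integral>\<^sup>+ u. \<integral>\<^sup>+ y. indicator {u. v * (cmod u)\<^sup>2 \<le> A} u * indicator {y. (norm y)\<^sup>2 \<le> B - v * ?D * (cmod u)\<^sup>2} y \<partial>basis_measure V \<partial>lborel)"
  proof (rule nn_integral_cong, rule nn_integral_cong_AE)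
    fix u :: complex
    show "AE y in basis_measure V. (indicator (revolution_body e A B C) (y + u *s \<zeta>) :: ennreal) =
      indicator {u. v * (cmod u)\<^sup>2 \<le> A} u * indicator {y. (norm y)\<^sup>2 \<le> B - v * ?D * (cmod u)\<^sup>2} y"
      using AE
    proof eventually_elim
      case (elim y)
      have "hprod (y + u *s \<zeta>) e = of_real (sqrt v) * u"
        using elim \<zeta> \<zeta>\<xi>
        by (subst e_eq) (simp add: hprod_add_left hprod_add_right hprod_scaleR_right hprod_scale_right hprod_scale_left hprod_self)
      then have 1: "(cmod (hprod (y + u *s \<zeta>) e))\<^sup>2 = v * (cmod u)\<^sup>2"
        using v by (simp add: norm_mult power_mult_distrib)
      have 2: "(norm (y + u *s \<zeta>))\<^sup>2 = (norm y)\<^sup>2 + (cmod u)\<^sup>2" using elim by (intro norm_add_smult \<zeta>) simp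
      have 3: "v * ?D * (cmod u)\<^sup>2 = (cmod u)\<^sup>2 - v * (cmod u)\<^sup>2 + C * (v * (cmod u)\<^sup>2)" using v by (simp add: field_simps)
      show ?case unfolding revolution_body_def 3 by (auto simp: indicator_def 1 2)
    qed
  qed
  also have "\<dots> = (\<integral>\<^sup>+ u. ennreal (unit_ball_vol (2 * ?k)) * (indicator {u. v * (cmod u)\<^sup>2 \<le> A} u * ennreal ((max 0 (B - v * ?D * (cmod u)\<^sup>2)) ^ ?k)) \<partial>lborel)"
    using emeasure_basis_measure_ball[OF V card] n
    by (intro nn_integral_cong) (simp add: nn_integral_cmult mult_ac)
  finally have "emeasure (hyperplane_measure \<xi>) (revolution_body e A B C) =
      ennreal (unit_ball_vol (2 * ?k)) * (ennreal (unit_ball_vol 2 / v) * ennreal (profile_integral ?k A B ?D))"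
    by (subst (asm) nn_integral_cmult) (simp_all only: nn_integral_complex_profile[OF v A], measurable)
  moreover have "ennreal (unit_ball_vol (2 * ?k) * (unit_ball_vol 2 / v)) = ennreal (unit_ball_vol (2 * ?k)) * ennreal (unit_ball_vol 2 / v)"
    by (rule ennreal_mult') simp
  ultimately show ?thesis by (simp only: mult.assoc)
qed

text \<open>
  The hyperplane orthogonal to the axis, where \<open>v = 0\<close>: the section is a ball.
\<close>

lemma emeasure_revolution_section_parallel:
  fixes e \<xi> :: "complex ^ 'n"
  assumes e: "norm e = 1" and \<xi>: "norm \<xi> = 1" and n: "CARD('n) \<ge> 2"
    and v: "(cmod (hprod e \<xi>))\<^sup>2 = 1" and A: "A > 0"
  shows "emeasure (hyperplane_measure \<xi>) (revolution_body e A B C) =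
    ennreal (unit_ball_vol (2 * (CARD('n) - 1))) * ennreal ((max 0 B) ^ (CARD('n) - 1))"
proof -
  have "(norm (hproj \<xi> e))\<^sup>2 = 0" using norm_hproj[OF \<xi>, of e] e v by simp
  then have e_eq: "e = hprod e \<xi> *s \<xi>" by (simp add: hproj_def)
  obtain E where E: "orthonormal_basis_of (complex_hyperplane \<xi>) E" "hyperplane_measure \<xi> = basis_measure E"
    using subspace_lborel_basis[OF subspace_complex_hyperplane] by metis
  have "emeasure (hyperplane_measure \<xi>) (revolution_body e A B C) = emeasure (hyperplane_measure \<xi>) {y. (norm y)\<^sup>2 \<le> B}"
  proof (rule emeasure_eq_AE)
    show "AE y in hyperplane_measure \<xi>. y \<in> revolution_body e A B C \<longleftrightarrow> y \<in> {y. (norm y)\<^sup>2 \<le> B}"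
      using AE_hyperplane_measure[of \<xi>]
    proof eventually_elim
      case (elim y)
      then have "hprod y e = 0" by (subst e_eq) (simp add: hprod_scale_right)
      then show ?case using A by (simp add: revolution_body_def)
    qed
  qed auto
  then show ?thesis
    unfolding E(2) using emeasure_basis_measure_ball[OF E(1) card_orthonormal_basis_hyperplane[OF \<xi> E(1)]] n by simp
qed

section \<open>A perturbation of the cylinder\<close>

text \<open>
  The graph of the convex function \<open>x \<mapsto> x\<^sub>+\<^sup>m\<close> lies above its tangents. This
  makes first variations into lower bounds.
\<close>

lemma power_positive_part_tangent:
  fixes x y :: real
  assumes m: "m \<ge> 2"
  shows "(max 0 x) ^ m + real m * (max 0 x) ^ (m - 1) * (y - x) \<le> (max 0 y) ^ m"
proof (cases "x \<le> 0")
  case True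
  then show ?thesis using m by (simp add: max_def zero_power)
next
  case False
  then have x: "x > 0" by simp
  have xm: "x ^ m = x * x ^ (m - 1)" using m by (cases m) auto
  show ?thesis
  proof (cases "y \<ge> 0")
    case True
    have "1 + real m * (y / x - 1) \<le> (1 + (y / x - 1)) ^ m"
      using x True by (intro Bernoulli_inequality) (simp add: field_simps)
    then have "x ^ m * (1 + real m * (y / x - 1)) \<le> x ^ m * (y / x) ^ m"
      using x by (intro mult_left_mono) auto
    moreover have "x ^ m * (y / x) ^ m = y ^ m" using x by (simp add: power_divide)
    ultimately have "x ^ m * (1 + real m * (y / x - 1)) \<le> y ^ m" by simp
    moreover have "x ^ m * (1 + real m * (y / x - 1)) = x ^ m + real m * x ^ (m - 1) * (x * (y / x - 1))"
      unfolding xm by (simp add: algebra_simps)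
    moreover have "x * (y / x - 1) = y - x" using x by (simp add: right_diff_distrib)
    ultimately have "x ^ m + real m * x ^ (m - 1) * (y - x) \<le> y ^ m" by simp
    then show ?thesis using x True by (simp add: max_def)
  next
    case False
    have "x + real m * (y - x) \<le> x + 2 * (y - x)" using mult_right_mono_neg[of 2 "real m" "y - x"] m False x by simp
    also have "\<dots> \<le> 0" using False x by simp
    finally have "x ^ (m - 1) * (x + real m * (y - x)) \<le> 0" using x by (intro mult_nonneg_nonpos) auto
    then show ?thesis using x False m by (simp add: max_def xm algebra_simps zero_power)
  qed
qed

lemma profile_integral_nonneg: "0 \<le> profile_integral k A B D"
  unfolding profile_integral_def by (rule Bochner_Integration.integral_nonneg) auto

lemma profile_integral_scale:
  assumes t: "t > 0"
  shows "profile_integral k (t * A) (t * B) D = t ^ (k + 1) * profile_integral k A B D"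
proof -
  have "profile_integral k (t * A) (t * B) D = t * (\<integral>a. indicator {0..t * A} (t * a) * (max 0 (t * B - D * (t * a))) ^ k \<partial>lborel)"
    unfolding profile_integral_def using t by (subst lborel_integral_real_affine[where c = t and t = 0]) auto
  also have "(\<lambda>a. indicator {0..t * A} (t * a) * (max 0 (t * B - D * (t * a))) ^ k) = (\<lambda>a. t ^ k * (indicator {0..A} a * (max 0 (B - D * a)) ^ k))"
  proof
    fix a
    have "t * B - D * (t * a) = t * (B - D * a)" by (simp add: algebra_simps)
    then have "max 0 (t * B - D * (t * a)) = t * max 0 (B - D * a)"
      using t by (simp add: max_def zero_le_mult_iff)
    then show "indicator {0..t * A} (t * a) * (max 0 (t * B - D * (t * a))) ^ k = t ^ k * (indicator {0..A} a * (max 0 (B - D * a)) ^ k)"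
      using t by (auto simp: indicator_def power_mult_distrib zero_le_mult_iff)
  qed
  finally show ?thesis by (simp add: profile_integral_def)
qed

lemma profile_integral_unit:
  assumes A: "A > 0"
  shows "profile_integral k A B D = A * profile_integral k 1 B (D * A)"
proof -
  have "profile_integral k A B D = A * (\<integral>a. indicator {0..A} (A * a) * (max 0 (B - D * (A * a))) ^ k \<partial>lborel)"
    unfolding profile_integral_def using A by (subst lborel_integral_real_affine[where c = A and t = 0]) auto
  also have "(\<lambda>a. indicator {0..A} (A * a) * (max 0 (B - D * (A * a))) ^ k) = (\<lambda>a. indicator {0..1} a * (max 0 (B - D * A * a)) ^ k)"
    using A by (auto simp: indicator_def zero_le_mult_iff mult.assoc)
  finally show ?thesis by (simp add: profile_integral_def)
qed

text \<open>
  A Chebyshev sum: the weights \<open>m - 1 - 2 i\<close> are decreasing in \<open>i\<close> with total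
  \<open>0\<close>, and \<open>q\<^sup>i\<close> is decreasing as well. The second statement quantifies the gain.
\<close>

lemma weighted_power_sum_nonneg:
  fixes q :: real
  assumes q: "0 \<le> q" "q \<le> 1"
  shows "0 \<le> (\<Sum>i<m. (real m - 1 - 2 * real i) * q ^ i)"
    and "m \<ge> 1 \<Longrightarrow> 1 - q ^ m \<le> (\<Sum>i<Suc m. (real (Suc m) - 1 - 2 * real i) * q ^ i)"
proof -
  let ?c = "\<lambda>m. \<Sum>i<m. (real m - 1 - 2 * real i) * q ^ i"
  have step: "?c (Suc m) = ?c m + (\<Sum>i<m. q ^ i - q ^ m)" for m
    by (simp add: sum_subtractf algebra_simps sum.distrib)
  have le: "q ^ m \<le> q ^ i" if "i < m" for i m using q that by (intro power_decreasing) auto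
  show nonneg: "0 \<le> ?c m" for m
  proof (induction m)
    case (Suc m)
    have "0 \<le> (\<Sum>i<m. q ^ i - q ^ m)" using le by (intro sum_nonneg) auto
    then show ?case using Suc step[of m] by simp
  qed simp
  show "1 - q ^ m \<le> ?c (Suc m)" if "m \<ge> 1"
  proof -
    have "1 - q ^ m = (\<Sum>i\<in>{0}. q ^ i - q ^ m)" by simp
    also have "\<dots> \<le> (\<Sum>i<m. q ^ i - q ^ m)" using le that by (intro sum_mono2) auto
    finally show ?thesis using nonneg[of m] step[of m] by linarith
  qed
qed

lemma power_sum_identities:
  fixes q :: real
  shows "(1 - q) * (\<Sum>i<m. q ^ i) = 1 - q ^ m"
    and "(1 - q)\<^sup>2 * (\<Sum>i<m. real i * q ^ i) = q - real m * q ^ m + (real m - 1) * q ^ (m + 1)"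
proof -
  show "(1 - q) * (\<Sum>i<m. q ^ i) = 1 - q ^ m" by (simp add: one_diff_power_eq)
  show "(1 - q)\<^sup>2 * (\<Sum>i<m. real i * q ^ i) = q - real m * q ^ m + (real m - 1) * q ^ (m + 1)"
    by (induction m) (auto simp: algebra_simps power2_eq_square)
qed

text \<open>
  The polynomial is \<open>(1 - q)\<^sup>2\<close> times \<open>\<alpha> q\<^sup>m + (c - 1) S - W\<close>, where
  \<open>S\<close> and \<open>W\<close> are the sums of \<open>q\<^sup>i\<close> and \<open>i q\<^sup>i\<close>
  over \<open>i < m\<close>. For \<open>\<tau> = 0\<close> the second factor would be half of the Chebyshev sum
  \<open>(m - 1) S - 2 W\<close>. The terms with \<open>\<tau>\<close> lower it by at most \<open>\<tau> m (1 -
  q\<^sup>m)\<close>, which the margin of the Chebyshev sum covers because \<open>\<tau> = 1 / (4 m)\<close>.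
\<close>

lemma section_polynomial_nonneg:
  fixes q :: real
  assumes m: "m \<ge> 2" and q: "0 \<le> q" "q \<le> 1"
  defines "\<tau> \<equiv> 1 / (4 * real m)"
  defines "\<alpha> \<equiv> \<tau> * (real m + 1 / 2)" and "c \<equiv> (real m + 1) / 2 - \<tau>"
  shows "0 \<le> \<alpha> * (1 - q)\<^sup>2 * q ^ m + (1 - q) * (c - (c - (real m + 1)) * q ^ m) - (1 - q ^ (m + 1))"
proof -
  define S where "S = (\<Sum>i<m. q ^ i)"
  define W where "W = (\<Sum>i<m. real i * q ^ i)"
  have S: "(1 - q) * S = 1 - q ^ m" unfolding S_def by (rule power_sum_identities)
  have W: "(1 - q)\<^sup>2 * W = q - real m * q ^ m + (real m - 1) * q ^ (m + 1)" unfolding W_def by (rule power_sum_identities)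
  have "\<alpha> * (1 - q)\<^sup>2 * q ^ m + (1 - q) * (c - (c - (real m + 1)) * q ^ m) - (1 - q ^ (m + 1)) =
      (1 - q)\<^sup>2 * (\<alpha> * q ^ m) + (c - 1) * (1 - q) * (1 - q ^ m) - (q - real m * q ^ m + (real m - 1) * q ^ (m + 1))"
    by (simp add: algebra_simps)
  also have "\<dots> = (1 - q)\<^sup>2 * (\<alpha> * q ^ m + (c - 1) * S - W)"
    unfolding S[symmetric] W[symmetric] by (simp add: algebra_simps power2_eq_square)
  finally have eq: "\<alpha> * (1 - q)\<^sup>2 * q ^ m + (1 - q) * (c - (c - (real m + 1)) * q ^ m) - (1 - q ^ (m + 1)) =
    (1 - q)\<^sup>2 * (\<alpha> * q ^ m + (c - 1) * S - W)" .
  obtain k where k: "m = Suc k" "k \<ge> 1" using m by (cases m) auto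
  have c1: "1 - q ^ k \<le> (real m - 1) * S - 2 * W"
  proof -
    have "(\<Sum>i<m. (real m - 1 - 2 * real i) * q ^ i) = (real m - 1) * S - 2 * W"
      by (simp add: S_def W_def sum_distrib_left left_diff_distrib sum_subtractf mult.assoc)
    then show ?thesis using weighted_power_sum_nonneg(2)[OF q k(2)] k(1) by simp
  qed
  have S_le: "S - real m * q ^ m \<le> real m * (1 - q ^ m)"
  proof -
    have "S \<le> (\<Sum>i<m. 1)" unfolding S_def using q by (intro sum_mono power_le_one)
    then show ?thesis by (simp add: algebra_simps)
  qed
  have "1 - q ^ m \<le> 2 * (1 - q ^ k)"
  proof -
    have "q ^ k \<le> q" using q k(2) power_decreasing[of 1 k q] by simp
    moreover have "q ^ k * (1 - q) \<le> 1 * (1 - q)" using q by (intro mult_right_mono power_le_one) auto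
    ultimately show ?thesis by (simp add: k(1) algebra_simps)
  qed
  have \<tau>: "\<tau> > 0" "\<tau> * real m = 1 / 4" using m by (auto simp: \<tau>_def)
  define X where "X = \<tau> * (S - real m * q ^ m)"
  define Y where "Y = (real m - 1) * S - 2 * W"
  define Z where "Z = \<tau> * (q ^ m / 2)"
  have "\<alpha> * q ^ m + (c - 1) * S - W = Z - X + Y / 2"
    by (simp add: X_def Y_def Z_def \<alpha>_def c_def field_simps)
  moreover have "X \<le> (1 - q ^ m) / 4"
    unfolding X_def using mult_left_mono[OF S_le less_imp_le[OF \<tau>(1)]] \<tau>(2) by (simp add: mult.assoc[symmetric])
  moreover have "0 \<le> Z" using \<tau> q by (simp add: Z_def)
  moreover have "1 - q ^ k \<le> Y" using c1 by (simp add: Y_def)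
  moreover have "Y / 2 - X + Z \<ge> 0" if "X \<le> (1 - q ^ m) / 4" "0 \<le> Z" "1 - q ^ k \<le> Y"
    using that \<open>1 - q ^ m \<le> 2 * (1 - q ^ k)\<close> by (simp add: field_simps)
  ultimately have "0 \<le> \<alpha> * q ^ m + (c - 1) * S - W" by simp
  then show ?thesis unfolding eq by simp
qed

text \<open>
  The cylinder \<open>A = B = 1, C = 0\<close> is deformed into the body with \<open>A = 1 + \<epsilon>
  \<alpha>\<close> whose profile is \<open>1 + \<epsilon> w(a / A)\<close> with \<open>w(a) = c - (m + 1) a = (m +
  1) (1/2 - a) - \<tau>\<close>. After rescaling \<open>a\<close> to \<open>[0, 1]\<close>, the integral below is
  the derivative at \<open>\<epsilon> = 0\<close> of the section with parameter \<open>\<kappa>\<close>. At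
  \<open>\<kappa> = 0\<close> the mean \<open>- \<tau>\<close> of \<open>w\<close> gives \<open>\<alpha> - m
  \<tau>\<close>, which is positive because \<open>\<alpha> = (m + 1/2) \<tau>\<close>; the first variation of the
  volume will be \<open>\<alpha> - (m + 1) \<tau> < 0\<close>. So \<open>\<alpha> / \<tau>\<close> has to lie
  between the two exponents \<open>m\<close> and \<open>m + 1\<close>. For \<open>\<kappa> > 0\<close> the slices
  near \<open>a = 0\<close>, where \<open>w\<close> is large, weigh more. When \<open>\<kappa> \<ge> 1\<close> the
  claim comes down to \<open>c \<ge> 1\<close>, which would fail for \<open>m = 1\<close>, that is for \<open>n =
  3\<close>.
\<close>

lemma first_variation_section_nonneg:
  fixes \<kappa> :: real
  assumes m: "m \<ge> 2" and \<kappa>: "\<kappa> \<ge> 0"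
  defines "\<tau> \<equiv> 1 / (4 * real m)"
  defines "\<alpha> \<equiv> \<tau> * (real m + 1 / 2)" and "c \<equiv> (real m + 1) / 2 - \<tau>"
  defines "g \<equiv> \<lambda>a. \<alpha> * (max 0 (1 - \<kappa> * a)) ^ m + real m * (max 0 (1 - \<kappa> * a)) ^ (m - 1) * (c - (real m + 1) * a - \<kappa> * \<alpha> * a)"
  shows "0 \<le> (\<integral>a. g a * indicator {0..1} a \<partial>lborel)"
proof (cases "\<kappa> = 0")
  case True
  have \<tau>: "\<tau> > 0" "\<tau> * real m = 1 / 4" using m by (auto simp: \<tau>_def)
  have "(\<integral>a. g a * indicator {0..1} a \<partial>lborel) = (\<integral>a. (\<alpha> + real m * (c - (real m + 1) * a)) * indicator {0..1} a \<partial>lborel)"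
    by (simp add: g_def True)
  also have "\<dots> = (\<alpha> * 1 + real m * (c * 1 - (real m + 1) * 1\<^sup>2 / 2)) - (\<alpha> * 0 + real m * (c * 0 - (real m + 1) * 0\<^sup>2 / 2))"
    by (rule integral_FTC_Icc_real) (auto intro!: derivative_eq_intros continuous_intros)
  also have "\<dots> = \<tau> / 2" by (simp add: \<alpha>_def c_def algebra_simps)
  finally show ?thesis using \<tau> by simp
next
  case False
  then have \<kappa>0: "\<kappa> > 0" using \<kappa> by simp
  define r where "r = min 1 (1 / \<kappa>)"
  have r: "0 \<le> r" "r \<le> 1" using \<kappa>0 by (auto simp: r_def)
  obtain k where k: "m = Suc k" "k \<ge> 1" using m by (cases m) auto
  \<comment> \<open>A primitive of the integrand on the interval \<open>[0, r]\<close>, where the positive part can be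
    dropped.\<close>
  define F where "F a = \<alpha> * a * (1 - \<kappa> * a) ^ m - (c - (real m + 1) * a) * (1 - \<kappa> * a) ^ m / \<kappa> + (1 - \<kappa> * a) ^ (m + 1) / \<kappa>\<^sup>2" for a
  let ?h = "\<lambda>a. \<alpha> * (1 - \<kappa> * a) ^ m + real m * (1 - \<kappa> * a) ^ (m - 1) * (c - (real m + 1) * a - \<kappa> * \<alpha> * a)"
  have eq: "g a * indicator {0..1} a = ?h a * indicator {0..r} a" for a
  proof (cases "a \<le> 1 / \<kappa>")
    case True
    then have "0 \<le> 1 - \<kappa> * a" using \<kappa>0 by (simp add: field_simps)
    then show ?thesis using True by (auto simp: g_def r_def indicator_def max_def)
  next
    case False
    then have "1 - \<kappa> * a < 0" using \<kappa>0 by (simp add: field_simps)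
    then have "g a = 0" using k by (simp add: g_def max_def)
    moreover have "a \<notin> {0..r}" using False by (auto simp: r_def)
    ultimately show ?thesis by simp
  qed
  have dF: "(F has_real_derivative ?h a) (at a)" for a
  proof -
    define X where "X = (1 - \<kappa> * a) ^ m"
    define Y where "Y = (1 - \<kappa> * a) ^ (m - 1)"
    have pw: "((\<lambda>a. (1 - \<kappa> * a) ^ j) has_real_derivative - \<kappa> * (real j * (1 - \<kappa> * a) ^ (j - 1))) (at a)" for j
      by (auto intro!: derivative_eq_intros)
    have d1: "((\<lambda>a. \<alpha> * a * (1 - \<kappa> * a) ^ m) has_real_derivative (\<alpha> * a * (- \<kappa> * (real m * Y)) + \<alpha> * X)) (at a)"
      unfolding X_def Y_def by (rule DERIV_mult'[OF _ pw]) (auto intro!: derivative_eq_intros)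
    have d2: "((\<lambda>a. (c - (real m + 1) * a) * (1 - \<kappa> * a) ^ m / \<kappa>) has_real_derivative
        ((c - (real m + 1) * a) * (- \<kappa> * (real m * Y)) + - (real m + 1) * X) / \<kappa>) (at a)"
      unfolding X_def Y_def by (rule DERIV_cdivide[OF DERIV_mult'[OF _ pw]]) (auto intro!: derivative_eq_intros)
    have d3: "((\<lambda>a. (1 - \<kappa> * a) ^ (m + 1) / \<kappa>\<^sup>2) has_real_derivative - \<kappa> * ((real m + 1) * X) / \<kappa>\<^sup>2) (at a)"
      using DERIV_cdivide[OF pw[of "m + 1"], of "\<kappa>\<^sup>2"] by (simp add: X_def add.commute)
    have "(F has_real_derivative (\<alpha> * a * (- \<kappa> * (real m * Y)) + \<alpha> * X) -
        ((c - (real m + 1) * a) * (- \<kappa> * (real m * Y)) + - (real m + 1) * X) / \<kappa> + - \<kappa> * ((real m + 1) * X) / \<kappa>\<^sup>2) (at a)"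
      unfolding F_def by (intro DERIV_add DERIV_diff d1 d2 d3)
    moreover have "((c - (real m + 1) * a) * (- \<kappa> * (real m * Y)) + - (real m + 1) * X) / \<kappa> =
        - ((c - (real m + 1) * a) * (real m * Y)) - (real m + 1) * X / \<kappa>"
      using \<kappa>0 by (simp add: field_simps)
    moreover have "- \<kappa> * ((real m + 1) * X) / \<kappa>\<^sup>2 = - ((real m + 1) * X / \<kappa>)" using \<kappa>0 by (simp add: power2_eq_square)
    ultimately have "(F has_real_derivative (\<alpha> * a * (- \<kappa> * (real m * Y)) + \<alpha> * X) -
        (- ((c - (real m + 1) * a) * (real m * Y)) - (real m + 1) * X / \<kappa>) + - ((real m + 1) * X / \<kappa>)) (at a)"
      by (simp only:)
    moreover have "(\<alpha> * a * (- \<kappa> * (real m * Y)) + \<alpha> * X) -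
        (- ((c - (real m + 1) * a) * (real m * Y)) - (real m + 1) * X / \<kappa>) + - ((real m + 1) * X / \<kappa>) =
        (\<alpha> * a * (- \<kappa> * (real m * Y)) + \<alpha> * X) + (c - (real m + 1) * a) * (real m * Y)"
      by simp
    moreover have "(\<alpha> * a * (- \<kappa> * (real m * Y)) + \<alpha> * X) + (c - (real m + 1) * a) * (real m * Y) = ?h a"
      unfolding X_def[symmetric] Y_def[symmetric] by (simp add: algebra_simps)
    ultimately show ?thesis by metis
  qed
  have "(\<integral>a. g a * indicator {0..1} a \<partial>lborel) = (\<integral>a. ?h a * indicator {0..r} a \<partial>lborel)"
    by (simp only: eq)
  also have "\<dots> = F r - F 0"
    by (rule integral_FTC_Icc_real[OF r(1) dF]) (intro continuous_intros)
  also have "F 0 = - c / \<kappa> + 1 / \<kappa>\<^sup>2" by (simp add: F_def)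
  also have "F r - (- c / \<kappa> + 1 / \<kappa>\<^sup>2) \<ge> 0"
  proof (cases "\<kappa> \<le> 1")
    case True
    then have r1: "r = 1" using \<kappa>0 by (simp add: r_def)
    \<comment> \<open>Multiplied by \<open>\<kappa>\<^sup>2\<close>, the value of the integral is a polynomial in \<open>1 -
      \<kappa>\<close>.\<close>
    define q where "q = 1 - \<kappa>"
    have q: "0 \<le> q" "q \<le> 1" "\<kappa> = 1 - q" using True \<kappa>0 by (auto simp: q_def)
    have "\<kappa>\<^sup>2 * (F r - (- c / \<kappa> + 1 / \<kappa>\<^sup>2)) = \<alpha> * (1 - q)\<^sup>2 * q ^ m + (1 - q) * (c - (c - (real m + 1)) * q ^ m) - (1 - q ^ (m + 1))"
    proof -
      have "\<kappa>\<^sup>2 * (F r - (- c / \<kappa> + 1 / \<kappa>\<^sup>2)) = \<alpha> * \<kappa>\<^sup>2 * q ^ m + \<kappa> * (c - (c - (real m + 1)) * q ^ m) - (1 - q ^ (m + 1))"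
        unfolding F_def r1 mult_1_right q_def[symmetric] using \<kappa>0 by (simp add: field_simps power2_eq_square)
      then show ?thesis by (simp only: q(3))
    qed
    also have "\<dots> \<ge> 0" using section_polynomial_nonneg[OF m q(1,2)] unfolding \<tau>_def \<alpha>_def c_def .
    finally show ?thesis using \<kappa>0 by (simp add: zero_le_mult_iff)
  next
    case False
    then have "r = 1 / \<kappa>" by (simp add: r_def)
    then have "F r = 0" using \<kappa>0 m by (simp add: F_def zero_power)
    moreover have "1 / \<kappa>\<^sup>2 \<le> c / \<kappa>"
    proof -
      have "\<tau> \<le> 1 / 8" unfolding \<tau>_def using m by (intro divide_left_mono) auto
      moreover have "2 * c = real m + 1 - 2 * \<tau>" by (simp add: c_def)
      moreover have "real m \<ge> 2" using m by simp
      ultimately have "1 \<le> c" by linarith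
      moreover have "1 / \<kappa> \<le> 1" using False by simp
      ultimately have "1 / \<kappa> \<le> c" by (rule order_trans[rotated])
      then have "1 / \<kappa> / \<kappa> \<le> c / \<kappa>" using \<kappa>0 by (intro divide_right_mono) auto
      then show ?thesis by (simp add: power2_eq_square)
    qed
    ultimately show ?thesis by simp
  qed
  finally show ?thesis .
qed

text \<open>
  The tangent inequality bounds the sections of the deformed body below by their linearisation, whose first order
  term is nonnegative, uniformly in \<open>\<kappa>\<close>. The factor \<open>1 - (\<epsilon>
  \<alpha>)\<^sup>2\<close> is \<open>(1 + \<epsilon> \<alpha>) (1 - \<epsilon> \<alpha>)\<close>: the first
  variation \<open>\<alpha>\<close> of the length \<open>A\<close>, counted in \<open>g\<close>, is removed again,
  so that the loss is of second order.
\<close>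

lemma profile_integral_perturbed_ge:
  fixes \<kappa> \<epsilon> :: real
  assumes m: "m \<ge> 2" and \<kappa>: "\<kappa> \<ge> 0" and \<epsilon>: "\<epsilon> > 0"
  defines "\<tau> \<equiv> 1 / (4 * real m)"
  defines "\<alpha> \<equiv> \<tau> * (real m + 1 / 2)" and "c \<equiv> (real m + 1) / 2 - \<tau>"
  defines "A \<equiv> 1 + \<epsilon> * \<alpha>"
  shows "(1 - (\<epsilon> * \<alpha>)\<^sup>2) * profile_integral m 1 1 \<kappa> \<le> profile_integral m A (1 + \<epsilon> * c) (\<epsilon> * (real m + 1) / A + \<kappa>)"
proof -
  have \<tau>: "\<tau> > 0" using m by (auto simp: \<tau>_def)
  have \<alpha>: "\<alpha> > 0" using \<tau> by (simp add: \<alpha>_def)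
  have A: "A > 0" using \<epsilon> \<alpha> by (simp add: A_def add_pos_pos)
  define g where "g a = \<alpha> * (max 0 (1 - \<kappa> * a)) ^ m + real m * (max 0 (1 - \<kappa> * a)) ^ (m - 1) * (c - (real m + 1) * a - \<kappa> * \<alpha> * a)" for a
  have g_int: "integrable lborel (\<lambda>a. g a * indicator {0..1} a)"
  proof -
    have "continuous_on {0..1} g" unfolding g_def by (intro continuous_intros)
    from borel_integrable_compact[OF compact_Icc this] show ?thesis by (simp add: indicator_def mult.commute)
  qed
  have g0: "0 \<le> (\<integral>a. g a * indicator {0..1} a \<partial>lborel)"
    using first_variation_section_nonneg[OF m \<kappa>] unfolding g_def \<alpha>_def c_def \<tau>_def .
  let ?D = "(\<epsilon> * (real m + 1) / A + \<kappa>) * A"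
  have D: "?D = \<epsilon> * (real m + 1) + \<kappa> + \<kappa> * (\<epsilon> * \<alpha>)" using A by (simp add: field_simps) (simp add: A_def algebra_simps)
  have "(1 - \<epsilon> * \<alpha>) * profile_integral m 1 1 \<kappa> \<le> (1 - \<epsilon> * \<alpha>) * profile_integral m 1 1 \<kappa> + \<epsilon> * (\<integral>a. g a * indicator {0..1} a \<partial>lborel)"
    using g0 \<epsilon> by simp
  also have "\<dots> = (\<integral>a. (1 - \<epsilon> * \<alpha>) * (indicator {0..1} a * (max 0 (1 - \<kappa> * a)) ^ m) + \<epsilon> * (g a * indicator {0..1} a) \<partial>lborel)"
    unfolding profile_integral_def using integrable_profile[of 1 1 \<kappa> m] g_int by simp
  also have "\<dots> \<le> profile_integral m 1 (1 + \<epsilon> * c) ?D"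
    unfolding profile_integral_def
  proof (rule integral_mono)
    show "integrable lborel (\<lambda>a. (1 - \<epsilon> * \<alpha>) * (indicator {0..1} a * (max 0 (1 - \<kappa> * a)) ^ m) + \<epsilon> * (g a * indicator {0..1} a))"
      using integrable_profile[of 1 1 \<kappa> m] g_int by (intro Bochner_Integration.integrable_add integrable_mult_right)
    fix a :: real
    show "(1 - \<epsilon> * \<alpha>) * (indicator {0..1} a * (max 0 (1 - \<kappa> * a)) ^ m) + \<epsilon> * (g a * indicator {0..1} a) \<le>
      indicator {0..1} a * (max 0 (1 + \<epsilon> * c - ?D * a)) ^ m"
    proof (cases "a \<in> {0..1}")
      case True
      let ?x = "1 - \<kappa> * a" and ?y = "1 + \<epsilon> * c - ?D * a"
      have yx: "?y - ?x = \<epsilon> * (c - (real m + 1) * a - \<kappa> * \<alpha> * a)" unfolding D by (simp add: algebra_simps)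
      have "(max 0 ?x) ^ m + real m * (max 0 ?x) ^ (m - 1) * (\<epsilon> * (c - (real m + 1) * a - \<kappa> * \<alpha> * a)) \<le> (max 0 ?y) ^ m"
        using power_positive_part_tangent[OF m, of ?x ?y] unfolding yx .
      moreover have "(1 - \<epsilon> * \<alpha>) * (max 0 ?x) ^ m + \<epsilon> * g a = (max 0 ?x) ^ m + real m * (max 0 ?x) ^ (m - 1) * (\<epsilon> * (c - (real m + 1) * a - \<kappa> * \<alpha> * a))"
        unfolding g_def by (simp add: left_diff_distrib distrib_left mult.left_commute mult.assoc)
      ultimately show ?thesis using True by simp
    qed simp
  qed (rule integrable_profile)
  finally have "A * ((1 - \<epsilon> * \<alpha>) * profile_integral m 1 1 \<kappa>) \<le> A * profile_integral m 1 (1 + \<epsilon> * c) ?D"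
    using A by (intro mult_left_mono) auto
  moreover have "A * ((1 - \<epsilon> * \<alpha>) * profile_integral m 1 1 \<kappa>) = (1 - (\<epsilon> * \<alpha>)\<^sup>2) * profile_integral m 1 1 \<kappa>"
    by (simp add: A_def algebra_simps power2_eq_square)
  ultimately show ?thesis using profile_integral_unit[OF A, of m "1 + \<epsilon> * c" "\<epsilon> * (real m + 1) / A + \<kappa>"] by simp
qed

text \<open>
  A second order Taylor bound; the constant \<open>3\<^sup>k\<close> is not optimal but makes the induction work.
\<close>

lemma power_one_plus_le:
  fixes y :: real
  assumes "\<bar>y\<bar> \<le> 1"
  shows "(1 + y) ^ k \<le> 1 + real k * y + 3 ^ k * y\<^sup>2"
proof (induction k)
  case (Suc k)
  have k: "real k \<le> 3 ^ k"
  proof (induction k)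
    case (Suc k)
    have "(1 :: real) \<le> 3 ^ k" by simp
    with Suc show ?case unfolding power_Suc of_nat_Suc by linarith
  qed simp
  have "(1 + y) ^ Suc k \<le> (1 + real k * y + 3 ^ k * y\<^sup>2) * (1 + y)"
    using mult_right_mono[OF Suc, of "1 + y"] assms by (simp add: mult.commute abs_le_iff)
  also have "\<dots> = 1 + real (Suc k) * y + (real k + 3 ^ k * (1 + y)) * y\<^sup>2" by (simp add: algebra_simps power2_eq_square)
  also have "(real k + 3 ^ k * (1 + y)) * y\<^sup>2 \<le> (3 ^ k + 3 ^ k * 2) * y\<^sup>2"
    using k assms by (intro mult_right_mono add_mono mult_left_mono) (auto simp: abs_le_iff)
  finally show ?case by simp
qed (use zero_le_power2 in auto)

text \<open>
  The first variation of the volume is \<open>\<alpha> - (m + 1) \<tau> = - \<tau> / 2\<close>. For small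
  \<open>\<epsilon>\<close> this outweighs all second order terms, including those on the right, where \<open>1 -
  (\<epsilon> \<alpha>)\<^sup>2\<close> is the bound for the relative loss of the sections. The square leaves room
  for the dilation in \<open>exists_counterexample_profile\<close>.
\<close>

lemma profile_integral_perturbed_volume:
  assumes m: "m \<ge> 2"
  defines "\<tau> \<equiv> 1 / (4 * real m)"
  defines "\<alpha> \<equiv> \<tau> * (real m + 1 / 2)" and "c \<equiv> (real m + 1) / 2 - \<tau>"
  obtains \<epsilon> where "\<epsilon> > 0" "\<epsilon> * \<alpha> < 1"
    "profile_integral (m + 1) (1 + \<epsilon> * \<alpha>) (1 + \<epsilon> * c) (\<epsilon> * (real m + 1) / (1 + \<epsilon> * \<alpha>)) < (1 - (\<epsilon> * \<alpha>)\<^sup>2)\<^sup>2"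
proof -
  have \<tau>: "\<tau> > 0" "\<tau> * real m = 1 / 4" "\<tau> \<le> 1" using m by (auto simp: \<tau>_def)
  have \<alpha>: "\<alpha> > 0" using \<tau> by (simp add: \<alpha>_def)
  define k where "k = real m + 1"
  define M where "M = 3 ^ (m + 1) * k\<^sup>2"
  have k: "k > 0" by (simp add: k_def add_nonneg_pos)
  have M: "M \<ge> 0" by (simp add: M_def)
  \<comment> \<open>\<open>Q \<epsilon>\<^sup>2\<close> collects the second order terms: \<open>M\<close> from the Taylor
    bound, \<open>\<alpha> M\<close> from its product with \<open>A\<close>, and \<open>2
    \<alpha>\<^sup>2\<close> from the right-hand side; the \<open>1\<close> makes the inequality strict.\<close>
  define Q where "Q = M + \<alpha> * M + 2 * \<alpha>\<^sup>2 + 1"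
  have Q: "Q > 0" using M \<alpha> by (simp add: Q_def add_nonneg_pos)
  define \<epsilon> where "\<epsilon> = min (min (1 / k) (1 / (\<alpha> + 1))) (\<tau> / (4 * Q))"
  have \<epsilon>: "\<epsilon> > 0" "\<epsilon> * k \<le> 1" "\<epsilon> * (\<alpha> + 1) \<le> 1" "\<epsilon> * (4 * Q) \<le> \<tau>"
  proof -
    show "\<epsilon> > 0" using k \<alpha> \<tau> Q by (auto simp: \<epsilon>_def)
    have "\<epsilon> \<le> 1 / k" "\<epsilon> \<le> 1 / (\<alpha> + 1)" "\<epsilon> \<le> \<tau> / (4 * Q)" by (auto simp: \<epsilon>_def)
    then show "\<epsilon> * k \<le> 1" "\<epsilon> * (\<alpha> + 1) \<le> 1" "\<epsilon> * (4 * Q) \<le> \<tau>" using k \<alpha> Q by (auto simp: le_divide_eq)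
  qed
  have \<epsilon>1: "\<epsilon> * \<alpha> < 1" "\<epsilon> \<le> 1"
    using \<epsilon>(1,3) mult_pos_pos[OF \<epsilon>(1) \<alpha>] by (simp_all add: distrib_left)
  define A where "A = 1 + \<epsilon> * \<alpha>"
  have A: "A > 0" using \<epsilon>(1) \<alpha> by (simp add: A_def add_pos_pos)
  define w where "w a = c - k * a" for a
  have "profile_integral (m + 1) A (1 + \<epsilon> * c) (\<epsilon> * k / A) = A * profile_integral (m + 1) 1 (1 + \<epsilon> * c) (\<epsilon> * k)"
    using profile_integral_unit[OF A, of "m + 1" "1 + \<epsilon> * c" "\<epsilon> * k / A"] A by simp
  also have "profile_integral (m + 1) 1 (1 + \<epsilon> * c) (\<epsilon> * k) \<le> (\<integral>a. (1 + k * (\<epsilon> * w a) + M * \<epsilon>\<^sup>2) * indicator {0..1} a \<partial>lborel)"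
    unfolding profile_integral_def
  proof (rule integral_mono)
    show "integrable lborel (\<lambda>a. (1 + k * (\<epsilon> * w a) + M * \<epsilon>\<^sup>2) * indicator {0..1} a)"
    proof -
      have "continuous_on {0..1} (\<lambda>a. 1 + k * (\<epsilon> * w a) + M * \<epsilon>\<^sup>2)" unfolding w_def by (intro continuous_intros)
      from borel_integrable_compact[OF compact_Icc this] show ?thesis by (simp add: indicator_def mult.commute)
    qed
    fix a :: real
    show "indicator {0..1} a * (max 0 (1 + \<epsilon> * c - \<epsilon> * k * a)) ^ (m + 1) \<le> (1 + k * (\<epsilon> * w a) + M * \<epsilon>\<^sup>2) * indicator {0..1} a"
    proof (cases "a \<in> {0..1}")
      case True
      have "\<bar>w a\<bar> \<le> k"
      proof -
        have "0 \<le> k * a" "k * a \<le> k" using True k by (auto simp: mult_left_le)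
        moreover have "real m \<ge> 2" using m by simp
        then have "0 \<le> c" "c \<le> k" using \<tau>(1,3) by (simp_all add: c_def k_def field_simps)
        ultimately show ?thesis by (simp add: w_def abs_le_iff)
      qed
      then have "\<bar>\<epsilon> * w a\<bar> \<le> \<epsilon> * k" using \<epsilon>(1) by (simp add: abs_mult)
      then have w1: "\<bar>\<epsilon> * w a\<bar> \<le> 1" using \<epsilon>(2) by linarith
      have "(\<epsilon> * w a)\<^sup>2 \<le> (\<epsilon> * k)\<^sup>2" using \<open>\<bar>\<epsilon> * w a\<bar> \<le> \<epsilon> * k\<close> by (simp add: abs_le_square_iff[symmetric])
      then have "3 ^ (m + 1) * (\<epsilon> * w a)\<^sup>2 \<le> 3 ^ (m + 1) * (\<epsilon> * k)\<^sup>2" by (intro mult_left_mono) auto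
      also have "\<dots> = M * \<epsilon>\<^sup>2" by (simp add: M_def power_mult_distrib)
      finally have "3 ^ (m + 1) * (\<epsilon> * w a)\<^sup>2 \<le> M * \<epsilon>\<^sup>2" .
      have "(1 + \<epsilon> * w a) ^ (m + 1) \<le> 1 + k * (\<epsilon> * w a) + M * \<epsilon>\<^sup>2"
      proof -
        have km: "real (m + 1) = k" by (simp add: k_def)
        have "(1 + \<epsilon> * w a) ^ (m + 1) \<le> 1 + k * (\<epsilon> * w a) + 3 ^ (m + 1) * (\<epsilon> * w a)\<^sup>2"
          using power_one_plus_le[OF w1, of "m + 1"] unfolding km .
        with \<open>3 ^ (m + 1) * (\<epsilon> * w a)\<^sup>2 \<le> M * \<epsilon>\<^sup>2\<close> show ?thesis by linarith
      qed
      moreover have "max 0 (1 + \<epsilon> * c - \<epsilon> * k * a) = 1 + \<epsilon> * w a"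
      proof -
        have "1 + \<epsilon> * c - \<epsilon> * k * a = 1 + \<epsilon> * w a" by (simp add: w_def algebra_simps)
        moreover have "0 \<le> 1 + \<epsilon> * w a" using w1 unfolding abs_le_iff by linarith
        ultimately show ?thesis by simp
      qed
      ultimately show ?thesis using True by (simp only: indicator_simps mult_1 mult_1_right)
    qed simp
  qed (rule integrable_profile)
  also have "(\<integral>a. (1 + k * (\<epsilon> * w a) + M * \<epsilon>\<^sup>2) * indicator {0..1} a \<partial>lborel) =
      ((1 + M * \<epsilon>\<^sup>2) * 1 + k * \<epsilon> * (c * 1 - k * 1\<^sup>2 / 2)) - ((1 + M * \<epsilon>\<^sup>2) * 0 + k * \<epsilon> * (c * 0 - k * 0\<^sup>2 / 2))"
    unfolding w_def by (rule integral_FTC_Icc_real) (auto intro!: derivative_eq_intros continuous_intros simp: algebra_simps)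
  also have "\<dots> = 1 - k * \<epsilon> * \<tau> + M * \<epsilon>\<^sup>2" by (simp add: c_def k_def field_simps)
  finally have V: "profile_integral (m + 1) A (1 + \<epsilon> * c) (\<epsilon> * k / A) \<le> A * (1 - k * \<epsilon> * \<tau> + M * \<epsilon>\<^sup>2)" using A by simp
  also have "\<dots> < (1 - (\<epsilon> * \<alpha>)\<^sup>2)\<^sup>2"
  proof -
    have "k * \<tau> = \<alpha> + \<tau> / 2" by (simp add: k_def \<alpha>_def algebra_simps)
    then have "A * (1 - k * \<epsilon> * \<tau> + M * \<epsilon>\<^sup>2) = (1 + \<epsilon> * \<alpha>) * (1 - \<epsilon> * (\<alpha> + \<tau> / 2) + M * \<epsilon>\<^sup>2)"
      by (simp add: A_def mult_ac)
    also have "\<dots> = 1 - \<epsilon> * \<tau> / 2 - \<epsilon>\<^sup>2 * (\<alpha> * (\<alpha> + \<tau> / 2)) + \<epsilon>\<^sup>2 * M + \<epsilon>\<^sup>2 * (\<epsilon> * (\<alpha> * M))"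
      by (simp add: algebra_simps power2_eq_square)
    also have "\<dots> \<le> 1 - \<epsilon> * \<tau> / 2 + \<epsilon>\<^sup>2 * M + \<epsilon>\<^sup>2 * (\<alpha> * M)"
    proof -
      have "0 \<le> \<epsilon>\<^sup>2 * (\<alpha> * (\<alpha> + \<tau> / 2))" using \<alpha> \<tau> by simp
      moreover have "\<epsilon>\<^sup>2 * (\<epsilon> * (\<alpha> * M)) \<le> \<epsilon>\<^sup>2 * (1 * (\<alpha> * M))" using \<epsilon>1 \<alpha> M by (intro mult_left_mono mult_right_mono) auto
      ultimately show ?thesis by simp
    qed
    also have "\<dots> < 1 - 2 * (\<epsilon> * \<alpha>)\<^sup>2"
    proof -
      have "\<epsilon> * (\<epsilon> * (4 * Q)) \<le> \<epsilon> * \<tau>" using \<epsilon> by (intro mult_left_mono) auto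
      then have "\<epsilon>\<^sup>2 * Q \<le> \<epsilon> * \<tau> / 4" by (simp add: power2_eq_square)
      moreover have "\<epsilon>\<^sup>2 * Q = \<epsilon>\<^sup>2 * M + \<epsilon>\<^sup>2 * (\<alpha> * M) + 2 * (\<epsilon> * \<alpha>)\<^sup>2 + \<epsilon>\<^sup>2"
        by (simp add: Q_def algebra_simps power_mult_distrib)
      moreover have "0 < \<epsilon>\<^sup>2" "0 < \<epsilon> * \<tau>" using \<epsilon>(1) \<tau> by auto
      ultimately show ?thesis by linarith
    qed
    also have "\<dots> \<le> (1 - (\<epsilon> * \<alpha>)\<^sup>2)\<^sup>2"
      using zero_le_power2[of "(\<epsilon> * \<alpha>)\<^sup>2"] by (simp add: power2_diff)
    finally show ?thesis .
  qed
  finally show ?thesis using that[OF \<epsilon>(1) \<epsilon>1(1)] by (simp add: A_def k_def)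
qed

lemma integral_indicator_bounds:
  fixes f :: "'a \<Rightarrow> real"
  assumes [measurable]: "D \<in> sets M" "f \<in> borel_measurable M" and fin: "emeasure M D < \<infinity>"
    and f: "\<And>x. x \<in> D \<Longrightarrow> lo \<le> f x \<and> f x \<le> hi" and lo: "0 \<le> lo"
  shows "lo * measure M D \<le> (\<integral>x. indicator D x * f x \<partial>M)" "(\<integral>x. indicator D x * f x \<partial>M) \<le> hi * measure M D"
proof -
  have ind: "integrable M (\<lambda>x. indicator D x * c)" for c :: real using fin by simp
  have int: "integrable M (\<lambda>x. indicator D x * f x)"
    using f lo by (intro Bochner_Integration.integrable_bound[OF ind[of hi]]) (force simp: indicator_def)+
  have m: "(\<integral>x. indicator D x * c \<partial>M) = c * measure M D" for c :: real
    using fin sets.sets_into_space[of D M] by (simp add: Int_absorb2)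
  show "lo * measure M D \<le> (\<integral>x. indicator D x * f x \<partial>M)"
    unfolding m[symmetric] by (rule integral_mono[OF ind int]) (use f in \<open>auto simp: indicator_def\<close>)
  show "(\<integral>x. indicator D x * f x \<partial>M) \<le> hi * measure M D"
    unfolding m[symmetric] by (rule integral_mono[OF int ind]) (use f in \<open>auto simp: indicator_def\<close>)
qed

section \<open>The negative part\<close>

text \<open>
  Hyperplanes not orthogonal to the axis are covered by \<open>profile\<close>, with \<open>\<kappa>\<close>
  determined by the direction; the orthogonal one is covered by \<open>top\<close>.
\<close>

lemma revolution_sections_le:
  fixes e \<xi> :: "complex ^ 'n"
  assumes e: "norm e = 1" and \<xi>: "norm \<xi> = 1" and n: "CARD('n) \<ge> 3"
    and A: "A > 0" and A': "A' > 0" and q: "0 \<le> q"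
    and top: "q * (max 0 B) ^ (CARD('n) - 1) \<le> (max 0 B') ^ (CARD('n) - 1)"
    and profile: "\<And>\<kappa>. \<kappa> \<ge> 0 \<Longrightarrow> q * profile_integral (CARD('n) - 2) A B (C + \<kappa>) \<le> profile_integral (CARD('n) - 2) A' B' (C' + \<kappa>)"
  shows "q * measure (hyperplane_measure \<xi>) (revolution_body e A B C) \<le> measure (hyperplane_measure \<xi>) (revolution_body e A' B' C')"
    and "emeasure (hyperplane_measure \<xi>) (revolution_body e A B C) < \<infinity>"
proof -
  have n2: "CARD('n) \<ge> 2" using n by simp
  define v where "v = 1 - (cmod (hprod e \<xi>))\<^sup>2"
  have "(cmod (hprod e \<xi>))\<^sup>2 \<le> 1" using power_mono[OF cmod_hprod_le[of e \<xi>], of 2] e \<xi> by simp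
  then consider "v > 0" | "(cmod (hprod e \<xi>))\<^sup>2 = 1" unfolding v_def by linarith
  then have "q * measure (hyperplane_measure \<xi>) (revolution_body e A B C) \<le> measure (hyperplane_measure \<xi>) (revolution_body e A' B' C') \<and>
    emeasure (hyperplane_measure \<xi>) (revolution_body e A B C) < \<infinity>"
  proof cases
    case 1
    define c where "c = unit_ball_vol (2 * (CARD('n) - 2)) * (unit_ball_vol 2 / v)"
    have c: "c \<ge> 0" using 1 by (simp add: c_def)
    have "v \<le> 1" by (simp add: v_def)
    then have \<kappa>: "(1 - v) / v \<ge> 0" using 1 by simp
    have em: "emeasure (hyperplane_measure \<xi>) (revolution_body e A B C) = ennreal (c * profile_integral (CARD('n) - 2) A B (C + (1 - v) / v))"
      if "A > 0" for A B C
      unfolding ennreal_mult'[OF c] unfolding c_def v_def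
      by (rule emeasure_revolution_section[OF e \<xi> n 1[unfolded v_def] that])
    have "measure (hyperplane_measure \<xi>) (revolution_body e A B C) = c * profile_integral (CARD('n) - 2) A B (C + (1 - v) / v)"
      if "A > 0" for A B C
      unfolding measure_def em[OF that] using c profile_integral_nonneg by (intro enn2real_ennreal mult_nonneg_nonneg)
    moreover have "c * (q * profile_integral (CARD('n) - 2) A B (C + (1 - v) / v)) \<le> c * profile_integral (CARD('n) - 2) A' B' (C' + (1 - v) / v)"
      by (intro mult_left_mono profile \<kappa> c)
    ultimately show ?thesis using A A' em[OF A] by (simp add: mult.left_commute)
  next
    case 2
    define c where "c = unit_ball_vol (2 * (CARD('n) - 1))"
    have c: "c \<ge> 0" by (simp add: c_def)
    have em: "emeasure (hyperplane_measure \<xi>) (revolution_body e A B C) = ennreal (c * (max 0 B) ^ (CARD('n) - 1))" if "A > 0" for A B C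
      using emeasure_revolution_section_parallel[OF e \<xi> n2 2 that] c by (simp add: c_def ennreal_mult')
    have "measure (hyperplane_measure \<xi>) (revolution_body e A B C) = c * (max 0 B) ^ (CARD('n) - 1)" if "A > 0" for A B C
      unfolding measure_def em[OF that] using c by (intro enn2real_ennreal mult_nonneg_nonneg) auto
    moreover have "c * (q * (max 0 B) ^ (CARD('n) - 1)) \<le> c * (max 0 B') ^ (CARD('n) - 1)"
      by (intro mult_left_mono top c)
    ultimately show ?thesis using A A' em[OF A] by (simp add: mult.left_commute)
  qed
  then show "q * measure (hyperplane_measure \<xi>) (revolution_body e A B C) \<le> measure (hyperplane_measure \<xi>) (revolution_body e A' B' C')"
    "emeasure (hyperplane_measure \<xi>) (revolution_body e A B C) < \<infinity>" by auto
qed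

text \<open>
  The deformed body has sections at least \<open>q\<close> times those of the unit cylinder and volume \<open>V <
  q\<^sup>2\<close>. Replacing \<open>(a, b)\<close> by \<open>(\<rho> a, \<rho> b)\<close> in the cylinder
  multiplies its sections by \<open>\<rho>\<^sup>m\<^sup>+\<^sup>1\<close> and its volume by
  \<open>\<rho>\<^sup>m\<^sup>+\<^sup>2\<close>. So the dilated cylinder has strictly smaller sections and
  strictly larger volume as soon as \<open>\<rho>\<^sup>m\<^sup>+\<^sup>1 < q\<close> and
  \<open>\<rho>\<^sup>m\<^sup>+\<^sup>2 > V\<close>.
\<close>

lemma exists_counterexample_profile:
  assumes m: "m \<ge> 2"
  obtains \<rho> A B C q where "0 < \<rho>" "\<rho> \<le> 1" "A > 0" "B \<ge> 1" "C \<ge> 0" "0 < q" "\<rho> ^ (m + 1) < q" "q \<le> 1"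
    "\<And>\<kappa>. \<kappa> \<ge> 0 \<Longrightarrow> q * profile_integral m 1 1 \<kappa> \<le> profile_integral m A B (C + \<kappa>)"
    "profile_integral (m + 1) A B C < \<rho> ^ (m + 2)"
proof -
  define \<tau> where "\<tau> = 1 / (4 * real m)"
  define \<alpha> where "\<alpha> = \<tau> * (real m + 1 / 2)"
  define c where "c = (real m + 1) / 2 - \<tau>"
  have \<tau>: "\<tau> > 0" "\<tau> \<le> 1" using m by (auto simp: \<tau>_def)
  have \<alpha>: "\<alpha> > 0" using \<tau> by (simp add: \<alpha>_def)
  have "real m \<ge> 2" using m by simp
  then have c: "c \<ge> 0" using \<tau> by (simp add: c_def field_simps)
  obtain \<epsilon> where \<epsilon>: "\<epsilon> > 0" "\<epsilon> * \<alpha> < 1"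
    and vol: "profile_integral (m + 1) (1 + \<epsilon> * \<alpha>) (1 + \<epsilon> * c) (\<epsilon> * (real m + 1) / (1 + \<epsilon> * \<alpha>)) < (1 - (\<epsilon> * \<alpha>)\<^sup>2)\<^sup>2"
    using profile_integral_perturbed_volume[OF m] unfolding \<tau>_def[symmetric] \<alpha>_def[symmetric] c_def[symmetric] by metis
  define A where "A = 1 + \<epsilon> * \<alpha>"
  define B where "B = 1 + \<epsilon> * c"
  define C where "C = \<epsilon> * (real m + 1) / A"
  define q where "q = 1 - (\<epsilon> * \<alpha>)\<^sup>2"
  define V where "V = profile_integral (m + 1) A B C"
  have A: "A > 0" using \<epsilon>(1) \<alpha> by (simp add: A_def add_pos_pos)
  have q: "0 < q" "q \<le> 1"
    using \<epsilon> \<alpha> power_strict_mono[OF \<epsilon>(2), of 2] by (simp_all add: q_def less_imp_le)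
  have V: "0 \<le> V" "V < q\<^sup>2" using vol by (simp_all add: V_def q_def A_def B_def C_def profile_integral_nonneg)
  have sV: "sqrt V < q" using V q by (simp add: real_less_lsqrt)
  \<comment> \<open>If \<open>\<rho>\<^sup>m\<^sup>+\<^sup>1 = \<theta> \<le> 1\<close>, then \<open>\<rho> \<ge>
    \<theta>\<close> and \<open>\<rho>\<^sup>m\<^sup>+\<^sup>2 \<ge> \<theta>\<^sup>2\<close>; hence any
    \<open>\<theta>\<close> between \<open>\<surd>V\<close> and \<open>q\<close> will do.\<close>
  define \<theta> where "\<theta> = (sqrt V + q) / 2"
  have \<theta>: "sqrt V < \<theta>" "\<theta> < q" "0 < \<theta>" using sV add_pos_nonneg[OF q(1) real_sqrt_ge_zero[OF V(1)]] by (simp_all add: \<theta>_def field_simps)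
  define \<rho> where "\<rho> = root (m + 1) \<theta>"
  have \<rho>: "\<rho> > 0" "\<rho> ^ (m + 1) = \<theta>"
  proof -
    show "\<rho> > 0" using \<theta> by (simp add: \<rho>_def)
    show "\<rho> ^ (m + 1) = \<theta>" unfolding \<rho>_def by (rule real_root_pow_pos2) (use \<theta> in auto)
  qed
  have \<rho>1: "\<rho> \<le> 1"
  proof (rule ccontr)
    assume "\<not> \<rho> \<le> 1"
    then have "1 \<le> \<rho> ^ (m + 1)" by (intro one_le_power) simp
    then show False using \<rho>(2) \<theta> q by linarith
  qed
  have "\<rho> ^ (m + 1) \<le> \<rho> ^ 1" using \<rho>(1) \<rho>1 by (intro power_decreasing) auto
  then have "\<theta> \<le> \<rho>" unfolding \<rho>(2) by simp
  then have "\<theta> * \<theta> \<le> \<rho> * \<rho> ^ (m + 1)" using \<rho> \<theta> by (intro mult_mono) auto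
  moreover have "V < \<theta> * \<theta>" using \<theta> V real_less_rsqrt by (metis power2_eq_square real_sqrt_less_iff real_sqrt_unique less_imp_le)
  ultimately have "V < \<rho> ^ (m + 2)" by simp
  moreover have "q * profile_integral m 1 1 \<kappa> \<le> profile_integral m A B (C + \<kappa>)" if "\<kappa> \<ge> 0" for \<kappa>
    using profile_integral_perturbed_ge[OF m that \<epsilon>(1)] unfolding \<tau>_def[symmetric] \<alpha>_def[symmetric] c_def[symmetric]
    by (simp add: A_def B_def C_def q_def)
  ultimately show ?thesis
    using that[OF \<rho>(1) \<rho>1 A _ _ q(1) _ q(2), of B C] \<epsilon> c A \<rho>(2) \<theta>(2) by (simp add: V_def B_def C_def)
qed

text \<open>
  Both inequalities of \<open>exists_counterexample_profile\<close> are strict with a relative margin that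
  survives a factor \<open>(1 + \<eta>) / (1 - \<eta>)\<close>. Scaling the two bodies by the same small
  \<open>t\<close> preserves the inequalities and keeps \<open>f\<close> between \<open>(1 - \<eta>) f 0\<close>
  and \<open>(1 + \<eta>) f 0\<close>.
\<close>

theorem exists_counterexample:
  fixes f :: "complex ^ 'n \<Rightarrow> real"
  assumes n: "CARD('n) \<ge> 4" and f: "continuous_on UNIV f" and f_pos: "\<And>x. f x > 0"
  shows "\<exists>K L. origin_symmetric_convex_body K \<and> origin_symmetric_convex_body L \<and>
    rotation_invariant K \<and> rotation_invariant L \<and>
    (\<forall>\<xi>\<in>sphere 0 1. mu_section f K (complex_hyperplane \<xi>) \<le> mu_section f L (complex_hyperplane \<xi>)) \<and>
    mu f K > mu f L"
proof -
  define m where "m = CARD('n) - 2"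
  have m: "m \<ge> 2" "CARD('n) - 1 = m + 1" "CARD('n) - 2 = m" using n by (auto simp: m_def)
  obtain \<rho> A B C q where \<rho>: "0 < \<rho>" "\<rho> \<le> 1" and A: "A > 0" and B: "B \<ge> 1" and C: "C \<ge> 0"
    and q: "0 < q" "\<rho> ^ (m + 1) < q" "q \<le> 1"
    and prof: "\<And>\<kappa>. \<kappa> \<ge> 0 \<Longrightarrow> q * profile_integral m 1 1 \<kappa> \<le> profile_integral m A B (C + \<kappa>)"
    and vol: "profile_integral (m + 1) A B C < \<rho> ^ (m + 2)"
    using exists_counterexample_profile[OF m(1)] by metis
  define V where "V = profile_integral (m + 1) A B C"
  have V: "0 \<le> V" "V < \<rho> ^ (m + 2)" using vol by (simp_all add: V_def profile_integral_nonneg)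
  define e :: "complex ^ 'n" where "e = axis undefined 1"
  have e: "norm e = 1" by (simp add: e_def)
  have f_meas [measurable]: "f \<in> borel_measurable borel" using f by (rule borel_measurable_continuous_onI)
  define \<theta> where "\<theta> = \<rho> ^ (m + 1)"
  define W where "W = \<rho> ^ (m + 2)"
  have \<theta>: "0 < \<theta>" "\<theta> < q" using \<rho> q by (auto simp: \<theta>_def)
  have W: "V < W" "0 < W" using V \<rho> by (auto simp: W_def)
  \<comment> \<open>Small enough for \<open>(1 + \<eta>) \<theta> < (1 - \<eta>) q\<close> and \<open>(1 + \<eta>) V < (1 -
    \<eta>) W\<close>.\<close>
  define \<eta> where "\<eta> = min (1 / 2) (min ((q - \<theta>) / (2 * (q + \<theta>))) ((W - V) / (2 * (W + V))))"
  have \<eta>: "0 < \<eta>" "\<eta> < 1" "\<eta> * (q + \<theta>) < q - \<theta>" "\<eta> * (W + V) < W - V"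
  proof -
    have pos: "0 < (q - \<theta>) / (2 * (q + \<theta>))" "0 < (W - V) / (2 * (W + V))" using \<theta> W V q by auto
    then show "0 < \<eta>" "\<eta> < 1" by (auto simp: \<eta>_def)
    have "\<eta> \<le> (q - \<theta>) / (2 * (q + \<theta>))" "\<eta> \<le> (W - V) / (2 * (W + V))" by (auto simp: \<eta>_def)
    then have "\<eta> * (2 * (q + \<theta>)) \<le> q - \<theta>" "\<eta> * (2 * (W + V)) \<le> W - V" using \<theta> W V q by (auto simp: le_divide_eq)
    moreover have "0 < \<eta> * (q + \<theta>)" "0 < \<eta> * (W + V)" using \<open>0 < \<eta>\<close> \<theta> W V q by (auto intro!: mult_pos_pos add_pos_nonneg)
    ultimately show "\<eta> * (q + \<theta>) < q - \<theta>" "\<eta> * (W + V) < W - V" by linarith+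
  qed
  have "isCont f 0" using f by (simp add: continuous_on_eq_continuous_at)
  then have "\<exists>d>0. \<forall>x. dist x 0 < d \<longrightarrow> dist (f x) (f 0) < \<eta> * f 0"
    using mult_pos_pos[OF \<eta>(1) f_pos[of 0]] unfolding continuous_at_eps_delta by blast
  then obtain d where d: "d > 0" and fd: "\<And>x. norm x < d \<Longrightarrow> \<bar>f x - f 0\<bar> < \<eta> * f 0"
    by (auto simp: dist_norm)
  \<comment> \<open>The squared circumradii of the two bodies are at most \<open>2 t\<close> and \<open>t (A + B)\<close>.\<close>
  define t where "t = d\<^sup>2 / (2 * (2 + A + B))"
  have t: "t > 0" using d A B by (simp add: t_def)
  have tb: "t * (A + B) < d\<^sup>2" "t * 2 < d\<^sup>2"
  proof -
    have "t * (2 * (2 + A + B)) = d\<^sup>2" using A B by (simp add: t_def)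
    then have eq: "t * 2 + t * 2 + (t * A + t * A) + (t * B + t * B) = d\<^sup>2" by (simp add: algebra_simps)
    have "0 < t * A" "0 < t * B" using t A B by auto
    then show "t * (A + B) < d\<^sup>2" "t * 2 < d\<^sup>2" using eq t unfolding distrib_left by linarith+
  qed
  define K where "K = revolution_body e (t * \<rho>) (t * \<rho>) 0"
  define L where "L = revolution_body e (t * A) (t * B) C"
  have tr: "t * \<rho> > 0" using t \<rho> by simp
  have tA: "t * A > 0" using t A by simp
  have tB: "t * B > 0" using t B by simp
  have K: "origin_symmetric_convex_body K" unfolding K_def by (rule origin_symmetric_revolution_body[OF e tr tr order_refl])
  have L: "origin_symmetric_convex_body L" unfolding L_def by (rule origin_symmetric_revolution_body[OF e tA tB C])
  have [measurable]: "K \<in> sets borel" "L \<in> sets borel" by (auto simp: K_def L_def)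
  define lo where "lo = (1 - \<eta>) * f 0"
  define hi where "hi = (1 + \<eta>) * f 0"
  have lo: "0 < lo" "0 < hi" using \<eta> f_pos[of 0] by (auto simp: lo_def hi_def)
  have f_bd: "lo \<le> f x \<and> f x \<le> hi" if "norm x < d" for x
    using fd[OF that] by (auto simp: lo_def hi_def algebra_simps abs_less_iff)
  have small: "norm x < d" if "(norm x)\<^sup>2 < d\<^sup>2" for x :: "complex ^ 'n"
    using that d by (intro power2_less_imp_less[of _ d]) auto
  have fK: "lo \<le> f x \<and> f x \<le> hi" if "x \<in> K" for x
  proof (rule f_bd[OF small])
    have "(norm x)\<^sup>2 \<le> t * \<rho> + t * \<rho>" using revolution_body_norm_le[OF order_refl that[unfolded K_def]] .
    also have "\<dots> \<le> t * 2" using \<rho> t mult_left_mono[of \<rho> 1 t] by simp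
    finally show "(norm x)\<^sup>2 < d\<^sup>2" using tb by simp
  qed
  have fL: "lo \<le> f x \<and> f x \<le> hi" if "x \<in> L" for x
  proof (rule f_bd[OF small])
    have "(norm x)\<^sup>2 \<le> t * A + t * B" using revolution_body_norm_le[OF C that[unfolded L_def]] .
    then show "(norm x)\<^sup>2 < d\<^sup>2" using tb by (simp add: distrib_left)
  qed
  have sections: "mu_section f K (complex_hyperplane \<xi>) \<le> mu_section f L (complex_hyperplane \<xi>)" if "\<xi> \<in> sphere 0 1" for \<xi>
  proof -
    have \<xi>: "norm \<xi> = 1" using that by simp
    let ?M = "hyperplane_measure \<xi>"
    have n3: "CARD('n) \<ge> 3" using n by simp
    let ?Q = "q / \<theta>"
    have scaled: "profile_integral m (t * \<rho>) (t * \<rho>) \<kappa> = t ^ (m + 1) * (\<theta> * profile_integral m 1 1 \<kappa>)" for \<kappa>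
      using profile_integral_scale[OF tr, of m 1 1 \<kappa>] by (simp add: \<theta>_def power_mult_distrib mult_ac)
    have scaledL: "profile_integral m (t * A) (t * B) D = t ^ (m + 1) * profile_integral m A B D" for D
      by (rule profile_integral_scale[OF t])
    have Q: "?Q * profile_integral m (t * \<rho>) (t * \<rho>) (0 + \<kappa>) \<le> profile_integral m (t * A) (t * B) (C + \<kappa>)" if "\<kappa> \<ge> 0" for \<kappa>
      unfolding scaled scaledL using mult_left_mono[OF prof[OF that], of "t ^ (m + 1)"] t \<theta> by (simp add: field_simps)
    have top: "?Q * (max 0 (t * \<rho>)) ^ (m + 1) \<le> (max 0 (t * B)) ^ (m + 1)"
    proof -
      have "?Q * (max 0 (t * \<rho>)) ^ (m + 1) = t ^ (m + 1) * q"
        using tr \<theta> \<rho> t by (simp add: power_mult_distrib \<theta>_def max_def field_simps)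
      also have "\<dots> \<le> t ^ (m + 1) * B ^ (m + 1)"
        using t q one_le_power[OF B, of "m + 1"] by (intro mult_left_mono) auto
      also have "\<dots> = (max 0 (t * B)) ^ (m + 1)" using tB by (simp add: power_mult_distrib max_def)
      finally show ?thesis .
    qed
    have Q0: "0 \<le> ?Q" using q \<theta> by simp
    have cmp: "?Q * measure ?M K \<le> measure ?M L" "emeasure ?M K < \<infinity>"
      unfolding K_def L_def using revolution_sections_le[OF e \<xi> n3 tr tA Q0, where B = "t * \<rho>" and B' = "t * B" and C = 0 and C' = C] Q top
      unfolding m(2,3) by auto
    have finL: "emeasure ?M L < \<infinity>"
      unfolding L_def using revolution_sections_le(2)[OF e \<xi> n3 tA tA zero_le_one, where B = "t * B" and B' = "t * B" and C = C and C' = C] by auto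
    have "mu_section f K (complex_hyperplane \<xi>) \<le> hi * measure ?M K"
      unfolding mu_section_hyperplane[OF f_meas \<open>K \<in> sets borel\<close>]
      by (rule integral_indicator_bounds(2)[OF _ _ cmp(2) fK]) (use lo in auto)
    also have "hi * measure ?M K \<le> lo * measure ?M L"
    proof -
      have "hi * \<theta> \<le> lo * q"
      proof -
        have "(1 + \<eta>) * \<theta> \<le> (1 - \<eta>) * q" using \<eta>(3) by (simp add: algebra_simps)
        then have "f 0 * ((1 + \<eta>) * \<theta>) \<le> f 0 * ((1 - \<eta>) * q)" using f_pos[of 0] by (intro mult_left_mono) auto
        then show ?thesis by (simp add: hi_def lo_def mult_ac)
      qed
      then have "hi \<le> lo * ?Q" using \<theta> by (simp add: field_simps)
      then have "hi * measure ?M K \<le> lo * ?Q * measure ?M K" by (rule mult_right_mono) simp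
      also have "\<dots> \<le> lo * measure ?M L" using cmp(1) lo by (simp only: mult.assoc) (rule mult_left_mono, auto)
      finally show ?thesis .
    qed
    also have "\<dots> \<le> mu_section f L (complex_hyperplane \<xi>)"
      unfolding mu_section_hyperplane[OF f_meas \<open>L \<in> sets borel\<close>]
      by (rule integral_indicator_bounds(1)[OF _ _ finL fL]) (use lo in auto)
    finally show ?thesis .
  qed
  have volume: "mu f K > mu f L"
  proof -
    have n2: "CARD('n) \<ge> 2" using n by simp
    define c where "c = unit_ball_vol (2 * (m + 1)) * unit_ball_vol 2"
    have c: "c > 0" unfolding c_def by (intro mult_pos_pos unit_ball_vol_pos) auto
    have em: "emeasure lborel (revolution_body e A B C) = ennreal (c * profile_integral (m + 1) A B C)" if "A > 0" for A B C
      unfolding ennreal_mult'[OF less_imp_le[OF c]] unfolding c_def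
      using emeasure_revolution_body[OF e n2 that, of B C] unfolding m(2) .
    have ms: "measure lborel (revolution_body e A B C) = c * profile_integral (m + 1) A B C" if "A > 0" for A B C
      unfolding measure_def em[OF that] using c profile_integral_nonneg by (intro enn2real_ennreal mult_nonneg_nonneg) auto
    have unit: "profile_integral (m + 1) 1 1 0 = 1" by (simp add: profile_integral_def)
    have volK: "measure lborel K = c * t ^ (m + 2) * W"
      unfolding K_def ms[OF tr] using profile_integral_scale[OF tr, of "m + 1" 1 1 0] unit
      by (simp add: W_def power_mult_distrib mult_ac)
    have volL: "measure lborel L = c * t ^ (m + 2) * V"
      unfolding L_def ms[OF tA] using profile_integral_scale[OF t, of "m + 1" A B C] by (simp add: V_def)
    have "mu f L \<le> hi * measure lborel L"
      unfolding mu_def set_lebesgue_integral_def real_scaleR_def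
      by (rule integral_indicator_bounds(2)[OF _ _ _ fL]) (use lo em[OF tA] in \<open>auto simp: L_def\<close>)
    also have "hi * measure lborel L < lo * measure lborel K"
    proof -
      have "(1 + \<eta>) * V < (1 - \<eta>) * W" using \<eta>(4) by (simp add: algebra_simps)
      then have "(f 0 * (c * t ^ (m + 2))) * ((1 + \<eta>) * V) < (f 0 * (c * t ^ (m + 2))) * ((1 - \<eta>) * W)"
        using f_pos[of 0] c t by (intro mult_strict_left_mono) auto
      then show ?thesis unfolding volK volL hi_def lo_def by (simp only: mult_ac)
    qed
    also have "lo * measure lborel K \<le> mu f K"
      unfolding mu_def set_lebesgue_integral_def real_scaleR_def
      by (rule integral_indicator_bounds(1)[OF _ _ _ fK]) (use lo em[OF tr] in \<open>auto simp: K_def\<close>)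
    finally show ?thesis .
  qed
  have "rotation_invariant K" "rotation_invariant L" by (simp_all add: K_def L_def rotation_invariant_revolution_body)
  with K L sections volume show ?thesis by blast
qed

theorem mainTheorem1:
  fixes f :: "complex ^ 'n \<Rightarrow> real"
  assumes "CARD('n) \<ge> 2"
    and "continuous_on UNIV f"
    and "\<And>x. f x > 0"
    and "\<And>x. f (- x) = f x"
  shows "(CARD('n) \<le> 3 \<longrightarrow>
           (\<forall>K L. origin_symmetric_convex_body K \<and> origin_symmetric_convex_body L \<and>
              rotation_invariant K \<and> rotation_invariant L \<and>
              (\<forall>\<xi>\<in>sphere 0 1. mu_section f K (complex_hyperplane \<xi>)
                                  \<le> mu_section f L (complex_hyperplane \<xi>))
              \<longrightarrow> mu f K \<le> mu f L)) \<and>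
         (CARD('n) \<ge> 4 \<longrightarrow>
           (\<exists>K L. origin_symmetric_convex_body K \<and> origin_symmetric_convex_body L \<and>
              rotation_invariant K \<and> rotation_invariant L \<and>
              (\<forall>\<xi>\<in>sphere 0 1. mu_section f K (complex_hyperplane \<xi>)
                                  \<le> mu_section f L (complex_hyperplane \<xi>))
              \<and> mu f K > mu f L))"
proof (intro conjI impI allI)
  fix K L :: "(complex ^ 'n) set"
  assume n: "CARD('n) \<le> 3"
    and KL: "origin_symmetric_convex_body K \<and> origin_symmetric_convex_body L \<and>
      rotation_invariant K \<and> rotation_invariant L \<and>
      (\<forall>\<xi>\<in>sphere 0 1. mu_section f K (complex_hyperplane \<xi>) \<le> mu_section f L (complex_hyperplane \<xi>))"
  have "CARD('n) = 2 \<or> CARD('n) = 3" using n assms(1) by linarith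
  then show "mu f K \<le> mu f L"
    using KL by (intro mu_le_if_sections_le assms(2,3)) auto
next
  assume "CARD('n) \<ge> 4"
  then show "\<exists>K L. origin_symmetric_convex_body K \<and> origin_symmetric_convex_body L \<and>
      rotation_invariant K \<and> rotation_invariant L \<and>
      (\<forall>\<xi>\<in>sphere 0 1. mu_section f K (complex_hyperplane \<xi>) \<le> mu_section f L (complex_hyperplane \<xi>)) \<and>
      mu f K > mu f L"
    by (rule exists_counterexample[OF _ assms(2,3)])
qed

end
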